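(* Let $n,q\ge 1$ and $N\ge 1$ be integers, and let $X$ be a germ at a point $x\in\mathbb P^N$ of a smooth complex analytic submanifold of $\mathbb P^N$ of dimension $n$. Assume that $X$ is $q$-regular at $x$, and that for every generic $y\in X$ there exists a rational normal curve of degree $q$ in $\mathbb P^N$, locally contained in $X$, passing through $x$ and $y$. Then $X$ is the germ at $x$ of a Veronese variety of order $q$ (of dimension $n$).
   Context: Everything is over $\mathbb C$. A subvariety of dimension $n$ of a projective space is a Veronese variety of order $q$ if, in the projective space it spans, it is the image of $\mathbb P^n$ under an embedding associated with the complete linear system $|\mathcal O_{\mathbb P^n}(q)|$ (so it spans a space of dimension $\binom{n+q}{q}-1$). A rational normal curve of degree $q$ is a Veronese variety of dimension $1$ and order $q$ (it spans a projective subspace of dimension $q$). Osculating space and regularity: for a germ of smooth variety $X\subset\mathbb P^N$ of dimension $n$ and $x\in X$, the osculating space $X_x(q)$ of order $q$ is the projective subspace of $\mathbb P^N$ passing through $x$ whose direction is the vector space spanned by the derivatives at $x$ of orders $1,\dots,q$ (computed in an affine chart) of germs of parametrized curves lying on $X$. $X$ is $q$-regular at $x$ if $X_x(q)$ has the maximal possible dimension $\binom{n+q}{q}-1$. The germ $X$ is identified with a sufficiently small connected representative; "generic $y\in X$" means $y$ outside a nowhere dense analytic subset of $X$. That a curve $C$ through $x$ is locally contained in $X$ means that the germ of $C$ at $x$ is contained in the germ $X$. *)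

theory Defs
  imports "HOL-Analysis.Analysis"
begin

section \<open>Complex projective space\<close>

text \<open>
  For a finite type \<open>'N\<close> with \<open>N\<close> elements, the type \<open>'N proj\<close> is the projective space of
  dimension \<open>N\<close>: its points are the lines of the complex vector space with coordinates indexed
  by \<open>'N option\<close>, a type with \<open>N + 1\<close> elements.
\<close>

typedef (overloaded) ('N::finite) proj =
  "{L :: (complex ^ 'N option) set. \<exists>v. v \<noteq> 0 \<and> L = vec.span {v}}"
  morphisms line_of proj_of_line
proof -
  have "(axis None 1 :: complex ^ 'N option) \<noteq> 0"
    by (simp add: axis_eq_0_iff)
  then show ?thesis by blast
qed

definition proj_point :: "complex ^ 'N::finite option \<Rightarrow> 'N proj" where
  "proj_point v = proj_of_line (vec.span {v})"

lemma line_of_proj_point: "v \<noteq> 0 \<Longrightarrow> line_of (proj_point v) = vec.span {v}"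
  unfolding proj_point_def by (subst proj_of_line_inverse) auto

text \<open>The quotient topology.\<close>

instantiation proj :: (finite) topological_space
begin

definition open_proj :: "'a proj set \<Rightarrow> bool" where
  "open_proj U \<longleftrightarrow> open {v :: complex ^ 'a option. v \<noteq> 0 \<and> proj_point v \<in> U}"

instance
proof
  have "{v :: complex ^ 'a option. v \<noteq> 0 \<and> proj_point v \<in> UNIV} = - {0}"
    by auto
  then show "open (UNIV :: 'a proj set)"
    unfolding open_proj_def by (simp add: open_Compl)
next
  fix S T :: "'a proj set"
  assume "open S" "open T"
  then have "open ({v. v \<noteq> 0 \<and> proj_point v \<in> S} \<inter> {v. v \<noteq> 0 \<and> proj_point v \<in> T})"
    unfolding open_proj_def by (rule open_Int)
  moreover have "{v. v \<noteq> 0 \<and> proj_point v \<in> S} \<inter> {v. v \<noteq> 0 \<and> proj_point v \<in> T}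
      = {v. v \<noteq> 0 \<and> proj_point v \<in> S \<inter> T}"
    by auto
  ultimately show "open (S \<inter> T)"
    unfolding open_proj_def by simp
next
  fix K :: "'a proj set set"
  assume "\<forall>S\<in>K. open S"
  then have "open (\<Union>S\<in>K. {v. v \<noteq> 0 \<and> proj_point v \<in> S})"
    unfolding open_proj_def by blast
  moreover have "(\<Union>S\<in>K. {v. v \<noteq> 0 \<and> proj_point v \<in> S}) = {v. v \<noteq> 0 \<and> proj_point v \<in> \<Union>K}"
    by auto
  ultimately show "open (\<Union>K)"
    unfolding open_proj_def by simp
qed

end

text \<open>
  The standard affine chart with index \<open>i\<close> is the set of points whose \<open>i\<close>-th homogeneous
  coordinate is nonzero.  A point of it is represented by its homogeneous coordinate vector
  normalized by \<open>z $ i = 1\<close>; the chart is thereby identified with an affine hyperplane, the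
  direction of which is the vector space \<open>{z. z $ i = 0}\<close>.
\<close>

definition affine_chart :: "'N::finite option \<Rightarrow> 'N proj set" where
  "affine_chart i = {p. \<exists>z\<in>line_of p. z $ i \<noteq> 0}"

definition affine_coords :: "'N::finite option \<Rightarrow> 'N proj \<Rightarrow> complex ^ 'N option" where
  "affine_coords i p = (THE z. z \<in> line_of p \<and> z $ i = 1)"

lemma affine_coords_proj_point:
  assumes "v $ i \<noteq> 0"
  shows "affine_coords i (proj_point v) = inverse (v $ i) *s v"
proof -
  have "v \<noteq> 0" using assms by auto
  then have "line_of (proj_point v) = range (\<lambda>c. c *s v)"
    by (simp add: line_of_proj_point vec.span_singleton)
  then show ?thesis
    unfolding affine_coords_def using assms
    by (intro the_equality) (auto simp: field_simps)
qed

definition projective_subspace :: "(complex ^ 'N::finite option) set \<Rightarrow> 'N proj set" where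
  "projective_subspace L = {p. line_of p \<subseteq> L}"

definition has_projective_dim :: "'N::finite proj set \<Rightarrow> nat \<Rightarrow> bool" where
  "has_projective_dim S d \<longleftrightarrow>
     (\<exists>L. vec.subspace L \<and> vec.dim L = d + 1 \<and> S = projective_subspace L)"


section \<open>Complex submanifolds of projective space\<close>

text \<open>Holomorphic functions of several variables: the real Frechet derivative exists and is
  complex linear.\<close>

definition holomorphic_several :: "(complex ^ 'n::finite \<Rightarrow> complex) \<Rightarrow> (complex ^ 'n) set \<Rightarrow> bool"
  where "holomorphic_several f \<Omega> \<longleftrightarrow>
    (\<forall>u\<in>\<Omega>. \<exists>D. (f has_derivative D) (at u) \<and> (\<forall>c h. D (c *s h) = c * D h))"

text \<open>
  A local parametrization of \<open>X\<close>: a holomorphic immersion of an open subset of \<open>\<complex>\<^sup>n\<close>, with values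
  in one of the standard affine charts, which is a homeomorphism onto an open subset of \<open>X\<close>.
\<close>

definition local_parametrization ::
  "'N::finite proj set \<Rightarrow> (complex ^ 'n::finite) set \<Rightarrow> (complex ^ 'n \<Rightarrow> 'N proj) \<Rightarrow> bool" where
  "local_parametrization X \<Omega> \<sigma> \<longleftrightarrow>
     open \<Omega> \<and>
     openin (top_of_set X) (\<sigma> ` \<Omega>) \<and>
     (\<exists>\<tau>. homeomorphism \<Omega> (\<sigma> ` \<Omega>) \<sigma> \<tau>) \<and>
     (\<exists>i. \<sigma> ` \<Omega> \<subseteq> affine_chart i \<and>
          (\<forall>j. holomorphic_several (\<lambda>u. affine_coords i (\<sigma> u) $ j) \<Omega>) \<and>
          (\<forall>u\<in>\<Omega>. inj (frechet_derivative (\<lambda>u. affine_coords i (\<sigma> u)) (at u))))"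

text \<open>The type argument \<open>'n\<close> gives the dimension \<open>n = CARD('n)\<close> of the submanifold.\<close>

definition complex_submanifold :: "'n::finite itself \<Rightarrow> 'N::finite proj set \<Rightarrow> bool" where
  "complex_submanifold TYPE('n) X \<longleftrightarrow>
     (\<forall>p\<in>X. \<exists>(\<Omega> :: (complex ^ 'n) set) \<sigma>. local_parametrization X \<Omega> \<sigma> \<and> p \<in> \<sigma> ` \<Omega>)"

definition analytic_subset ::
  "'n::finite itself \<Rightarrow> 'N::finite proj set \<Rightarrow> 'N proj set \<Rightarrow> bool" where
  "analytic_subset TYPE('n) X Z \<longleftrightarrow>
     Z \<subseteq> X \<and>
     (\<forall>p\<in>X. \<exists>(\<Omega> :: (complex ^ 'n) set) \<sigma> F.
        local_parametrization X \<Omega> \<sigma> \<and> p \<in> \<sigma> ` \<Omega> \<and>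
        finite F \<and> (\<forall>f\<in>F. holomorphic_several f \<Omega>) \<and>
        (\<forall>u\<in>\<Omega>. \<sigma> u \<in> Z \<longleftrightarrow> (\<forall>f\<in>F. f u = 0)))"

definition nowhere_dense_in :: "'a::topological_space set \<Rightarrow> 'a set \<Rightarrow> bool" where
  "nowhere_dense_in X Z \<longleftrightarrow> top_of_set X interior_of (top_of_set X closure_of Z) = {}"

text \<open>A property of generic points of \<open>X\<close>.\<close>

definition generically ::
  "'n::finite itself \<Rightarrow> 'N::finite proj set \<Rightarrow> ('N proj \<Rightarrow> bool) \<Rightarrow> bool" where
  "generically TYPE('n) X P \<longleftrightarrow>
     (\<exists>Z. analytic_subset TYPE('n) X Z \<and> nowhere_dense_in X Z \<and> (\<forall>y\<in>X - Z. P y))"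

text \<open>Inclusion and equality of germs at \<open>x\<close>.\<close>

definition germ_subset :: "'a::topological_space \<Rightarrow> 'a set \<Rightarrow> 'a set \<Rightarrow> bool" where
  "germ_subset x A B \<longleftrightarrow> (\<exists>U. open U \<and> x \<in> U \<and> A \<inter> U \<subseteq> B)"

definition germ_eq :: "'a::topological_space \<Rightarrow> 'a set \<Rightarrow> 'a set \<Rightarrow> bool" where
  "germ_eq x A B \<longleftrightarrow> (\<exists>U. open U \<and> x \<in> U \<and> A \<inter> U = B \<inter> U)"


section \<open>Osculating spaces and regularity\<close>

text \<open>Germs at \<open>0\<close> of holomorphic parametrized curves on \<open>X\<close> with \<open>\<gamma> 0 = x\<close>, where \<open>x\<close> is a
  point of the affine chart \<open>i\<close>.\<close>

definition curve_germ_on ::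
  "'N::finite option \<Rightarrow> 'N proj set \<Rightarrow> 'N proj \<Rightarrow> (complex \<Rightarrow> 'N proj) \<Rightarrow> bool" where
  "curve_germ_on i X x \<gamma> \<longleftrightarrow>
     \<gamma> 0 = x \<and>
     (\<exists>r>0. \<gamma> ` ball 0 r \<subseteq> X \<inter> affine_chart i \<and>
            (\<forall>j. (\<lambda>t. affine_coords i (\<gamma> t) $ j) holomorphic_on ball 0 r))"

definition curve_derivative ::
  "'N::finite option \<Rightarrow> nat \<Rightarrow> (complex \<Rightarrow> 'N proj) \<Rightarrow> complex ^ 'N option" where
  "curve_derivative i k \<gamma> = (\<chi> j. (deriv ^^ k) (\<lambda>t. affine_coords i (\<gamma> t) $ j) 0)"

definition osculating_direction ::
  "'N::finite option \<Rightarrow> nat \<Rightarrow> 'N proj set \<Rightarrow> 'N proj \<Rightarrow> (complex ^ 'N option) set" where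
  "osculating_direction i q X x =
     vec.span {curve_derivative i k \<gamma> | k \<gamma>. 1 \<le> k \<and> k \<le> q \<and> curve_germ_on i X x \<gamma>}"

text \<open>
  The projective subspace that passes through \<open>x\<close> and has the direction \<open>D\<close> in the affine chart
  \<open>i\<close> is the projective closure of the affine space \<open>affine_coords i x + D\<close>, hence the one
  associated with the vector space spanned by \<open>affine_coords i x\<close> and \<open>D\<close>.
\<close>

definition osculating_space ::
  "'N::finite option \<Rightarrow> nat \<Rightarrow> 'N proj set \<Rightarrow> 'N proj \<Rightarrow> 'N proj set" where
  "osculating_space i q X x =
     projective_subspace (vec.span (insert (affine_coords i x) (osculating_direction i q X x)))"

text \<open>The osculating space does not depend on the affine chart containing \<open>x\<close>.\<close>

definition q_regular :: "nat \<Rightarrow> nat \<Rightarrow> 'N::finite proj set \<Rightarrow> 'N proj \<Rightarrow> bool" where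
  "q_regular n q X x \<longleftrightarrow>
     (\<exists>i. x \<in> affine_chart i \<and>
          has_projective_dim (osculating_space i q X x) (((n + q) choose q) - 1))"


section \<open>Veronese varieties\<close>

text \<open>Forms of degree \<open>q\<close> in homogeneous coordinates indexed by \<open>'k\<close>, as polynomial
  functions; a monomial is given by its exponents.\<close>

definition exponents :: "nat \<Rightarrow> ('k::finite \<Rightarrow> nat) set" where
  "exponents q = {\<alpha>. (\<Sum>i\<in>UNIV. \<alpha> i) = q}"

lemma finite_exponents: "finite (exponents q :: ('k::finite \<Rightarrow> nat) set)"
proof (rule finite_subset)
  have "\<alpha> i \<le> sum \<alpha> UNIV" for \<alpha> :: "'k \<Rightarrow> nat" and i
    by (rule member_le_sum) auto
  then show "exponents q \<subseteq> PiE (UNIV :: 'k set) (\<lambda>_. {..q})"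
    by (auto simp: exponents_def)
  show "finite (PiE (UNIV :: 'k set) (\<lambda>_. {..q}))"
    by (rule finite_PiE) auto
qed

definition forms :: "nat \<Rightarrow> (complex ^ 'k::finite \<Rightarrow> complex) set" where
  "forms q = {f. \<exists>c. f = (\<lambda>s. \<Sum>\<alpha>\<in>exponents q. c \<alpha> * (\<Prod>i\<in>UNIV. (s $ i) ^ \<alpha> i))}"

text \<open>\<open>\<phi> 0, \<dots>, \<phi> (m - 1)\<close> is a basis of the space of forms of degree \<open>q\<close>, that is, of the space
  of global sections of the line bundle \<open>O(q)\<close>.\<close>

definition forms_basis :: "nat \<Rightarrow> nat \<Rightarrow> (nat \<Rightarrow> complex ^ 'k::finite \<Rightarrow> complex) \<Rightarrow> bool" where
  "forms_basis q m \<phi> \<longleftrightarrow>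
     (\<forall>j<m. \<phi> j \<in> forms q) \<and>
     (\<forall>f\<in>forms q. \<exists>!c. c \<in> {..<m} \<rightarrow>\<^sub>E UNIV \<and> f = (\<lambda>s. \<Sum>j<m. c j * \<phi> j s))"

text \<open>
  Veronese varieties of dimension \<open>CARD('n)\<close> and order \<open>q\<close>: the vectors \<open>w j\<close> are a basis of
  the vector space associated with the projective space spanned by \<open>V\<close>, and in the homogeneous
  coordinates of that space which this basis defines, \<open>V\<close> is the image of the map given by a
  basis of the complete linear system of forms of degree \<open>q\<close>.
\<close>

definition veronese_variety :: "'n::finite itself \<Rightarrow> nat \<Rightarrow> 'N::finite proj set \<Rightarrow> bool" where
  "veronese_variety TYPE('n) q V \<longleftrightarrow>
     (\<exists>m (\<phi> :: nat \<Rightarrow> complex ^ 'n option \<Rightarrow> complex) (w :: nat \<Rightarrow> complex ^ 'N option).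
        forms_basis q m \<phi> \<and>
        inj_on w {..<m} \<and> vec.independent (w ` {..<m}) \<and>
        V = {proj_point (\<Sum>j<m. \<phi> j s *s w j) | s. s \<noteq> 0})"

definition rational_normal_curve :: "nat \<Rightarrow> 'N::finite proj set \<Rightarrow> bool" where
  "rational_normal_curve q C \<longleftrightarrow> veronese_variety TYPE(1) q C"

end

theory Submission
  imports Defs "HOL-Complex_Analysis.Conformal_Mappings" "HOL-Computational_Algebra.Polynomial"
begin

text \<open>
  Let \<open>F\<close> be the affine coordinates of \<open>X\<close> near \<open>x\<close> in a local parameter \<open>u\<close>.  By regularity every
  jet of order \<open>q\<close> at \<open>u = 0\<close> is the jet of a linear functional of \<open>F\<close>.  Along a rational normal curve
  through \<open>x\<close> with velocity \<open>a\<close>, a linear functional is a polynomial of degree at most \<open>q\<close> in the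
  parameter, so it is determined by its jet of order \<open>q\<close>.

  First, the functionals with the jets \<open>u\<^sub>k\<^sup>q\<^sup>-\<^sup>1 u\<^sub>j\<close> are proportional to \<open>a\<^sub>k\<^sup>q\<^sup>-\<^sup>1 a\<^sub>j\<close> on the whole
  curve.  Hence they have the form \<open>g\<^sub>k\<^sup>q\<^sup>-\<^sup>1 g\<^sub>j\<close>, where \<open>g\<close> is proportional to \<open>a\<close>; the functions \<open>g\<^sub>j\<close>
  are \<open>q\<close>-th roots, defined on a cone around each axis and glued on a punctured neighbourhood.
  Second, the functionals whose jets are those of \<open>g\<^sub>k\<^sup>q\<^sup>-\<^sup>1\<close> are \<open>a\<^sub>k\<^sup>q\<^sup>-\<^sup>1 t\<^sup>q\<^sup>-\<^sup>1 (1 + b t)\<close> on the curve, with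
  \<open>b\<close> independent of \<open>k\<close>.  Ratios of these two kinds of functionals give functions on \<open>X\<close> equal to
  the monomials of degree \<open>q\<close> in \<open>(1 + b t, a t)\<close> on every curve, up to a common factor.  The jets of
  these functions are a basis of all jets, so each coordinate of \<open>F\<close> agrees to order \<open>q\<close> with a
  combination of them, hence agrees exactly along each curve, hence on \<open>X\<close>.
\<close>

section \<open>Complex differentiability in several variables\<close>

text \<open>A curve is tied to the germ at two places only, by its jet at \<open>t = 0\<close> and
  by its value at \<open>t = 1\<close>; between them it may leave the germ. Information passes from
  one to the other because functionals on a curve are polynomials of degree at most
  \<open>q\<close>. The parameter \<open>u\<close> is not adapted to the curves: a functional with a
  jet of pure degree \<open>q\<close> restricts to one power of \<open>t\<close>, but lower order
  jets do not. The vector \<open>g\<close> gives the direction of the curve, up to an unknown scalar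
  factor. The jets of its powers \<open>g\<^sub>k\<^sup>q\<^sup>-\<^sup>1\<close> start in degree
  \<open>q - 1\<close>, so on a curve a single coefficient \<open>b\<close> stays undetermined. It
  absorbs the choice of a projective parameter on the curve; the value of
  \<open>a t / (1 + b t)\<close> at the endpoint depends on that point alone. The
  \<open>q\<close>-th roots are defined after division by a coordinate, hence on cones that all end
  at the origin, where nothing is known about them. This is why Taylor expansions are needed for
  bounded functions on a punctured neighbourhood.\<close>

text \<open>Pointwise, in contrast to \<open>holomorphic_several\<close>, so that holomorphy on an
  unspecified neighbourhood, punctured neighbourhood or cone is stated as \<open>cdiff\<close>
  holding eventually.\<close>

definition cdiff :: "(complex ^ 'n::finite \<Rightarrow> complex) \<Rightarrow> complex ^ 'n \<Rightarrow> bool" where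
  "cdiff f u \<longleftrightarrow> (\<exists>D. (f has_derivative D) (at u) \<and> (\<forall>c h. D (c *s h) = c * D h))"

lemma holomorphic_several_iff_cdiff: "holomorphic_several f \<Omega> \<longleftrightarrow> (\<forall>u\<in>\<Omega>. cdiff f u)"
  by (simp add: holomorphic_several_def cdiff_def)

lemma cdiffI: "(f has_derivative D) (at u) \<Longrightarrow> (\<And>c h. D (c *s h) = c * D h) \<Longrightarrow> cdiff f u"
  by (auto simp: cdiff_def)

lemma cdiff_const: "cdiff (\<lambda>_. c) u"
  by (rule cdiffI[where D = "\<lambda>_. 0"]) auto

lemma cdiff_nth: "cdiff (\<lambda>u. u $ j) u"
  by (rule cdiffI[where D = "\<lambda>h. h $ j"])
     (auto intro: bounded_linear_imp_has_derivative bounded_linear_vec_nth)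

lemma cdiff_add: "cdiff f u \<Longrightarrow> cdiff g u \<Longrightarrow> cdiff (\<lambda>u. f u + g u) u"
  unfolding cdiff_def by (elim exE conjE, rule exI, rule conjI, erule (1) has_derivative_add)
    (simp add: ring_distribs)

lemma cdiff_mult:
  assumes "cdiff f u" "cdiff g u"
  shows "cdiff (\<lambda>u. f u * g u) u"
proof -
  obtain D E where D: "(f has_derivative D) (at u)" "\<And>c h. D (c *s h) = c * D h"
    and E: "(g has_derivative E) (at u)" "\<And>c h. E (c *s h) = c * E h"
    using assms by (auto simp: cdiff_def)
  show ?thesis
    by (rule cdiffI[OF has_derivative_mult[OF D(1) E(1)]]) (simp add: D E algebra_simps)
qed

lemma cdiff_compose:
  assumes "cdiff f u" "(h has_field_derivative h') (at (f u))"
  shows "cdiff (\<lambda>u. h (f u)) u"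
proof -
  obtain D where D: "(f has_derivative D) (at u)" "\<And>c h. D (c *s h) = c * D h"
    using assms by (auto simp: cdiff_def)
  have "(h has_derivative (*) h') (at (f u))"
    using assms(2) by (simp add: has_field_derivative_def)
  from has_derivative_compose[OF D(1) this] show ?thesis
    by (rule cdiffI) (simp add: D)
qed

lemma cdiff_minus: "cdiff f u \<Longrightarrow> cdiff (\<lambda>u. - f u) u"
  using cdiff_mult[OF cdiff_const[of "-1"], of f u] by simp

lemma cdiff_diff: "cdiff f u \<Longrightarrow> cdiff g u \<Longrightarrow> cdiff (\<lambda>u. f u - g u) u"
  using cdiff_add[OF _ cdiff_minus, of f u g] by simp

lemma cdiff_inverse: "cdiff f u \<Longrightarrow> f u \<noteq> 0 \<Longrightarrow> cdiff (\<lambda>u. inverse (f u)) u"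
  by (rule cdiff_compose[where h = inverse], assumption, rule DERIV_inverse) auto

lemma cdiff_divide: "cdiff f u \<Longrightarrow> cdiff g u \<Longrightarrow> g u \<noteq> 0 \<Longrightarrow> cdiff (\<lambda>u. f u / g u) u"
  using cdiff_mult[OF _ cdiff_inverse, of f u g] by (simp add: divide_inverse)

lemma cdiff_sum: "(\<And>i. i \<in> I \<Longrightarrow> cdiff (f i) u) \<Longrightarrow> cdiff (\<lambda>u. \<Sum>i\<in>I. f i u) u"
  by (induction I rule: infinite_finite_induct) (auto intro: cdiff_const cdiff_add)

lemma cdiff_prod: "(\<And>i. i \<in> I \<Longrightarrow> cdiff (f i) u) \<Longrightarrow> cdiff (\<lambda>u. \<Prod>i\<in>I. f i u) u"
  by (induction I rule: infinite_finite_induct) (auto intro: cdiff_const cdiff_mult)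

lemma cdiff_power: "cdiff f u \<Longrightarrow> cdiff (\<lambda>u. f u ^ k) u"
  by (induction k) (auto intro: cdiff_const cdiff_mult)

lemmas cdiff_intros = cdiff_const cdiff_nth cdiff_add cdiff_mult cdiff_minus cdiff_diff
  cdiff_divide cdiff_sum cdiff_prod cdiff_power

lemma cdiff_imp_isCont: "cdiff f u \<Longrightarrow> isCont f u"
  by (auto simp: cdiff_def intro: has_derivative_continuous)

lemma cdiff_cong:
  assumes "cdiff f u" "\<forall>\<^sub>F v in nhds u. g v = f v"
  shows "cdiff g u"
proof -
  obtain D where D: "(f has_derivative D) (at u)" "\<And>c h. D (c *s h) = c * D h"
    using assms by (auto simp: cdiff_def)
  have "(g has_derivative D) (at u)"
  proof (rule has_derivative_transform_eventually[OF D(1)])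
    show "\<forall>\<^sub>F v in at u. f v = g v"
      using assms(2) by (simp add: eventually_at_filter eventually_mono eq_commute)
    show "f u = g u" using eventually_nhds_x_imp_x[OF assms(2)] by simp
  qed simp
  then show ?thesis using D(2) by (rule cdiffI)
qed

lemma norm_vec_scale: "norm (z *s c) = cmod z * norm c" for c :: "complex ^ 'n::finite"
  by (auto simp: norm_vec_def L2_set_def norm_mult power_mult_distrib
          real_sqrt_mult simp flip: sum_distrib_left)

lemma bounded_linear_vec_scale: "bounded_linear (\<lambda>h. h *s c)" for c :: "complex ^ 'n::finite"
  by (rule bounded_linear_intro[where K = "norm c"])
       (simp_all add: norm_vec_scale vec.scale_left_distrib, simp add: vec_eq_iff scaleR_conv_of_real[where 'a = complex])

text \<open>Complex linearity of \<open>D\<close> makes the derivative along a complex line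
  multiplication by \<open>D c\<close>. Removable singularities and Cauchy estimates in one variable
  are reached in this way.\<close>

lemma cdiff_along_line:
  assumes "cdiff f (b + z *s c)"
  shows "(\<lambda>z. f (b + z *s c)) field_differentiable at z"
proof -
  obtain D where D: "(f has_derivative D) (at (b + z *s c))" "\<And>c h. D (c *s h) = c * D h"
    using assms by (auto simp: cdiff_def)
  have "((\<lambda>z. b + z *s c) has_derivative (\<lambda>h. h *s c)) (at z)"
    using bounded_linear_imp_has_derivative[OF bounded_linear_vec_scale] by (auto intro!: derivative_eq_intros)
  from has_derivative_compose[OF this D(1)]
  have "((\<lambda>z. f (b + z *s c)) has_derivative (\<lambda>h. D (h *s c))) (at z)" .
  moreover have "(\<lambda>h. D (h *s c)) = (*) (D c)" by (auto simp: D(2))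
  ultimately have "((\<lambda>z. f (b + z *s c)) has_derivative (*) (D c)) (at z)" by simp
  then show ?thesis
    by (auto simp: field_differentiable_def has_field_derivative_def)
qed

section \<open>Homogeneous polynomials\<close>

definition monomial :: "('k::finite \<Rightarrow> nat) \<Rightarrow> complex ^ 'k \<Rightarrow> complex" where
  "monomial \<alpha> s = (\<Prod>i\<in>UNIV. (s $ i) ^ \<alpha> i)"

lemma forms_iff: "f \<in> forms q \<longleftrightarrow> (\<exists>c. f = (\<lambda>s. \<Sum>\<alpha>\<in>exponents q. c \<alpha> * monomial \<alpha> s))"
  by (simp add: forms_def monomial_def)

lemma monomial_scale: "monomial \<alpha> (z *s s) = z ^ (\<Sum>i\<in>UNIV. \<alpha> i) * monomial \<alpha> s"
  by (simp add: monomial_def power_mult_distrib prod.distrib power_sum)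

lemma monomial_scale_exponents: "\<alpha> \<in> exponents q \<Longrightarrow> monomial \<alpha> (z *s s) = z ^ q * monomial \<alpha> s"
  by (simp add: monomial_scale exponents_def)

lemma forms_scale: "f \<in> forms q \<Longrightarrow> f (z *s s) = z ^ q * f s"
  by (auto simp: forms_iff monomial_scale_exponents sum_distrib_left mult_ac)

lemma monomial_in_forms: "\<alpha> \<in> exponents q \<Longrightarrow> monomial \<alpha> \<in> forms q"
  unfolding forms_iff
  by (rule exI[of _ "\<lambda>\<beta>. if \<beta> = \<alpha> then 1 else 0"])
     (simp add: finite_exponents sum.delta' if_distrib[of "\<lambda>x. x * _"] cong: if_cong)

section \<open>Functions that are polynomial in each variable separately\<close>

definition upd :: "complex ^ 'k \<Rightarrow> 'k \<Rightarrow> complex \<Rightarrow> complex ^ 'k" where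
  "upd b i z = (\<chi> j. if j = i then z else b $ j)"

text \<open>The nodes are the integers from 0 to \<open>d\<close>; a polynomial of degree at most
  \<open>d\<close> minus its interpolant has \<open>d + 1\<close> roots. The \<open>L l\<close> do
  not depend on \<open>p\<close>, so one family interpolates in every variable.\<close>

lemma ex_lagrange_basis:
  "\<exists>L :: nat \<Rightarrow> complex poly. (\<forall>l\<le>d. degree (L l) \<le> d) \<and>
     (\<forall>p z. degree p \<le> d \<longrightarrow> poly p z = (\<Sum>l\<le>d. poly p (of_nat l) * poly (L l) z))"
proof -
  define M :: "nat \<Rightarrow> nat \<Rightarrow> complex poly"
    where "M l m = smult (inverse (of_nat l - of_nat m)) [:- of_nat m, 1:]" for l m
  define L where "L l = (\<Prod>m\<in>{..d} - {l}. M l m)" for l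
  have degM: "degree (M l m) \<le> 1" for l m
    unfolding M_def by (rule order_trans[OF degree_smult_le]) simp
  have deg: "degree (L l) \<le> d" if "l \<le> d" for l
  proof -
    have "degree (L l) \<le> (\<Sum>m\<in>{..d} - {l}. degree (M l m))"
      unfolding L_def using degree_prod_sum_le[of "{..d}-{l}" "M l"] by (simp add: o_def)
    also have "\<dots> \<le> (\<Sum>m\<in>{..d} - {l}. 1)"
      by (intro sum_mono degM)
    also have "\<dots> = d" using that by (simp add: card_Diff_singleton)
    finally show ?thesis .
  qed
  have node: "poly (L l) (of_nat k) = (if k = l then 1 else 0)" if "k \<le> d" for k l
  proof (cases "k = l")
    case True
    have "poly (M l m) (of_nat l) = 1" if "m \<noteq> l" for m
    proof -
      have "of_nat l - of_nat m \<noteq> (0 :: complex)" using that by simp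
      then show ?thesis by (simp add: M_def divide_inverse[symmetric] diff_divide_distrib[symmetric] left_diff_distrib[symmetric] mult.commute)
    qed
    then show ?thesis using True by (auto simp: L_def poly_prod intro!: prod.neutral)
  next
    case False
    then show ?thesis using \<open>k \<le> d\<close> by (auto simp: L_def M_def poly_prod field_simps)
  qed
  have "poly p z = (\<Sum>l\<le>d. poly p (of_nat l) * poly (L l) z)" if p: "degree p \<le> d" for p z
  proof -
    define r where "r = (\<Sum>l\<le>d. smult (poly p (of_nat l)) (L l))"
    have "degree r \<le> d"
      unfolding r_def by (intro degree_sum_le) (auto intro: order_trans[OF degree_smult_le] deg)
    have "poly r (of_nat k) = poly p (of_nat k)" if "k \<le> d" for k
      using that by (simp add: r_def poly_sum node if_distrib[of "\<lambda>x. _ * x"] cong: if_cong)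
    then have roots: "of_nat ` {..d} \<subseteq> {x. poly (p - r) x = 0}" by auto
    have "p - r = 0"
    proof (rule ccontr)
      assume nz: "p - r \<noteq> 0"
      have "d + 1 = card (of_nat ` {..d} :: complex set)" by (subst card_image) (auto simp: inj_on_def)
      also have "\<dots> \<le> card {x. poly (p - r) x = 0}"
        using roots poly_roots_finite[OF nz] by (intro card_mono) auto
      also have "\<dots> \<le> degree (p - r)" by (rule card_poly_roots_bound[OF nz])
      also have "\<dots> \<le> d" using p \<open>degree r \<le> d\<close> by (rule degree_diff_le)
      finally show False by simp
    qed
    then have "poly p z = poly r z" by simp
    then show ?thesis by (simp add: r_def poly_sum)
  qed
  with deg show ?thesis by blast
qed

text \<open>The variables of \<open>S\<close> are moved to nodes one at a time. For
  \<open>S = UNIV\<close> only values of \<open>f\<close> on a grid remain, so bounded degree along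
  the axis directions forces joint polynomiality.\<close>

lemma interpolate_along_axes:
  fixes f :: "complex ^ 'k::finite \<Rightarrow> complex"
  assumes axes: "\<And>b i. \<exists>p. degree p \<le> d \<and> (\<forall>z. f (upd b i z) = poly p z)"
    and L: "\<And>p z. degree p \<le> d \<Longrightarrow> poly p z = (\<Sum>l\<le>d. poly p (of_nat l) * poly (L l) z)"
  shows "f b = (\<Sum>l\<in>PiE S (\<lambda>_. {..d}). f (\<chi> j. if j \<in> S then of_nat (l j) else b $ j) * (\<Prod>i\<in>S. poly (L (l i)) (b $ i)))"
proof -
  have "finite S" by simp
  then show ?thesis
  proof (induction S arbitrary: b rule: finite_induct)
    case empty
    then show ?case by simp
  next
    case (insert i S)
    let ?b = "\<lambda>S (l :: 'k \<Rightarrow> nat) b. (\<chi> j. if j \<in> S then of_nat (l j) else b $ j) :: complex ^ 'k"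
    have step: "f c = (\<Sum>m\<le>d. f (upd c i (of_nat m)) * poly (L m) (c $ i))" for c
    proof -
      obtain p where p: "degree p \<le> d" "\<And>z. f (upd c i z) = poly p z" using axes by blast
      have "upd c i (c $ i) = c" by (simp add: upd_def vec_eq_iff)
      then have "f c = poly p (c $ i)" using p(2)[of "c $ i"] by simp
      also note L[OF p(1)]
      finally show ?thesis by (simp add: p(2))
    qed
    have "f b = (\<Sum>l\<in>PiE S (\<lambda>_. {..d}). f (?b S l b) * (\<Prod>i\<in>S. poly (L (l i)) (b $ i)))"
      by (rule insert.IH)
    also have "\<dots> = (\<Sum>l\<in>PiE S (\<lambda>_. {..d}). \<Sum>m\<le>d. f (upd (?b S l b) i (of_nat m)) * (poly (L m) (b $ i) * (\<Prod>i\<in>S. poly (L (l i)) (b $ i))))"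
      by (subst step) (use insert.hyps in \<open>simp add: sum_distrib_left sum_distrib_right mult_ac\<close>)
    also have "\<dots> = (\<Sum>m\<le>d. \<Sum>l\<in>PiE S (\<lambda>_. {..d}). f (upd (?b S l b) i (of_nat m)) * (poly (L m) (b $ i) * (\<Prod>i\<in>S. poly (L (l i)) (b $ i))))"
      by (rule sum.swap)
    also have "\<dots> = (\<Sum>(m, l)\<in>{..d} \<times> PiE S (\<lambda>_. {..d}). f (upd (?b S l b) i (of_nat m)) * (poly (L m) (b $ i) * (\<Prod>i\<in>S. poly (L (l i)) (b $ i))))"
      by (simp add: sum.cartesian_product)
    also have "\<dots> = (\<Sum>l\<in>PiE (insert i S) (\<lambda>_. {..d}). f (?b (insert i S) l b) * (\<Prod>i\<in>insert i S. poly (L (l i)) (b $ i)))"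
    proof (subst PiE_insert_eq, subst sum.reindex, goal_cases)
      case 1
      show ?case using inj_combinator[OF insert.hyps(2)] by (simp add: case_prod_unfold)
    next
      case 2
      have *: "(\<Prod>x\<in>S. poly (L (if x = i then m else l x)) (b $ x)) = (\<Prod>x\<in>S. poly (L (l x)) (b $ x))" for m l
        using insert.hyps by (intro prod.cong) auto
      have **: "upd (?b S l b) i (of_nat m) = ?b (insert i S) (l(i := m)) b" for m l
        by (auto simp: upd_def vec_eq_iff)
      show ?case
        using insert.hyps by (auto intro!: sum.cong simp: * ** case_prod_unfold)
    qed
    finally show ?case .
  qed
qed

lemma monomials_of_poly_along_axes:
  fixes f :: "complex ^ 'k::finite \<Rightarrow> complex"
  assumes axes: "\<And>b i. \<exists>p. degree p \<le> d \<and> (\<forall>z. f (upd b i z) = poly p z)"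
  shows "\<exists>c. \<forall>b. f b = (\<Sum>\<alpha>\<in>PiE UNIV (\<lambda>_. {..d}). c \<alpha> * monomial \<alpha> b)"
proof -
  obtain L where deg: "\<And>l. l \<le> d \<Longrightarrow> degree (L l) \<le> d"
    and L: "\<And>p z. degree p \<le> d \<Longrightarrow> poly p z = (\<Sum>l\<le>d. poly p (of_nat l) * poly (L l :: complex poly) z)"
    using ex_lagrange_basis by metis
  let ?I = "PiE (UNIV :: 'k set) (\<lambda>_. {..d})"
  define C where "C l = f (\<chi> j. of_nat (l j))" for l :: "'k \<Rightarrow> nat"
  show ?thesis
  proof (intro exI allI)
    fix b
    have Lm: "poly (L (l i)) z = (\<Sum>m\<le>d. coeff (L (l i)) m * z ^ m)" if "l \<in> ?I" for l i z
    proof -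
      have "l i \<le> d" using that by auto
      then have "degree (L (l i)) \<le> d" by (rule deg)
      then show ?thesis by (subst poly_altdef) (auto intro!: sum.mono_neutral_left le_degree)
    qed
    have "f b = (\<Sum>l\<in>?I. C l * (\<Prod>i\<in>UNIV. poly (L (l i)) (b $ i)))"
      using interpolate_along_axes[OF axes L, of b UNIV] by (simp add: C_def)
    also have "\<dots> = (\<Sum>l\<in>?I. C l * (\<Prod>i\<in>UNIV. \<Sum>m\<le>d. coeff (L (l i)) m * (b $ i) ^ m))"
      by (simp add: Lm)
    also have "\<dots> = (\<Sum>l\<in>?I. C l * (\<Sum>\<alpha>\<in>?I. \<Prod>i\<in>UNIV. coeff (L (l i)) (\<alpha> i) * (b $ i) ^ \<alpha> i))"
      by (subst prod_sum_PiE) auto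
    also have "\<dots> = (\<Sum>l\<in>?I. \<Sum>\<alpha>\<in>?I. (C l * (\<Prod>i\<in>UNIV. coeff (L (l i)) (\<alpha> i))) * monomial \<alpha> b)"
      by (simp add: sum_distrib_left prod.distrib monomial_def mult_ac)
    also have "\<dots> = (\<Sum>\<alpha>\<in>?I. (\<Sum>l\<in>?I. C l * (\<Prod>i\<in>UNIV. coeff (L (l i)) (\<alpha> i))) * monomial \<alpha> b)"
      by (subst sum.swap) (simp add: sum_distrib_right)
    finally show "f b = (\<Sum>\<alpha>\<in>?I. (\<Sum>l\<in>?I. C l * (\<Prod>i\<in>UNIV. coeff (L (l i)) (\<alpha> i))) * monomial \<alpha> b)" .
  qed
qed

lemma poly_sum_powers: "(\<Sum>\<alpha>\<in>I. c \<alpha> * z ^ e \<alpha>) = poly (\<Sum>\<alpha>\<in>I. monom (c \<alpha>) (e \<alpha>)) z"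
  for z :: complex
  by (simp add: poly_sum poly_monom)

text \<open>For fixed \<open>b\<close>, \<open>f (z *s b)\<close> is a polynomial in
  \<open>z\<close> that equals \<open>z ^ q * f b\<close> at infinitely many \<open>z\<close>, so
  only the monomials of total degree \<open>q\<close> contribute. This is the criterion by which
  functions are recognized as forms.\<close>

lemma forms_of_homogeneous:
  fixes f :: "complex ^ 'k::finite \<Rightarrow> complex"
  assumes axes: "\<And>b i. \<exists>p. degree p \<le> d \<and> (\<forall>z. f (upd b i z) = poly p z)"
    and hom: "\<And>z b. z \<noteq> 0 \<Longrightarrow> f (z *s b) = z ^ q * f b"
  shows "f \<in> forms q"
proof -
  let ?I = "PiE (UNIV :: 'k set) (\<lambda>_. {..d})"
  let ?w = "\<lambda>\<alpha> :: 'k \<Rightarrow> nat. \<Sum>i\<in>UNIV. \<alpha> i"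
  obtain c where c: "\<And>b. f b = (\<Sum>\<alpha>\<in>?I. c \<alpha> * monomial \<alpha> b)"
    using monomials_of_poly_along_axes[OF axes] by blast
  have fin: "finite ?I" by (intro finite_PiE) auto
  have f: "f b = (\<Sum>\<alpha>\<in>{\<alpha>\<in>?I. ?w \<alpha> = q}. c \<alpha> * monomial \<alpha> b)" for b
  proof -
    define P where "P = (\<Sum>\<alpha>\<in>?I. monom (c \<alpha> * monomial \<alpha> b) (?w \<alpha>))"
    have P: "f (z *s b) = poly P z" for z
      unfolding P_def c by (subst poly_sum_powers[symmetric]) (simp add: monomial_scale mult_ac)
    have "poly (P - monom (f b) q) z = 0" if "z \<in> UNIV - {0}" for z
      using hom[of z b] P[of z] that by (simp add: poly_monom mult_ac)
    then have "UNIV - {0} \<subseteq> {z. poly (P - monom (f b) q) z = 0}" by blast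
    moreover have "infinite (UNIV - {0 :: complex})"
      using infinite_UNIV_char_0[where ?'a = complex] by simp
    ultimately have "infinite {z. poly (P - monom (f b) q) z = 0}"
      by (rule infinite_super)
    then have "P = monom (f b) q"
      using poly_roots_finite[of "P - monom (f b) q"] by auto
    then have "coeff P q = f b" by simp
    then show ?thesis
      by (simp add: P_def coeff_sum if_distrib[of "\<lambda>x. _ * x"] sum.If_cases fin Int_def conj_commute)
  qed
  have "{\<alpha>\<in>?I. ?w \<alpha> = q} \<subseteq> exponents q" by (auto simp: exponents_def)
  then have "f = (\<lambda>b. \<Sum>\<alpha>\<in>exponents q. (if \<alpha> \<in> ?I then c \<alpha> else 0) * monomial \<alpha> b)"
    unfolding f by (intro ext sum.mono_neutral_cong_left finite_exponents) (auto simp: exponents_def)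
  then show ?thesis unfolding forms_iff
    by (rule exI[where x = "\<lambda>\<alpha>. if \<alpha> \<in> ?I then c \<alpha> else 0"])
qed

lemma poly_of_forms_along_line:
  assumes "f \<in> forms q"
  shows "\<exists>p. degree p \<le> q \<and> (\<forall>z. f (b + z *s c) = poly p z)"
proof -
  obtain C where f: "f = (\<lambda>s. \<Sum>\<alpha>\<in>exponents q. C \<alpha> * monomial \<alpha> s)"
    using assms by (auto simp: forms_iff)
  define p where "p = (\<Sum>\<alpha>\<in>exponents q. smult (C \<alpha>) (\<Prod>i\<in>UNIV. [:b $ i, c $ i:] ^ \<alpha> i))"
  have "degree (\<Prod>i\<in>UNIV. [:b $ i, c $ i:] ^ \<alpha> i) \<le> q" if "\<alpha> \<in> exponents q" for \<alpha>
  proof -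
    have "degree (\<Prod>i\<in>UNIV. [:b $ i, c $ i:] ^ \<alpha> i) \<le> (\<Sum>i\<in>UNIV. degree ([:b $ i, c $ i:] ^ \<alpha> i))"
      using degree_prod_sum_le[of UNIV "\<lambda>i. [:b $ i, c $ i:] ^ \<alpha> i"] by (simp add: o_def)
    also have "\<dots> \<le> (\<Sum>i\<in>UNIV. \<alpha> i)"
      by (intro sum_mono order_trans[OF degree_power_le]) auto
    finally show ?thesis using that by (simp add: exponents_def)
  qed
  then have "degree p \<le> q"
    unfolding p_def by (intro degree_sum_le finite_exponents order_trans[OF degree_smult_le])
  moreover have "f (b + z *s c) = poly p z" for z
    by (simp add: f p_def poly_sum poly_prod monomial_def algebra_simps)
  ultimately show ?thesis by blast
qed

text \<open>Viewing the sum as a polynomial in the variable \<open>k\<close> isolates the exponents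
  with a prescribed entry at \<open>k\<close>. The separation hypothesis on \<open>I\<close> passes
  to that subset and leaves a single exponent when \<open>S\<close> is empty.\<close>

lemma monomial_coeffs_unique_on:
  fixes I :: "('k::finite \<Rightarrow> nat) set"
  assumes "finite S" "finite I" "\<And>\<alpha> \<beta>. \<alpha> \<in> I \<Longrightarrow> \<beta> \<in> I \<Longrightarrow> (\<And>i. i \<in> S \<Longrightarrow> \<alpha> i = \<beta> i) \<Longrightarrow> \<alpha> = \<beta>"
    and "\<And>s :: 'k \<Rightarrow> complex. (\<Sum>\<alpha>\<in>I. c \<alpha> * (\<Prod>i\<in>S. s i ^ \<alpha> i)) = 0" and "\<alpha> \<in> I"
  shows "c \<alpha> = 0"
  using assms
proof (induction S arbitrary: I rule: finite_induct)
  case empty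
  then have "I = {\<alpha>}" by auto
  with empty show ?case by simp
next
  case (insert k S)
  let ?J = "{\<beta>\<in>I. \<beta> k = \<alpha> k}"
  have "(\<Sum>\<beta>\<in>?J. c \<beta> * (\<Prod>i\<in>S. s i ^ \<beta> i)) = 0" for s :: "'k \<Rightarrow> complex"
  proof -
    define P where "P = (\<Sum>\<beta>\<in>I. monom (c \<beta> * (\<Prod>i\<in>S. s i ^ \<beta> i)) (\<beta> k))"
    have "poly P z = 0" for z
    proof -
      have "(\<Prod>i\<in>S. (s(k := z)) i ^ \<beta> i) = (\<Prod>i\<in>S. s i ^ \<beta> i)" for \<beta>
        using insert.hyps by (intro prod.cong) auto
      then show ?thesis
        using insert.prems(3)[of "s(k := z)"] insert.hyps
        unfolding P_def by (subst poly_sum_powers[symmetric]) (simp add: mult_ac)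
    qed
    then have "P = 0" using poly_all_0_iff_0 by blast
    then have "coeff P (\<alpha> k) = 0" by simp
    then show ?thesis
      by (simp add: P_def coeff_sum if_distrib[of "\<lambda>x. _ * x"] sum.If_cases \<open>finite I\<close> Int_def)
  qed
  moreover have "\<beta> = \<beta>'" if "\<beta> \<in> ?J" "\<beta>' \<in> ?J" "\<And>i. i \<in> S \<Longrightarrow> \<beta> i = \<beta>' i" for \<beta> \<beta>'
  proof (rule insert.prems(2))
    show "\<beta> i = \<beta>' i" if "i \<in> insert k S" for i
      using that \<open>\<beta> \<in> ?J\<close> \<open>\<beta>' \<in> ?J\<close> \<open>\<And>i. i \<in> S \<Longrightarrow> \<beta> i = \<beta>' i\<close> by auto
  qed (use that in auto)
  ultimately show ?case
    using insert.prems(1,4) by (intro insert.IH[of ?J]) auto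
qed

lemma monomial_coeffs_unique:
  assumes "\<And>s :: complex ^ 'k::finite. (\<Sum>\<alpha>\<in>exponents q. c \<alpha> * monomial \<alpha> s) = 0" "\<alpha> \<in> exponents q"
  shows "c \<alpha> = 0"
proof (rule monomial_coeffs_unique_on[where S = UNIV])
  show "(\<Sum>\<alpha>\<in>exponents q. c \<alpha> * (\<Prod>i\<in>UNIV. s i ^ \<alpha> i)) = 0" for s :: "'k \<Rightarrow> complex"
    using assms(1)[of "\<chi> i. s i"] by (simp add: monomial_def)
qed (use assms finite_exponents in auto)

text \<open>Listing the values of an exponent gives a list of length \<open>CARD('k)\<close> with
  sum \<open>q\<close>, which stars and bars counts.\<close>

lemma card_exponents: "card (exponents q :: ('k::finite \<Rightarrow> nat) set) = (q + CARD('k) - 1) choose q"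
proof -
  obtain xs :: "'k list" where xs: "set xs = UNIV" "distinct xs"
    using finite_distinct_list[of "UNIV :: 'k set"] by auto
  have len: "length xs = CARD('k)" using xs distinct_card by metis
  have "bij_betw (\<lambda>\<alpha>. map \<alpha> xs) (exponents q) {l::nat list. size l = CARD('k) \<and> sum_list l = q}"
  proof (rule bij_betw_imageI)
    show "inj_on (\<lambda>\<alpha>. map \<alpha> xs) (exponents q)"
      using xs by (auto simp: inj_on_def map_eq_conv)
    show "(\<lambda>\<alpha>. map \<alpha> xs) ` exponents q = {l::nat list. size l = CARD('k) \<and> sum_list l = q}"
    proof safe
      fix \<alpha> :: "'k \<Rightarrow> nat" assume "\<alpha> \<in> exponents q"
      then show "sum_list (map \<alpha> xs) = q"
        using xs by (simp add: sum_list_distinct_conv_sum_set exponents_def)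
    next
      fix l :: "nat list" assume l: "size l = CARD('k)" "q = sum_list l"
      define \<alpha> where "\<alpha> i = the (map_of (zip xs l) i)" for i
      have m: "map \<alpha> xs = l"
        using l xs len by (intro nth_equalityI) (auto simp: \<alpha>_def map_of_zip_nth)
      moreover have "\<alpha> \<in> exponents q"
        using xs m l by (metis (mono_tags, lifting) exponents_def mem_Collect_eq sum_list_distinct_conv_sum_set)
      ultimately show "l \<in> (\<lambda>\<alpha>. map \<alpha> xs) ` exponents (sum_list l)" using l by blast
    qed (simp add: len)
  qed
  then show ?thesis
    by (simp add: bij_betw_same_card card_length_sum_list)
qed

section \<open>Orders of vanishing at the origin\<close>

text \<open>The filter omits the origin, so values there do not matter, and \<open>S\<close> allows
  estimates on a cone. With order \<open>Suc q\<close>, the relation for a difference says that two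
  functions have the same jet of order \<open>q\<close>.\<close>

definition big_oh :: "'a::real_normed_vector set \<Rightarrow> nat \<Rightarrow> ('a \<Rightarrow> complex) \<Rightarrow> bool" where
  "big_oh S k f \<longleftrightarrow> (\<exists>C. \<forall>\<^sub>F u in at 0 within S. cmod (f u) \<le> C * norm u ^ k)"

lemma big_ohI: "\<forall>\<^sub>F u in at 0 within S. cmod (f u) \<le> C * norm u ^ k \<Longrightarrow> big_oh S k f"
  by (auto simp: big_oh_def)

lemma big_ohE:
  assumes "big_oh S k f"
  obtains C where "C > 0" "\<forall>\<^sub>F u in at 0 within S. cmod (f u) \<le> C * norm u ^ k"
proof -
  obtain C where C: "\<forall>\<^sub>F u in at 0 within S. cmod (f u) \<le> C * norm u ^ k"
    using assms by (auto simp: big_oh_def)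
  have "\<forall>\<^sub>F u in at 0 within S. cmod (f u) \<le> max C 1 * norm u ^ k"
    using C by eventually_elim (meson max.cobounded1 mult_right_mono norm_ge_zero order_trans zero_le_power)
  then show ?thesis by (intro that[of "max C 1"]) auto
qed

lemma big_oh_subset: "big_oh T k f \<Longrightarrow> S \<subseteq> T \<Longrightarrow> big_oh S k f"
  unfolding big_oh_def by (meson at_le filter_leD)

lemma big_oh_cong:
  assumes "big_oh S k f" "\<forall>\<^sub>F u in at 0 within S. g u = f u"
  shows "big_oh S k g"
proof -
  from assms(1) obtain C where "\<forall>\<^sub>F u in at 0 within S. cmod (f u) \<le> C * norm u ^ k"
    by (auto simp: big_oh_def)
  with assms(2) have "\<forall>\<^sub>F u in at 0 within S. cmod (g u) \<le> C * norm u ^ k"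
    by eventually_elim simp
  then show ?thesis by (rule big_ohI)
qed

lemma eventually_norm_less_at_0:
  "e > 0 \<Longrightarrow> \<forall>\<^sub>F u::'a::real_normed_vector in at 0 within S. norm u < e"
  unfolding eventually_at by (auto intro!: exI[of _ e])

lemma eventually_nonzero_at_0: "\<forall>\<^sub>F u::'a::real_normed_vector in at 0 within S. u \<noteq> 0"
  by (auto simp: eventually_at intro!: exI[of _ 1])

lemma big_oh_mono:
  assumes "big_oh S k f" "l \<le> k"
  shows "big_oh S l f"
proof -
  from assms(1) obtain C where C: "C > 0" "\<forall>\<^sub>F u in at 0 within S. cmod (f u) \<le> C * norm u ^ k"
    by (rule big_ohE)
  from C(2) have "\<forall>\<^sub>F u in at 0 within S. cmod (f u) \<le> C * norm u ^ l"
    using eventually_norm_less_at_0[of 1 S, OF zero_less_one]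
  proof eventually_elim
    case (elim u)
    have "norm u ^ k \<le> norm u ^ l" using elim assms(2) by (intro power_decreasing) auto
    then show ?case using elim C(1) by (meson mult_left_mono order_trans less_imp_le)
  qed
  then show ?thesis by (rule big_ohI)
qed

lemma big_oh_add:
  assumes "big_oh S k f" "big_oh S k g"
  shows "big_oh S k (\<lambda>u. f u + g u)"
proof -
  from assms obtain C D where "\<forall>\<^sub>F u in at 0 within S. cmod (f u) \<le> C * norm u ^ k"
    "\<forall>\<^sub>F u in at 0 within S. cmod (g u) \<le> D * norm u ^ k"
    by (auto simp: big_oh_def)
  then have "\<forall>\<^sub>F u in at 0 within S. cmod (f u + g u) \<le> (C + D) * norm u ^ k"
    by eventually_elim (auto simp: distrib_right intro: norm_triangle_le add_mono)
  then show ?thesis by (rule big_ohI)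
qed

lemma big_oh_mult:
  assumes "big_oh S k f" "big_oh S l g"
  shows "big_oh S (k + l) (\<lambda>u. f u * g u)"
proof -
  from assms(1) obtain C where C: "C > 0" "\<forall>\<^sub>F u in at 0 within S. cmod (f u) \<le> C * norm u ^ k"
    by (rule big_ohE)
  from assms(2) obtain D where D: "D > 0" "\<forall>\<^sub>F u in at 0 within S. cmod (g u) \<le> D * norm u ^ l"
    by (rule big_ohE)
  from C(2) D(2) have "\<forall>\<^sub>F u in at 0 within S. cmod (f u * g u) \<le> (C * D) * norm u ^ (k + l)"
  proof eventually_elim
    case (elim u)
    then have "cmod (f u) * cmod (g u) \<le> (C * norm u ^ k) * (D * norm u ^ l)"
      using C(1) by (intro mult_mono) auto
    then show ?case by (simp add: norm_mult power_add mult_ac)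
  qed
  then show ?thesis by (rule big_ohI)
qed

lemma big_oh_const: "big_oh S 0 (\<lambda>_. c)"
  by (rule big_ohI[where C = "cmod c"]) simp

lemma big_oh_zero: "big_oh S k (\<lambda>_. 0)"
  by (rule big_ohI[where C = 0]) simp

lemma big_oh_cmult: "big_oh S k f \<Longrightarrow> big_oh S k (\<lambda>u. c * f u)"
  using big_oh_mult[OF big_oh_const, of S k f c] by simp

lemma big_oh_minus: "big_oh S k f \<Longrightarrow> big_oh S k (\<lambda>u. - f u)"
  by (simp add: big_oh_def)

lemma big_oh_diff: "big_oh S k f \<Longrightarrow> big_oh S k g \<Longrightarrow> big_oh S k (\<lambda>u. f u - g u)"
  using big_oh_add[OF _ big_oh_minus, of S k f g] by simp

lemma big_oh_diff_trans:
  "big_oh S k (\<lambda>u. f u - g u) \<Longrightarrow> big_oh S k (\<lambda>u. g u - h u) \<Longrightarrow> big_oh S k (\<lambda>u. f u - h u)"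
  using big_oh_add[of S k "\<lambda>u. f u - g u" "\<lambda>u. g u - h u"] by simp

lemma big_oh_diff_sym: "big_oh S k (\<lambda>u. f u - g u) \<Longrightarrow> big_oh S k (\<lambda>u. g u - f u)"
  using big_oh_minus[of S k "\<lambda>u. f u - g u"] by simp

lemma big_oh_sum: "(\<And>i. i \<in> I \<Longrightarrow> big_oh S k (f i)) \<Longrightarrow> big_oh S k (\<lambda>u. \<Sum>i\<in>I. f i u)"
  by (induction I rule: infinite_finite_induct) (auto intro: big_oh_zero big_oh_add)

lemma big_oh_power: "big_oh S k f \<Longrightarrow> big_oh S (m * k) (\<lambda>u. f u ^ m)"
  by (induction m) (auto intro: big_oh_const big_oh_mult)

lemma big_oh_tendsto_0:
  assumes "big_oh S (Suc k) f"
  shows "(f \<longlongrightarrow> 0) (at 0 within S)"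
proof -
  have "big_oh S 1 f" by (rule big_oh_mono[OF assms]) simp
  then obtain C where C: "C > 0" "\<forall>\<^sub>F u in at 0 within S. cmod (f u) \<le> C * norm u ^ 1"
    by (rule big_ohE)
  have "((\<lambda>u. C * norm u) \<longlongrightarrow> C * norm (0 :: 'a)) (at 0 within S)"
    by (intro tendsto_intros)
  then show ?thesis
    using C(2) by (simp add: Lim_null_comparison)
qed

text \<open>The exponent \<open>Suc m\<close> forces \<open>c\<close> to tend to 0. The usual case
  is \<open>m = 0\<close>; the case \<open>m = 1\<close> describes a curve of zero velocity.\<close>

lemma big_oh_compose_power:
  fixes c :: "complex \<Rightarrow> 'a::real_normed_vector"
  assumes "big_oh S k f" and "\<forall>\<^sub>F t in at 0. norm (c t) \<le> K * norm t ^ Suc m"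
    and "\<forall>\<^sub>F t in at 0. c t \<noteq> 0" "\<forall>\<^sub>F t in at 0. c t \<in> S"
  shows "big_oh UNIV (Suc m * k) (\<lambda>t. f (c t))"
proof -
  obtain C where C: "C > 0" "\<forall>\<^sub>F u in at 0 within S. cmod (f u) \<le> C * norm u ^ k"
    using assms(1) by (rule big_ohE)
  have "((\<lambda>t::complex. K * norm t ^ Suc m) \<longlongrightarrow> K * norm (0::complex) ^ Suc m) (at 0)"
    by (intro tendsto_intros)
  then have "(c \<longlongrightarrow> 0) (at 0)"
    using assms(2) by (simp add: Lim_null_comparison)
  then have "filterlim c (at 0 within S) (at 0)"
    using assms(3,4) by (auto simp: filterlim_at eventually_conj_iff)
  from eventually_compose_filterlim[OF C(2) this]
  have "\<forall>\<^sub>F t in at 0. cmod (f (c t)) \<le> C * norm (c t) ^ k" .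
  then have "\<forall>\<^sub>F t in at 0. cmod (f (c t)) \<le> (C * K ^ k) * norm t ^ (Suc m * k)"
    using assms(2)
  proof eventually_elim
    case (elim t)
    then have "norm (c t) ^ k \<le> (K * norm t ^ Suc m) ^ k" by (intro power_mono) auto
    also have "\<dots> = K ^ k * norm t ^ (Suc m * k)" by (simp only: power_mult_distrib power_mult)
    finally show ?case using elim C(1) by (simp add: mult.assoc) (meson mult_left_mono order_trans less_imp_le)
  qed
  then show ?thesis by (rule big_ohI)
qed

lemma big_oh_compose:
  fixes c :: "complex \<Rightarrow> 'a::real_normed_vector"
  assumes "big_oh S k f" and "\<forall>\<^sub>F t in at 0. norm (c t) \<le> K * norm t"
    and "\<forall>\<^sub>F t in at 0. c t \<noteq> 0" "\<forall>\<^sub>F t in at 0. c t \<in> S"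
  shows "big_oh UNIV k (\<lambda>t. f (c t))"
  using big_oh_compose_power[of S k f c K 0] assms by simp

lemma big_oh_divide_self:
  fixes f :: "complex \<Rightarrow> complex"
  assumes "big_oh UNIV (k + l) (\<lambda>t. t ^ k * f t)"
  shows "big_oh UNIV l f"
proof -
  obtain C where C: "\<forall>\<^sub>F t in at 0. cmod (t ^ k * f t) \<le> C * norm t ^ (k + l)"
    using assms by (auto simp: big_oh_def)
  from C eventually_nonzero_at_0 have "\<forall>\<^sub>F t in at 0. cmod (f t) \<le> C * norm t ^ l"
    by eventually_elim (simp add: norm_mult norm_power power_add mult.left_commute)
  then show ?thesis by (rule big_ohI)
qed

lemma big_oh_poly_imp_coeff_0:
  assumes "big_oh UNIV k (poly p)" "i < k"
  shows "coeff p i = 0"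
  using assms
proof (induction k arbitrary: p i)
  case 0
  then show ?case by simp
next
  case (Suc k)
  obtain a r where p: "p = pCons a r" by (cases p)
  have "(poly p \<longlongrightarrow> 0) (at 0)"
    using big_oh_tendsto_0[OF Suc.prems(1)] by simp
  moreover have "(poly p \<longlongrightarrow> poly p 0) (at 0)"
    using isCont_def poly_isCont by blast
  ultimately have "poly p 0 = 0"
    using tendsto_unique[of "at (0::complex)"] by auto
  then have a: "a = 0" by (simp add: p)
  then have "big_oh UNIV (1 + k) (\<lambda>t. t ^ 1 * poly r t)"
    using Suc.prems(1) by (simp add: p)
  from big_oh_divide_self[OF this] have "big_oh UNIV k (poly r)" .
  with Suc show ?case by (cases i) (auto simp: p a)
qed

lemma poly_eq_0_of_big_oh:
  assumes "big_oh UNIV (Suc q) (poly p)" "degree p \<le> q"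
  shows "p = 0"
  using big_oh_poly_imp_coeff_0[OF assms(1)] assms(2) by (metis leading_coeff_0_iff less_Suc_eq_le)

text \<open>The source of all rigidity: a functional on a curve has degree at most \<open>q\<close>,
  so its jet at \<open>t = 0\<close> fixes it, and with it the value at
  \<open>t = 1\<close>.\<close>

lemma poly_eq_of_big_oh:
  assumes "big_oh UNIV (Suc q) (\<lambda>t. poly p t - poly r t)" "degree p \<le> q" "degree r \<le> q"
  shows "p = r"
proof -
  have "poly (p - r) = (\<lambda>t. poly p t - poly r t)" by auto
  then have "p - r = 0"
    using assms by (intro poly_eq_0_of_big_oh[of q]) (simp_all only: degree_diff_le)
  then show ?thesis by simp
qed

lemma big_oh_forms: "f \<in> forms k \<Longrightarrow> big_oh S k f"
proof -
  have "big_oh S k (monomial \<alpha>)" if "\<alpha> \<in> exponents k" for \<alpha> :: "'a \<Rightarrow> nat"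
  proof (rule big_ohI[where C = 1], rule always_eventually, rule allI)
    fix u :: "complex ^ 'a"
    have "cmod (monomial \<alpha> u) = (\<Prod>i\<in>UNIV. cmod (u $ i) ^ \<alpha> i)"
      by (simp add: monomial_def norm_power flip: prod_norm)
    also have "\<dots> \<le> (\<Prod>i\<in>UNIV. norm u ^ \<alpha> i)"
      by (intro prod_mono) (auto intro: power_mono Finite_Cartesian_Product.norm_nth_le)
    also have "\<dots> = norm u ^ k" using that by (simp add: exponents_def flip: power_sum)
    finally show "cmod (monomial \<alpha> u) \<le> 1 * norm u ^ k" by simp
  qed
  then show "f \<in> forms k \<Longrightarrow> big_oh S k f"
    by (auto simp: forms_iff intro!: big_oh_sum big_oh_cmult)
qed

lemma big_oh_nth: "big_oh S 1 (\<lambda>u :: complex ^ 'n::finite. u $ j)"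
  by (rule big_ohI[where C = 1]) (auto intro!: always_eventually Finite_Cartesian_Product.norm_nth_le)

section \<open>Taylor expansions at a puncture\<close>

text \<open>
  The term of degree \<open>j\<close>, defined by the expansion
  along the complex lines through the origin, is homogeneous of degree \<open>j\<close>; along every line that
  avoids the origin it is an entire function of polynomial growth, hence a polynomial.
\<close>

lemma homogeneous_entire_imp_forms:
  fixes a :: "complex ^ 'n::finite \<Rightarrow> complex"
  assumes hol: "\<And>b c. (\<And>z. b + z *s c \<noteq> 0) \<Longrightarrow> (\<lambda>z. a (b + z *s c)) holomorphic_on UNIV"
    and bound: "\<And>b. b \<noteq> 0 \<Longrightarrow> cmod (a b) \<le> C * norm b ^ j"
    and hom: "\<And>z b. z \<noteq> 0 \<Longrightarrow> b \<noteq> 0 \<Longrightarrow> a (z *s b) = z ^ j * a b"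
  shows "\<exists>\<psi>\<in>forms j. \<forall>b. b \<noteq> 0 \<longrightarrow> \<psi> b = a b"
proof -
  have "(axis undefined 1 :: complex ^ 'n) \<noteq> 0" by (simp add: axis_eq_0_iff)
  then have "0 \<le> C * norm (axis undefined 1 :: complex ^ 'n) ^ j"
    using bound norm_ge_zero order_trans by blast
  then have C: "C \<ge> 0" using \<open>axis undefined 1 \<noteq> 0\<close> by (simp add: zero_le_mult_iff)
  have poly: "\<exists>p. degree p \<le> j \<and> (\<forall>z. a (b + z *s c) = poly p z)"
    if off: "\<And>z. b + z *s c \<noteq> 0" for b c
  proof -
    have growth: "cmod (a (b + z *s c)) \<le> (C * (norm b + norm c) ^ j) * norm z ^ j" if "1 \<le> norm z" for z
    proof -
      have "norm (b + z *s c) \<le> norm b + norm z * norm c"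
        by (metis norm_triangle_ineq norm_vec_scale)
      also have "\<dots> \<le> (norm b + norm c) * norm z"
        using that mult_right_mono[of 1 "norm z" "norm b"] by (simp add: algebra_simps)
      finally have "norm (b + z *s c) ^ j \<le> ((norm b + norm c) * norm z) ^ j"
        by (intro power_mono) auto
      then show ?thesis
        using bound[OF off[of z]] C by (simp add: power_mult_distrib mult.assoc) (meson mult_left_mono order_trans)
    qed
    let ?d = "\<lambda>k. (deriv ^^ k) (\<lambda>z. a (b + z *s c)) 0 / fact k"
    have "a (b + z *s c) = poly (\<Sum>k\<le>j. monom (?d k) k) z" for z
      using Liouville_polynomial[OF hol[OF off] growth, where \<xi> = z] by (simp add: poly_sum poly_monom)
    moreover have "degree (\<Sum>k\<le>j. monom (?d k) k) \<le> j"
      by (intro degree_sum_le) (auto intro: order_trans[OF degree_monom_le])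
    ultimately show ?thesis by blast
  qed
  \<comment> \<open>In degree 0 the value at the origin has to be the common value elsewhere. The
    line through \<open>b\<close> and \<open>c\<close> shows that there is one, unless it meets 0;
    then \<open>b\<close> and \<open>c\<close> are proportional.\<close>
  have const: "a b = a c" if "j = 0" "b \<noteq> 0" "c \<noteq> 0" for b c
  proof (cases "\<exists>z. b + z *s (c - b) = 0")
    case False
    then obtain p where p: "degree p \<le> j" "\<And>z. a (b + z *s (c - b)) = poly p z"
      using poly[of b "c - b"] by blast
    obtain k where "p = [:k:]" using p(1) \<open>j = 0\<close> by (metis le_zero_eq degree_eq_zeroE)
    then show ?thesis using p(2)[of 0] p(2)[of 1] by simp
  next
    case True
    then obtain z where z: "b + z *s (c - b) = 0" by blast
    have "z \<noteq> 0" using z that by auto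
    have eq: "z *s c = (z - 1) *s b"
      using z by (simp add: vec_eq_iff algebra_simps eq_neg_iff_add_eq_0 add_eq_0_iff)
    then have "z - 1 \<noteq> 0" using that \<open>z \<noteq> 0\<close> by auto
    have "a c = a (z *s c)" using hom[of z c] that \<open>z \<noteq> 0\<close> by simp
    also have "\<dots> = a b" using eq hom[of "z - 1" b] that \<open>z - 1 \<noteq> 0\<close> by simp
    finally show ?thesis by simp
  qed
  \<comment> \<open>Homogeneity forces the value 0 at the origin for \<open>j > 0\<close>; for
    \<open>j = 0\<close> any nonzero vector supplies the constant.\<close>
  define \<psi> where "\<psi> b = (if b \<noteq> 0 then a b else if j = 0 then a (axis undefined 1) else 0)" for b
  have "\<psi> \<in> forms j"
  proof (rule forms_of_homogeneous[where d = j])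
    show "\<psi> (z *s b) = z ^ j * \<psi> b" if "z \<noteq> 0" for z b
      using hom[of z b] that by (auto simp: \<psi>_def)
    fix b :: "complex ^ 'n" and i
    have eq: "upd b i z = upd b i 0 + z *s axis i 1" for z
      by (auto simp: vec_eq_iff upd_def axis_def)
    show "\<exists>p. degree p \<le> j \<and> (\<forall>z. \<psi> (upd b i z) = poly p z)"
    proof (cases "upd b i 0 = 0")
      case False
      then obtain k where "k \<noteq> i" "b $ k \<noteq> 0" by (auto simp: upd_def vec_eq_iff split: if_splits)
      then have nz: "upd b i z \<noteq> 0" for z by (auto simp: upd_def vec_eq_iff intro!: exI[of _ k])
      then obtain p where "degree p \<le> j" "\<And>z. a (upd b i z) = poly p z"
        using poly[of "upd b i 0" "axis i 1"] unfolding eq[symmetric] by blast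
      then show ?thesis using nz by (auto simp: \<psi>_def)
    next
      case True
      have ax: "axis i 1 \<noteq> (0 :: complex ^ 'n)" by (simp add: axis_eq_0_iff)
      have "\<psi> (upd b i z) = poly (monom (a (axis i 1)) j) z" for z
      proof -
        have "upd b i z = z *s axis i 1" using eq[of z] True by simp
        then show ?thesis
          using hom[of z "axis i 1"] ax const[of "axis undefined 1" "axis i 1"] \<open>axis undefined 1 \<noteq> 0\<close>
          by (cases "z = 0") (simp_all add: \<psi>_def poly_monom power_0_left)
      qed
      moreover have "degree (monom (a (axis i 1)) j) \<le> j" by (rule degree_monom_le)
      ultimately show ?thesis by blast
    qed
  qed
  moreover have "\<psi> b = a b" if "b \<noteq> 0" for b using that by (simp add: \<psi>_def)
  ultimately show ?thesis by blast
qed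

text \<open>The function is not extended across the origin in several variables. On each complex
  line through 0 the singularity is removable, and Cauchy estimates uniform in the direction
  \<open>b\<close> give both the growth of the coefficients \<open>a j b\<close> and a uniform
  remainder.\<close>

theorem taylor_at_puncture:
  fixes f :: "complex ^ 'n::finite \<Rightarrow> complex"
  assumes "\<forall>\<^sub>F u in at 0. cdiff f u" "big_oh UNIV 0 f"
  shows "\<exists>\<phi>. (\<forall>j. \<phi> j \<in> forms j) \<and> (\<forall>K. big_oh UNIV K (\<lambda>u. f u - (\<Sum>j<K. \<phi> j u)))"
proof -
  obtain B where "B > 0" and B0: "\<forall>\<^sub>F u in at 0. cmod (f u) \<le> B"
    using big_ohE[OF assms(2)] by auto
  from assms(1) B0 have "\<forall>\<^sub>F u in at 0. cdiff f u \<and> cmod (f u) \<le> B"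
    by eventually_elim simp
  then obtain \<rho> where "\<rho> > 0" and \<rho>: "\<And>u. u \<noteq> 0 \<Longrightarrow> norm u < \<rho> \<Longrightarrow> cdiff f u \<and> cmod (f u) \<le> B"
    by (auto simp: eventually_at)
  have "\<exists>g. g holomorphic_on ball 0 (\<rho> / norm b) \<and> (\<forall>s\<in>ball 0 (\<rho> / norm b) - {0}. g s = f (s *s b))"
    if "b \<noteq> 0" for b
  proof -
    let ?S = "ball 0 (\<rho> / norm b) :: complex set"
    have in_ball: "s *s b \<noteq> 0 \<and> norm (s *s b) < \<rho>" if "s \<in> ?S - {0}" for s
      using that \<open>b \<noteq> 0\<close> by (simp add: norm_vec_scale field_simps)
    have "(\<lambda>s. f (s *s b)) holomorphic_on ?S - {0}"
      unfolding holomorphic_on_def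
    proof
      fix s assume "s \<in> ?S - {0}"
      then have "cdiff f (0 + s *s b)" using in_ball \<rho> by simp
      from cdiff_along_line[OF this] show "(\<lambda>s. f (s *s b)) field_differentiable at s within ?S - {0}"
        by (simp add: field_differentiable_at_within)
    qed
    moreover have "0 \<in> interior ?S" using \<open>\<rho> > 0\<close> \<open>b \<noteq> 0\<close> by (simp add: interior_open)
    moreover have "\<forall>\<^sub>F s in at 0. cmod (f (s *s b)) \<le> B"
      unfolding eventually_at
      using \<rho> in_ball \<open>\<rho> > 0\<close> \<open>b \<noteq> 0\<close> by (intro exI[of _ "\<rho> / norm b"]) auto
    ultimately show ?thesis
      using holomorphic_on_extend_bounded[of "\<lambda>s. f (s *s b)" ?S 0] by blast
  qed
  then obtain g where hol_g: "\<And>b. b \<noteq> 0 \<Longrightarrow> g b holomorphic_on ball 0 (\<rho> / norm b)"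
    and g: "\<And>b s. b \<noteq> 0 \<Longrightarrow> s \<noteq> 0 \<Longrightarrow> norm s < \<rho> / norm b \<Longrightarrow> g b s = f (s *s b)"
    by (metis Diff_iff mem_ball_0 singletonD)
  define a where "a j b = (deriv ^^ j) (g b) 0 / fact j" for j b
  \<comment> \<open>Cauchy's inequality will be used on the circle of radius
    \<open>\<rho> / 2 / norm b\<close>, half of the radius of holomorphy.\<close>
  define D where "D = 2 / \<rho>"
  have "D > 0" using \<open>\<rho> > 0\<close> by (simp add: D_def)
  have bound: "cmod (a j b) \<le> B * (D * norm b) ^ j" if "b \<noteq> 0" for j b
  proof -
    define r where "r = \<rho> / 2 / norm b"
    have r: "0 < r" "r < \<rho> / norm b" using that \<open>\<rho> > 0\<close> by (auto simp: r_def field_simps)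
    have "cmod ((deriv ^^ j) (g b) 0) \<le> fact j * B / r ^ j"
    proof (rule Cauchy_inequality)
      show "g b holomorphic_on ball 0 r" using hol_g[OF that] by (rule holomorphic_on_subset) (use r in auto)
      show "continuous_on (cball 0 r) (g b)"
        by (rule holomorphic_on_imp_continuous_on[OF holomorphic_on_subset[OF hol_g[OF that]]]) (use r in auto)
      show "cmod (g b s) \<le> B" if "cmod (0 - s) = r" for s
      proof -
        have "s \<noteq> 0" "norm s < \<rho> / norm b" using that r by auto
        then show ?thesis using g[OF \<open>b \<noteq> 0\<close>, of s] \<rho>[of "s *s b"] \<open>b \<noteq> 0\<close>
          by (simp add: norm_vec_scale field_simps)
      qed
    qed (use r in auto)
    then have "cmod (a j b) \<le> B / r ^ j" by (simp add: a_def norm_divide field_simps)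
    also have "\<dots> = B * (D * norm b) ^ j"
    proof -
      have "D * norm b = inverse r" using that \<open>\<rho> > 0\<close> by (simp add: r_def D_def field_simps)
      then show ?thesis by (simp add: divide_inverse power_inverse)
    qed
    finally show ?thesis .
  qed
  \<comment> \<open>A quarter of the radius makes \<open>D * norm b * norm s\<close> at most 1/2, so
    the tail is dominated by a geometric series whose ratio is at most 1/2.\<close>
  have rem: "cmod (f (s *s b) - (\<Sum>j<K. a j b * s ^ j)) \<le> 2 * B * (D * norm b * norm s) ^ K"
    if "b \<noteq> 0" "s \<noteq> 0" "norm s \<le> \<rho> / 4 / norm b" for b s K
  proof -
    have s: "norm s < \<rho> / norm b"
      using that \<open>\<rho> > 0\<close> by (intro le_less_trans[OF that(3)] divide_strict_right_mono) auto
    then have "(\<lambda>n. a n b * s ^ n) sums f (s *s b)"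
      using holomorphic_power_series[OF hol_g[OF that(1)], of s] g[OF that(1,2) s] by (simp add: a_def)
    then have sums: "(\<lambda>n. a (n + K) b * s ^ (n + K)) sums (f (s *s b) - (\<Sum>j<K. a j b * s ^ j))"
      by (rule sums_split_initial_segment)
    define x where "x = D * norm b * norm s"
    have x: "0 \<le> x" "x \<le> 1/2"
      using that \<open>\<rho> > 0\<close> by (auto simp: x_def D_def field_simps)
    have le: "cmod (a (n + K) b * s ^ (n + K)) \<le> B * x ^ K * x ^ n" for n
    proof -
      have "cmod (a (n + K) b * s ^ (n + K)) \<le> (B * (D * norm b) ^ (n + K)) * norm s ^ (n + K)"
        using bound[OF that(1), of "n + K"] by (simp add: norm_mult norm_power mult_right_mono)
      also have "\<dots> = B * x ^ K * x ^ n" by (simp add: x_def power_mult_distrib power_add mult_ac)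
      finally show ?thesis .
    qed
    have geo: "(\<lambda>n. B * x ^ K * x ^ n) sums (B * x ^ K * (1 / (1 - x)))"
      using x by (intro sums_mult geometric_sums) auto
    have "cmod (f (s *s b) - (\<Sum>j<K. a j b * s ^ j)) \<le> B * x ^ K * (1 / (1 - x))"
      using norm_suminf_le[OF le sums_summable[OF geo]] sums_unique[OF sums] sums_unique[OF geo] by simp
    also have "\<dots> \<le> B * x ^ K * 2"
      using x \<open>B > 0\<close> by (intro mult_left_mono) (auto simp: field_simps)
    finally show ?thesis by (simp add: x_def mult_ac)
  qed
  have bo: "big_oh UNIV K (\<lambda>s. f (s *s b) - (\<Sum>j<K. a j b * s ^ j))" if "b \<noteq> 0" for b K
  proof (rule big_ohI)
    show "\<forall>\<^sub>F s in at 0. cmod (f (s *s b) - (\<Sum>j<K. a j b * s ^ j)) \<le> (2 * B * (D * norm b) ^ K) * norm s ^ K"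
      using eventually_norm_less_at_0[of "\<rho> / 4 / norm b"] eventually_nonzero_at_0
      by (rule eventually_elim2) (use that \<open>\<rho> > 0\<close> rem[OF that, of _ K] in \<open>auto simp: power_mult_distrib mult_ac\<close>)
  qed
  \<comment> \<open>As a function of \<open>s\<close>, \<open>f (s *s (z *s b))\<close> expands
    along \<open>b\<close> in powers of \<open>s * z\<close> and along \<open>z *s b\<close> in
    powers of \<open>s\<close>; the coefficients are compared.\<close>
  have hom: "a j (z *s b) = z ^ j * a j b" if "z \<noteq> 0" "b \<noteq> 0" for j z b
  proof -
    have nz: "z *s b \<noteq> 0" using that by simp
    have "big_oh UNIV (Suc j) (\<lambda>s. f ((s * z) *s b) - (\<Sum>i<Suc j. a i b * (s * z) ^ i))"
    proof (rule big_oh_compose[OF bo[OF that(2), of "Suc j"], where c = "\<lambda>s. s * z" and K = "norm z"])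
      show "\<forall>\<^sub>F t in at 0. cmod (t * z) \<le> cmod z * cmod t" by (simp add: norm_mult mult.commute)
      show "\<forall>\<^sub>F t in at 0. t * z \<noteq> 0"
        using eventually_nonzero_at_0[where 'a = complex and S = UNIV] that by simp
    qed simp
    then have "big_oh UNIV (Suc j) (\<lambda>s. f (s *s (z *s b)) - (\<Sum>i<Suc j. a i b * (s * z) ^ i))"
      by simp
    from big_oh_diff[OF this bo[OF nz, of "Suc j"]]
    have "big_oh UNIV (Suc j) (\<lambda>s. (\<Sum>i<Suc j. a i (z *s b) * s ^ i) - (\<Sum>i<Suc j. a i b * (s * z) ^ i))"
      by (simp add: algebra_simps)
    also have "(\<lambda>s. (\<Sum>i<Suc j. a i (z *s b) * s ^ i) - (\<Sum>i<Suc j. a i b * (s * z) ^ i)) =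
        poly (\<Sum>i<Suc j. monom (a i (z *s b) - z ^ i * a i b) i)"
      unfolding poly_sum poly_monom sum_subtractf[symmetric]
      by (intro ext sum.cong) (simp_all add: algebra_simps power_mult_distrib)
    finally have "big_oh UNIV (Suc j) (poly (\<Sum>i<Suc j. monom (a i (z *s b) - z ^ i * a i b) i))" .
    from big_oh_poly_imp_coeff_0[OF this, of j] show ?thesis
      by (simp add: coeff_sum)
  qed
  \<comment> \<open>Removing the terms below \<open>j\<close>, holomorphic by induction, and
    dividing by \<open>\<sigma> n ^ j\<close> gives holomorphic functions \<open>h n\<close> of
    \<open>z\<close>. They converge locally uniformly to the coefficient of degree \<open>j\<close>
    as \<open>\<sigma> n\<close> tends to 0.\<close>
  have hol: "(\<lambda>z. a j (b + z *s c)) holomorphic_on UNIV" if off: "\<And>z. b + z *s c \<noteq> 0" for j b c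
  proof (induction j rule: less_induct)
    case (less j)
    have "(\<lambda>z. a j (b + z *s c)) holomorphic_on ball 0 R" if "R > 0" for R
    proof -
      define M where "M = norm b + R * norm c + 1"
      have "M > 0" using that by (simp add: M_def add_nonneg_pos)
      have M: "norm (b + z *s c) \<le> M" if "z \<in> ball 0 R" for z
      proof -
        have "norm (b + z *s c) \<le> norm b + norm z * norm c"
          by (metis norm_triangle_ineq norm_vec_scale)
        also have "norm z * norm c \<le> R * norm c" using that by (intro mult_right_mono) auto
        finally show ?thesis by (simp add: M_def)
      qed
      \<comment> \<open>The scale keeps \<open>\<sigma> n *s (b + z *s c)\<close> within
        \<open>\<rho> / 4\<close> of the origin for every \<open>z\<close> in the ball, where the
        remainder estimate applies.\<close>
      define \<sigma> :: "nat \<Rightarrow> complex" where "\<sigma> n = of_real (\<rho> / 4 / M / real (Suc n))" for n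
      have \<sigma>: "\<sigma> n \<noteq> (0::complex)" "norm (\<sigma> n :: complex) = \<rho> / 4 / M / real (Suc n)" for n
      proof -
        have "\<rho> / 4 / M / real (Suc n) > 0" using \<open>\<rho> > 0\<close> \<open>M > 0\<close> by simp
        then show "norm (\<sigma> n :: complex) = \<rho> / 4 / M / real (Suc n)" unfolding \<sigma>_def norm_of_real by (rule abs_of_pos)
        then show "\<sigma> n \<noteq> (0::complex)" using \<open>\<rho> / 4 / M / real (Suc n) > 0\<close> by (metis norm_zero less_irrefl)
      qed
      have \<sigma>_small: "norm (\<sigma> n :: complex) \<le> \<rho> / 4 / norm (b + z *s c)" if "z \<in> ball 0 R" for z n
      proof -
        have "\<rho> / 4 / M / real (Suc n) \<le> \<rho> / 4 / M / 1"
          using \<open>\<rho> > 0\<close> \<open>M > 0\<close> by (intro divide_left_mono) auto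
        also have "\<dots> \<le> \<rho> / 4 / norm (b + z *s c)"
          using M[OF that] off[of z] \<open>\<rho> > 0\<close> \<open>M > 0\<close> by (simp add: frac_le)
        finally show ?thesis by (simp add: \<sigma>)
      qed
      define h where "h n z = (f (\<sigma> n *s (b + z *s c)) - (\<Sum>l<j. a l (b + z *s c) * \<sigma> n ^ l)) / \<sigma> n ^ j" for n z
      have hh: "cmod (h n z - a j (b + z *s c)) \<le> 2 * B * (D * M) ^ Suc j * norm (\<sigma> n :: complex)"
        if "z \<in> ball 0 R" for n z
      proof -
        let ?s = "\<sigma> n :: complex" and ?b = "b + z *s c"
        have "cmod (f (?s *s ?b) - (\<Sum>l<Suc j. a l ?b * ?s ^ l)) \<le> 2 * B * (D * norm ?b * norm ?s) ^ Suc j"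
          by (rule rem) (use off \<sigma> \<sigma>_small[OF that] in auto)
        also have "\<dots> \<le> 2 * B * (D * M * norm ?s) ^ Suc j"
          using M[OF that] \<open>B > 0\<close> \<open>D > 0\<close> by (intro mult_left_mono power_mono mult_right_mono) auto
        finally have "cmod (f (?s *s ?b) - (\<Sum>l<Suc j. a l ?b * ?s ^ l)) / norm ?s ^ j \<le> 2 * B * (D * M * norm ?s) ^ Suc j / norm ?s ^ j"
          by (intro divide_right_mono) auto
        also have "\<dots> = 2 * B * (D * M) ^ Suc j * norm ?s"
          using \<sigma>(1)[of n] by (simp add: power_mult_distrib)
        also have "cmod (f (?s *s ?b) - (\<Sum>l<Suc j. a l ?b * ?s ^ l)) / norm ?s ^ j = cmod (h n z - a j ?b)"
          unfolding h_def norm_power[symmetric] norm_divide[symmetric]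
          using \<sigma>(1)[of n] by (simp add: diff_divide_distrib add_divide_distrib diff_diff_eq)
        finally show ?thesis .
      qed
      show ?thesis
      proof (rule holomorphic_uniform_sequence[where f = h])
        show "h n holomorphic_on ball 0 R" for n
        proof -
          have "(\<lambda>z. f (\<sigma> n *s (b + z *s c))) holomorphic_on ball 0 R"
            unfolding holomorphic_on_def
          proof
            fix z :: complex assume z: "z \<in> ball 0 R"
            have eq: "\<sigma> n *s (b + z *s c) = \<sigma> n *s b + z *s (\<sigma> n *s c)" for z
              by (simp add: vec_eq_iff algebra_simps)
            have "norm (\<sigma> n *s (b + z *s c)) \<le> \<rho> / 4"
              unfolding norm_vec_scale using \<sigma>_small[OF z, of n] off[of z] by (simp add: field_simps del: vector_sadd_rdistrib)
            moreover have "\<sigma> n *s (b + z *s c) \<noteq> 0" using off[of z] \<sigma>(1)[of n] by (metis vec.scale_eq_0_iff)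
            ultimately have "cdiff f (\<sigma> n *s (b + z *s c))" using \<rho> \<open>\<rho> > 0\<close> by auto
            then show "(\<lambda>z. f (\<sigma> n *s (b + z *s c))) field_differentiable at z within ball 0 R"
              unfolding eq
              by (rule field_differentiable_at_within[OF cdiff_along_line[of f "\<sigma> n *s b" z "\<sigma> n *s c"]])
          qed
          moreover have "(\<lambda>z. a l (b + z *s c)) holomorphic_on ball 0 R" if "l < j" for l
            using less.IH[OF that] by (rule holomorphic_on_subset) simp
          ultimately show ?thesis unfolding h_def
            by (intro holomorphic_on_divide holomorphic_on_diff holomorphic_on_sum holomorphic_on_mult
                holomorphic_on_const) (simp_all add: \<sigma>(1))
        qed
        fix z :: complex assume z: "z \<in> ball 0 R"
        then obtain d where d: "d > 0" "cball z d \<subseteq> ball 0 R"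
          using open_contains_cball[of "ball (0::complex) R"] open_ball by blast
        have "uniform_limit (cball z d) h (\<lambda>z. a j (b + z *s c)) sequentially"
          unfolding uniform_limit_iff
        proof (intro allI impI)
          fix e :: real assume "e > 0"
          have "(\<lambda>n. 2 * B * (D * M) ^ Suc j * (\<rho> / 4 / M / real (Suc n))) \<longlonglongrightarrow> 0"
            by (rule tendsto_mult_right_zero) (rule LIMSEQ_Suc[OF lim_const_over_n])
          then have "\<forall>\<^sub>F n in sequentially. 2 * B * (D * M) ^ Suc j * (\<rho> / 4 / M / real (Suc n)) < e"
            using \<open>e > 0\<close> by (rule order_tendstoD)
          then show "\<forall>\<^sub>F n in sequentially. \<forall>x\<in>cball z d. dist (h n x) (a j (b + x *s c)) < e"
          proof eventually_elim
            case (elim n)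
            show ?case
            proof
              fix x assume "x \<in> cball z d"
              then have "x \<in> ball 0 R" using d by auto
              from hh[OF this, of n] elim show "dist (h n x) (a j (b + x *s c)) < e"
                unfolding dist_norm \<sigma> by linarith
            qed
          qed
        qed
        with d show "\<exists>d>0. cball z d \<subseteq> ball 0 R \<and> uniform_limit (cball z d) h (\<lambda>z. a j (b + z *s c)) sequentially"
          by blast
      qed simp
    qed
    then have "(\<lambda>z. a j (b + z *s c)) field_differentiable at z" for z
      using holomorphic_on_imp_differentiable_at[of _ "ball 0 (norm z + 1)" z] by (simp add: add_nonneg_pos)
    then show ?case by (simp add: holomorphic_on_def field_differentiable_at_within)
  qed
  have "\<exists>\<psi>\<in>forms j. \<forall>b. b \<noteq> 0 \<longrightarrow> \<psi> b = a j b" for j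
  proof (rule homogeneous_entire_imp_forms)
    show "cmod (a j b) \<le> (B * D ^ j) * norm b ^ j" if "b \<noteq> 0" for b
      using bound[OF that, of j] by (simp add: power_mult_distrib mult_ac)
  qed (use hol hom in auto)
  then obtain \<phi> where \<phi>: "\<And>j. \<phi> j \<in> forms j" "\<And>j b. b \<noteq> 0 \<Longrightarrow> \<phi> j b = a j b"
    by metis
  have "big_oh UNIV K (\<lambda>u. f u - (\<Sum>j<K. \<phi> j u))" for K
  proof (rule big_ohI)
    show "\<forall>\<^sub>F u in at 0. cmod (f u - (\<Sum>j<K. \<phi> j u)) \<le> (2 * B * D ^ K) * norm u ^ K"
      using eventually_norm_less_at_0[of "\<rho> / 4"] eventually_nonzero_at_0
    proof (rule eventually_elim2)
      fix u :: "complex ^ 'n" assume u: "norm u < \<rho> / 4" "u \<noteq> 0"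
      have "cmod (f (1 *s u) - (\<Sum>j<K. a j u * 1 ^ j)) \<le> 2 * B * (D * norm u * norm (1::complex)) ^ K"
        by (rule rem) (use u \<open>\<rho> > 0\<close> in \<open>auto simp: field_simps\<close>)
      then show "cmod (f u - (\<Sum>j<K. \<phi> j u)) \<le> (2 * B * D ^ K) * norm u ^ K"
        using u by (simp add: \<phi>(2) power_mult_distrib mult_ac)
    qed (use \<open>\<rho> > 0\<close> in auto)
  qed
  with \<phi>(1) show ?thesis by blast
qed

section \<open>Leading terms\<close>

text \<open>In use \<open>g\<close> is a form, or a monomial in \<open>t\<close>, of degree
  \<open>k\<close>. The relation is stable under products, with the orders adding, so the leading
  part of a product is found without any higher terms of the factors.\<close>

definition leading :: "'a::real_normed_vector set \<Rightarrow> nat \<Rightarrow> ('a \<Rightarrow> complex) \<Rightarrow> ('a \<Rightarrow> complex) \<Rightarrow> bool" where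
  "leading S k f g \<longleftrightarrow> big_oh S k g \<and> big_oh S (Suc k) (\<lambda>u. f u - g u)"

lemma leading_imp_big_oh: "leading S k f g \<Longrightarrow> big_oh S k f"
  using big_oh_add[of S k g "\<lambda>u. f u - g u"] big_oh_mono[of S "Suc k" "\<lambda>u. f u - g u" k]
  by (simp add: leading_def)

lemma leading_mult:
  assumes "leading S k f f'" "leading S l g g'"
  shows "leading S (k + l) (\<lambda>u. f u * g u) (\<lambda>u. f' u * g' u)"
proof -
  have "big_oh S (k + Suc l) (\<lambda>u. f u * (g u - g' u))"
    using assms by (intro big_oh_mult leading_imp_big_oh[of S k f f']) (auto simp: leading_def)
  moreover have "big_oh S (Suc k + l) (\<lambda>u. (f u - f' u) * g' u)"
    using assms by (intro big_oh_mult) (auto simp: leading_def)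
  ultimately have "big_oh S (Suc (k + l)) (\<lambda>u. f u * (g u - g' u) + (f u - f' u) * g' u)"
    by (intro big_oh_add) simp_all
  then have "big_oh S (Suc (k + l)) (\<lambda>u. f u * g u - f' u * g' u)"
    by (simp add: algebra_simps)
  then show ?thesis using assms by (auto simp: leading_def intro: big_oh_mult)
qed

lemma leading_const: "leading S 0 (\<lambda>_. c) (\<lambda>_. c)"
  by (simp add: leading_def big_oh_const big_oh_zero)

lemma leading_power: "leading S k f g \<Longrightarrow> leading S (m * k) (\<lambda>u. f u ^ m) (\<lambda>u. g u ^ m)"
  by (induction m) (auto intro: leading_mult leading_const)

lemma leading_prod:
  assumes "finite I" "\<And>i. i \<in> I \<Longrightarrow> leading S (k i) (f i) (g i)"
  shows "leading S (\<Sum>i\<in>I. k i) (\<lambda>u. \<Prod>i\<in>I. f i u) (\<lambda>u. \<Prod>i\<in>I. g i u)"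
  using assms by (induction I rule: finite_induct) (auto intro: leading_const leading_mult)

lemma leading_cong:
  assumes "leading S k f g" "\<forall>\<^sub>F u in at 0 within S. f' u = f u"
  shows "leading S k f' g"
proof -
  have "\<forall>\<^sub>F u in at 0 within S. f' u - g u = f u - g u" using assms(2) by eventually_elim simp
  with assms show ?thesis by (auto simp: leading_def intro: big_oh_cong)
qed

lemma leading_subset: "leading T k f g \<Longrightarrow> S \<subseteq> T \<Longrightarrow> leading S k f g"
  by (auto simp: leading_def intro: big_oh_subset)

text \<open>Differentiability gives a Lipschitz bound at \<open>z\<close>, which preserves an error
  of first order. It is applied at 1, to the inverse and to the \<open>q\<close>-th root.\<close>

lemma leading_compose_deriv:
  assumes "leading S 0 f (\<lambda>_. z)" "(\<phi> has_field_derivative d) (at z)"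
  shows "leading S 0 (\<lambda>u. \<phi> (f u)) (\<lambda>_. \<phi> z)"
proof -
  have f: "big_oh S (Suc 0) (\<lambda>u. f u - z)" using assms(1) by (simp add: leading_def)
  obtain C where C: "C > 0" "\<forall>\<^sub>F u in at 0 within S. cmod (f u - z) \<le> C * norm u ^ Suc 0"
    using f by (rule big_ohE)
  have "((\<lambda>w. (\<phi> w - \<phi> z) / (w - z)) \<longlongrightarrow> d) (at z)"
    using assms(2) by (simp add: has_field_derivative_iff)
  then have "\<forall>\<^sub>F w in at z. dist ((\<phi> w - \<phi> z) / (w - z)) d < 1"
    by (rule tendstoD) simp
  then obtain e where e: "e > 0" "\<And>w. w \<noteq> z \<Longrightarrow> dist w z < e \<Longrightarrow> dist ((\<phi> w - \<phi> z) / (w - z)) d < 1"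
    by (auto simp: eventually_at)
  have lip: "cmod (\<phi> w - \<phi> z) \<le> (cmod d + 1) * cmod (w - z)" if "dist w z < e" for w
  proof (cases "w = z")
    case False
    have "cmod ((\<phi> w - \<phi> z) / (w - z)) \<le> cmod d + 1"
      using e(2)[OF False that] norm_triangle_sub[of "(\<phi> w - \<phi> z) / (w - z)" d] by (simp add: dist_norm)
    then show ?thesis using False by (simp add: norm_divide field_simps)
  qed simp
  have "(f \<longlongrightarrow> z) (at 0 within S)"
    using big_oh_tendsto_0[OF f] by (simp add: LIM_zero_iff)
  then have "\<forall>\<^sub>F u in at 0 within S. dist (f u) z < e" using e(1) by (rule tendstoD)
  with C(2) have "\<forall>\<^sub>F u in at 0 within S. cmod (\<phi> (f u) - \<phi> z) \<le> ((cmod d + 1) * C) * norm u ^ Suc 0"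
  proof eventually_elim
    case (elim u)
    have "(cmod d + 1) * cmod (f u - z) \<le> (cmod d + 1) * (C * norm u ^ Suc 0)"
      using elim by (intro mult_left_mono) auto
    with lip[OF elim(2)] show ?case by (simp add: mult.assoc)
  qed
  then show ?thesis unfolding leading_def by (auto intro: big_ohI big_oh_const)
qed

lemma leading_eventually_nonzero:
  assumes "leading S 0 f (\<lambda>_. z)" "z \<noteq> 0"
  shows "\<forall>\<^sub>F u in at 0 within S. f u \<noteq> 0"
proof -
  have "(f \<longlongrightarrow> z) (at 0 within S)"
    using big_oh_tendsto_0[of S 0 "\<lambda>u. f u - z"] assms(1) by (simp add: LIM_zero_iff leading_def)
  then show ?thesis using assms(2) by (rule tendsto_imp_eventually_ne)
qed

lemma leading_inverse: "leading S 0 f (\<lambda>_. 1) \<Longrightarrow> leading S 0 (\<lambda>u. inverse (f u)) (\<lambda>_. 1)"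
  using leading_compose_deriv[of S f 1 inverse] DERIV_inverse[of "1::complex"] by auto

lemma leading_divide:
  "leading S k f g \<Longrightarrow> leading S 0 h (\<lambda>_. 1) \<Longrightarrow> leading S k (\<lambda>u. f u / h u) g"
  using leading_mult[OF _ leading_inverse, of S k f g h] by (simp add: divide_inverse)

lemma leading_compose:
  fixes c :: "complex \<Rightarrow> 'a::real_normed_vector"
  assumes "leading S k f g" and "\<forall>\<^sub>F t in at 0. norm (c t) \<le> K * norm t"
    and "\<forall>\<^sub>F t in at 0. c t \<noteq> 0" "\<forall>\<^sub>F t in at 0. c t \<in> S"
  shows "leading UNIV k (\<lambda>t. f (c t)) (\<lambda>t. g (c t))"
  using big_oh_compose[of S k g c K] big_oh_compose[of S "Suc k" "\<lambda>u. f u - g u" c K] assms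
  by (simp add: leading_def)

lemma leading_poly: "leading UNIV 0 (poly p) (\<lambda>_. poly p 0)"
proof -
  obtain a r where p: "p = pCons a r" by (cases p)
  have "(poly r \<longlongrightarrow> poly r 0) (at 0)" using isCont_def poly_isCont by blast
  then have "\<forall>\<^sub>F t in at 0. dist (poly r t) (poly r 0) < 1" by (rule tendstoD) simp
  then have "\<forall>\<^sub>F t in at 0. cmod (poly r t) \<le> cmod (poly r 0) + 1"
    by eventually_elim (metis dist_norm norm_triangle_sub add.commute add_le_cancel_left less_imp_le order_trans)
  then have "big_oh UNIV 0 (poly r)" by (auto intro!: big_ohI)
  moreover have "big_oh UNIV 1 (\<lambda>t::complex. t)" by (rule big_ohI[where C = 1]) simp
  ultimately have "big_oh UNIV (1 + 0) (\<lambda>t. t * poly r t)" by (rule big_oh_mult[rotated])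
  then show ?thesis by (simp add: leading_def p big_oh_const)
qed

lemma big_oh_poly_diff_truncation:
  "big_oh UNIV 2 (\<lambda>t. poly p t - (coeff p 0 + coeff p 1 * t))"
proof -
  obtain a b r where p: "p = pCons a (pCons b r)" by (metis pCons_cases)
  have "big_oh UNIV 1 (\<lambda>t::complex. t)" by (rule big_ohI[where C = 1]) simp
  from big_oh_mult[OF big_oh_mult[OF this this] leading_imp_big_oh[OF leading_poly[of r]]]
  have "big_oh UNIV (1 + 1 + 0) (\<lambda>t. t * t * poly r t)" .
  then show ?thesis by (simp add: p algebra_simps numeral_2_eq_2)
qed

lemma finite_eventually_all:
  "(\<And>i::'i::finite. eventually (P i) F) \<Longrightarrow> \<forall>\<^sub>F u in F. \<forall>i. P i u"
  by (simp add: eventually_all_finite)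

section \<open>Cones around the coordinate axes\<close>

text \<open>The region where coordinate \<open>k\<close> is comparable with the norm, so that
  division by \<open>u $ k\<close> costs exactly one order. Since \<open>norm u\<close> is at most
  \<open>CARD('n)\<close> times the largest modulus of a coordinate, the constant
  \<open>CARD('n) + 1\<close> leaves a strict inequality: the cones are open and cover everything
  but the origin.\<close>

definition axis_cone :: "'n::finite \<Rightarrow> (complex ^ 'n) set" where
  "axis_cone k = {u. norm u < (real CARD('n) + 1) * norm (u $ k)}"

lemma axis_cone_nth_nonzero: "u \<in> axis_cone k \<Longrightarrow> u $ k \<noteq> 0"
  by (auto simp: axis_cone_def)

lemma open_axis_cone: "open (axis_cone k)"
  unfolding axis_cone_def by (intro open_Collect_less continuous_intros)

lemma axis_cone_scale: "z \<noteq> 0 \<Longrightarrow> z *s u \<in> axis_cone k \<longleftrightarrow> u \<in> axis_cone k"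
  by (simp add: axis_cone_def norm_vec_scale norm_mult mult.left_commute[of _ "cmod z"])

lemma norm_le_sum_nth: "norm (u :: complex ^ 'n::finite) \<le> (\<Sum>k\<in>UNIV. norm (u $ k))"
  unfolding norm_vec_def by (rule L2_set_le_sum) simp

lemma ex_axis_cone:
  fixes u :: "complex ^ 'n::finite"
  assumes "u \<noteq> 0"
  shows "\<exists>k. u \<in> axis_cone k"
proof -
  have "Max (range (\<lambda>j. norm (u $ j))) \<in> range (\<lambda>j. norm (u $ j))" by (rule Max_in) auto
  then obtain k where "Max (range (\<lambda>j. norm (u $ j))) = norm (u $ k)" by blast
  then have k: "norm (u $ j) \<le> norm (u $ k)" for j
    using Max_ge[of "range (\<lambda>j. norm (u $ j))" "norm (u $ j)"] by simp
  then have "norm u \<le> real CARD('n) * norm (u $ k)"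
    using norm_le_sum_nth[of u] sum_mono[of UNIV "\<lambda>j. norm (u $ j)" "\<lambda>_. norm (u $ k)"] by simp
  moreover have "u $ k \<noteq> 0"
  proof
    assume "u $ k = 0"
    then have "u $ j = 0" for j using k[of j] by simp
    then show False using assms by (simp add: vec_eq_iff)
  qed
  ultimately have "u \<in> axis_cone k" unfolding axis_cone_def mem_Collect_eq distrib_right
    using zero_less_norm_iff[of "u $ k"] by linarith
  then show ?thesis ..
qed

lemma eventually_at_0E:
  assumes "\<forall>\<^sub>F u::'a::real_normed_vector in at 0. P u"
  obtains d where "d > 0" "\<And>u. u \<noteq> 0 \<Longrightarrow> norm u < d \<Longrightarrow> P u"
  using assms unfolding eventually_at by auto

lemma eventually_in_set: "\<forall>\<^sub>F u in at a within S. u \<in> S"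
  by (simp add: eventually_at_filter)

lemma eventually_at_0_cones:
  assumes "\<And>k. \<forall>\<^sub>F u in at 0 within axis_cone k. P u"
  shows "\<forall>\<^sub>F u in at 0. P u"
proof -
  have "\<forall>\<^sub>F u in at 0. u \<in> axis_cone k \<longrightarrow> P u" for k
    using assms[of k] unfolding eventually_at_filter by (rule eventually_mono) simp
  then have "\<forall>\<^sub>F u in at 0. \<forall>k. u \<in> axis_cone k \<longrightarrow> P u" by (rule finite_eventually_all)
  with eventually_nonzero_at_0 show ?thesis
    by eventually_elim (use ex_axis_cone in blast)
qed

lemma big_oh_cones:
  assumes "\<And>k. big_oh (axis_cone k) m f"
  shows "big_oh UNIV m f"
proof -
  have "\<exists>C. C > 0 \<and> (\<forall>\<^sub>F u in at 0 within axis_cone k. cmod (f u) \<le> C * norm u ^ m)" for k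
    by (rule big_ohE[OF assms[of k]]) blast
  then have "\<exists>C. \<forall>k. C k > 0 \<and> (\<forall>\<^sub>F u in at 0 within axis_cone k. cmod (f u) \<le> C k * norm u ^ m)"
    by (intro choice allI)
  then obtain C where C: "\<And>k. C k > 0" "\<And>k. \<forall>\<^sub>F u in at 0 within axis_cone k. cmod (f u) \<le> C k * norm u ^ m"
    by blast
  have "\<forall>\<^sub>F u in at 0 within axis_cone k. cmod (f u) \<le> (\<Sum>k\<in>UNIV. C k) * norm u ^ m" for k
    using C(2)[of k]
  proof eventually_elim
    case (elim u)
    have "C k \<le> (\<Sum>k\<in>UNIV. C k)" by (rule member_le_sum) (use C(1) less_imp_le in auto)
    then show ?case using elim by (meson mult_right_mono norm_ge_zero order_trans zero_le_power)
  qed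
  then show ?thesis by (intro big_ohI eventually_at_0_cones)
qed

lemma leading_cones: "(\<And>k. leading (axis_cone k) m f g) \<Longrightarrow> leading UNIV m f g"
  by (auto simp: leading_def intro: big_oh_cones)

lemma big_oh_cone_divide_nth:
  assumes "big_oh S (m + p) f" "S \<subseteq> axis_cone k"
  shows "big_oh S m (\<lambda>u. f u / (u $ k) ^ p)"
proof -
  obtain C where C: "C > 0" "\<forall>\<^sub>F u in at 0 within S. cmod (f u) \<le> C * norm u ^ (m + p)"
    using assms(1) by (rule big_ohE)
  let ?M = "real CARD('a) + 1"
  have "\<forall>\<^sub>F u in at 0 within S. cmod (f u / (u $ k) ^ p) \<le> (C * ?M ^ p) * norm u ^ m"
    using C(2) eventually_in_set
  proof eventually_elim
    case (elim u)
    have cone: "u \<in> axis_cone k" using elim(2) assms(2) by blast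
    then have nz: "u $ k \<noteq> 0" by (rule axis_cone_nth_nonzero)
    have "norm u ^ p \<le> (?M * norm (u $ k)) ^ p"
      using cone by (intro power_mono) (auto simp: axis_cone_def)
    then have "C * norm u ^ m * norm u ^ p \<le> C * norm u ^ m * (?M ^ p * norm (u $ k) ^ p)"
      using C(1) by (intro mult_left_mono) (auto simp: power_mult_distrib)
    then have "cmod (f u) \<le> C * norm u ^ m * (?M ^ p * norm (u $ k) ^ p)"
      using elim(1) by (simp add: power_add mult.assoc)
    then show ?case using nz by (simp add: norm_divide norm_power field_simps)
  qed
  then show ?thesis by (rule big_ohI)
qed

lemma root_of_unity_isolated:
  assumes "q \<ge> 1"
  shows "\<exists>e>0. \<forall>z::complex. z ^ q = 1 \<longrightarrow> cmod (z - 1) < e \<longrightarrow> z = 1"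
proof -
  have "finite {z::complex. z ^ q = 1}" using assms by (intro finite_roots_unity) auto
  from finite_set_avoid[OF this, of 1] obtain e where "e > 0"
    and e: "\<And>z. z \<in> {z::complex. z ^ q = 1} \<Longrightarrow> z \<noteq> 1 \<Longrightarrow> e \<le> dist 1 z" by blast
  show ?thesis
  proof (intro exI conjI allI impI)
    fix z :: complex assume "z ^ q = 1" "cmod (z - 1) < e"
    then show "z = 1" using e[of z] by (auto simp: dist_norm norm_minus_commute)
  qed fact
qed

section \<open>Extending identities by density and gluing across cones\<close>

lemma eq_0_of_dense:
  fixes \<psi> :: "complex ^ 'n::finite \<Rightarrow> complex"
  assumes "isCont \<psi> u" "u \<in> closure G" "open W" "u \<in> W" "\<And>v. v \<in> G \<Longrightarrow> v \<in> W \<Longrightarrow> \<psi> v = 0"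
  shows "\<psi> u = 0"
proof (rule ccontr)
  assume "\<psi> u \<noteq> 0"
  then have "\<forall>\<^sub>F v in nhds u. \<psi> v \<noteq> 0"
    using assms(1) by (intro tendsto_imp_eventually_ne) (auto simp: isCont_def tendsto_at_iff_tendsto_nhds)
  moreover have "\<forall>\<^sub>F v in nhds u. v \<in> W" using assms(3,4) by (rule eventually_nhds_in_open)
  ultimately have "\<forall>\<^sub>F v in nhds u. \<psi> v \<noteq> 0 \<and> v \<in> W" by eventually_elim simp
  then obtain S where S: "open S" "u \<in> S" "\<And>v. v \<in> S \<Longrightarrow> \<psi> v \<noteq> 0 \<and> v \<in> W"
    by (auto simp: eventually_nhds)
  then have "S \<inter> G \<noteq> {}" using assms(2) open_Int_closure_eq_empty by blast
  then show False using S(3) assms(5) by blast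
qed

text \<open>Curves give identities at points of \<open>G\<close> only. Both sides are continuous off
  the origin, and the density of \<open>G\<close> near the origin does the rest.\<close>

lemma eventually_eq_of_dense:
  fixes \<psi> :: "complex ^ 'n::finite \<Rightarrow> complex"
  assumes "\<forall>\<^sub>F u in at 0. u \<in> closure G" "\<forall>\<^sub>F u in at 0. cdiff \<psi> u" "\<forall>\<^sub>F u in at 0. cdiff \<phi> u"
    and "open S" "\<forall>\<^sub>F u in at 0 within S. u \<in> G \<longrightarrow> \<psi> u = \<phi> u"
  shows "\<forall>\<^sub>F u in at 0 within S. \<psi> u = \<phi> u"
proof -
  have "\<forall>\<^sub>F u in at 0. u \<in> S \<longrightarrow> u \<in> G \<longrightarrow> \<psi> u = \<phi> u"
    using assms(5) unfolding eventually_at_filter by (rule eventually_mono) simp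
  with assms(1-3) have "\<forall>\<^sub>F u in at 0. u \<in> closure G \<and> cdiff \<psi> u \<and> cdiff \<phi> u \<and> (u \<in> S \<longrightarrow> u \<in> G \<longrightarrow> \<psi> u = \<phi> u)"
    by (intro eventually_conj)
  then obtain d where d: "d > 0" "\<And>u. u \<noteq> 0 \<Longrightarrow> norm u < d \<Longrightarrow>
      u \<in> closure G \<and> cdiff \<psi> u \<and> cdiff \<phi> u \<and> (u \<in> S \<longrightarrow> u \<in> G \<longrightarrow> \<psi> u = \<phi> u)"
    by (rule eventually_at_0E) blast
  have "\<psi> u = \<phi> u" if "u \<in> S" "u \<noteq> 0" "norm u < d" for u
  proof -
    have "(\<lambda>u. \<psi> u - \<phi> u) u = 0"
    proof (rule eq_0_of_dense[where W = "S \<inter> (ball 0 d - {0})"])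
      show "isCont (\<lambda>u. \<psi> u - \<phi> u) u" using d(2)[OF that(2,3)] by (intro cdiff_imp_isCont cdiff_diff) auto
      show "open (S \<inter> (ball 0 d - {0}))" using assms(4) by auto
    qed (use d that in auto)
    then show ?thesis by simp
  qed
  then show ?thesis using d(1) by (auto simp: eventually_at)
qed

text \<open>Agreement on \<open>G\<close> spreads to the whole overlap of two cones by density, so
  the value may be taken from any cone that contains the point. Near a given point one open cone
  serves, which gives differentiability.\<close>

lemma patch_cones:
  fixes \<phi> :: "'n::finite \<Rightarrow> complex ^ 'n \<Rightarrow> complex"
  assumes dense: "\<forall>\<^sub>F u in at 0. u \<in> closure G"
    and diff: "\<And>k. \<forall>\<^sub>F u in at 0 within axis_cone k. cdiff (\<phi> k) u"
    and agree: "\<And>k l. \<forall>\<^sub>F u in at 0 within axis_cone k \<inter> axis_cone l. u \<in> G \<longrightarrow> \<phi> k u = \<phi> l u"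
  shows "\<exists>\<psi>. (\<forall>\<^sub>F u in at 0. cdiff \<psi> u) \<and> (\<forall>k. \<forall>\<^sub>F u in at 0 within axis_cone k. \<psi> u = \<phi> k u)"
proof -
  have "\<forall>\<^sub>F u in at 0. u \<in> axis_cone k \<longrightarrow> cdiff (\<phi> k) u" for k
    using diff[of k] unfolding eventually_at_filter by (rule eventually_mono) simp
  then have 1: "\<forall>\<^sub>F u in at 0. \<forall>k. u \<in> axis_cone k \<longrightarrow> cdiff (\<phi> k) u" by (rule finite_eventually_all)
  have "\<forall>\<^sub>F u in at 0. u \<in> axis_cone k \<longrightarrow> u \<in> axis_cone l \<longrightarrow> u \<in> G \<longrightarrow> \<phi> k u = \<phi> l u" for k l
    using agree[of k l] unfolding eventually_at_filter by (rule eventually_mono) simp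
  then have 2: "\<forall>\<^sub>F u in at 0. \<forall>k l. u \<in> axis_cone k \<longrightarrow> u \<in> axis_cone l \<longrightarrow> u \<in> G \<longrightarrow> \<phi> k u = \<phi> l u"
    by (intro finite_eventually_all)
  from dense 1 2 have "\<forall>\<^sub>F u in at 0. u \<in> closure G \<and> (\<forall>k. u \<in> axis_cone k \<longrightarrow> cdiff (\<phi> k) u) \<and>
      (\<forall>k l. u \<in> axis_cone k \<longrightarrow> u \<in> axis_cone l \<longrightarrow> u \<in> G \<longrightarrow> \<phi> k u = \<phi> l u)"
    by (intro eventually_conj)
  then obtain d where d1: "d > 0" and d2: "\<And>u. u \<noteq> 0 \<Longrightarrow> norm u < d \<Longrightarrow>
      u \<in> closure G \<and> (\<forall>k. u \<in> axis_cone k \<longrightarrow> cdiff (\<phi> k) u) \<and>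
      (\<forall>k l. u \<in> axis_cone k \<longrightarrow> u \<in> axis_cone l \<longrightarrow> u \<in> G \<longrightarrow> \<phi> k u = \<phi> l u)"
    by (rule eventually_at_0E) blast
  then have d: "d > 0" "\<And>u. u \<noteq> 0 \<Longrightarrow> norm u < d \<Longrightarrow> u \<in> closure G"
      "\<And>u k. u \<noteq> 0 \<Longrightarrow> norm u < d \<Longrightarrow> u \<in> axis_cone k \<Longrightarrow> cdiff (\<phi> k) u"
      "\<And>u k l. u \<noteq> 0 \<Longrightarrow> norm u < d \<Longrightarrow> u \<in> axis_cone k \<Longrightarrow> u \<in> axis_cone l \<Longrightarrow> u \<in> G \<Longrightarrow> \<phi> k u = \<phi> l u"
    by blast+
  have eq: "\<phi> k u = \<phi> l u" if "u \<noteq> 0" "norm u < d" "u \<in> axis_cone k" "u \<in> axis_cone l" for u k l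
  proof -
    have "(\<lambda>u. \<phi> k u - \<phi> l u) u = 0"
    proof (rule eq_0_of_dense[where W = "(axis_cone k \<inter> axis_cone l) \<inter> (ball 0 d - {0})"])
      show "isCont (\<lambda>u. \<phi> k u - \<phi> l u) u"
        using that by (intro cdiff_imp_isCont cdiff_diff d(3))
      show "open ((axis_cone k \<inter> axis_cone l) \<inter> (ball 0 d - {0}))"
        by (intro open_Int open_axis_cone open_Diff open_ball closed_singleton)
      show "\<phi> k v - \<phi> l v = 0" if "v \<in> G" "v \<in> (axis_cone k \<inter> axis_cone l) \<inter> (ball 0 d - {0})" for v
        using d(4)[of v k l] that by simp
    qed (use d(2) that in auto)
    then show ?thesis by simp
  qed
  define \<psi> where "\<psi> u = \<phi> (SOME k. u \<in> axis_cone k) u" for u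
  have \<psi>: "\<psi> u = \<phi> k u" if "u \<noteq> 0" "norm u < d" "u \<in> axis_cone k" for u k
    unfolding \<psi>_def using someI[of "\<lambda>k. u \<in> axis_cone k", OF that(3)] by (intro eq) (use that in auto)
  have "cdiff \<psi> u" if "u \<noteq> 0" "norm u < d" for u
  proof -
    obtain k where k: "u \<in> axis_cone k" using ex_axis_cone[OF \<open>u \<noteq> 0\<close>] by blast
    have "\<forall>\<^sub>F v in nhds u. v \<in> axis_cone k \<inter> (ball 0 d - {0})"
      by (rule eventually_nhds_in_open) (use open_axis_cone k that in auto)
    then have "\<forall>\<^sub>F v in nhds u. \<psi> v = \<phi> k v"
      by eventually_elim (auto intro: \<psi>)
    then show ?thesis using d(3)[OF that k] cdiff_cong by blast
  qed
  then have "\<forall>\<^sub>F u in at 0. cdiff \<psi> u" using d(1) by (auto simp: eventually_at)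
  moreover have "\<forall>\<^sub>F u in at 0 within axis_cone k. \<psi> u = \<phi> k u" for k
    using d(1) \<psi> by (auto simp: eventually_at)
  ultimately show ?thesis by blast
qed

lemma poly_along_axis_of_forms:
  assumes "f \<in> forms p"
  shows "\<exists>r. degree r \<le> p \<and> (\<forall>z. f (upd b i z) = poly r z)"
proof -
  have eq: "upd b i 0 + z *s axis i 1 = upd b i z" for z
    by (auto simp: vec_eq_iff upd_def axis_def)
  show ?thesis using poly_of_forms_along_line[OF assms, of "upd b i 0" "axis i 1"] unfolding eq .
qed

lemma forms_mult:
  assumes "f \<in> forms p" "g \<in> forms q"
  shows "(\<lambda>s. f s * g s) \<in> forms (p + q)"
proof (rule forms_of_homogeneous[where d = "p + q"])
  show "f (z *s b) * g (z *s b) = z ^ (p + q) * (f b * g b)" for z b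
    using assms by (simp add: forms_scale power_add mult_ac)
  fix b :: "complex ^ 'a" and i
  obtain r where r: "degree r \<le> p" "\<And>z. f (upd b i z) = poly r z"
    using poly_along_axis_of_forms[OF assms(1)] by blast
  obtain s where s: "degree s \<le> q" "\<And>z. g (upd b i z) = poly s z"
    using poly_along_axis_of_forms[OF assms(2)] by blast
  have "degree (r * s) \<le> p + q" using r s degree_mult_le[of r s] by linarith
  then show "\<exists>t. degree t \<le> p + q \<and> (\<forall>z. f (upd b i z) * g (upd b i z) = poly t z)"
    by (intro exI[of _ "r * s"]) (simp add: r s)
qed

lemma forms_power: "f \<in> forms p \<Longrightarrow> (\<lambda>s. f s ^ m) \<in> forms (m * p)"
proof (induction m)
  case 0
  have "(\<lambda>s. 1) \<in> forms 0" by (rule forms_of_homogeneous[where d = 0]) (auto intro!: exI[of _ 1])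
  then show ?case by simp
next
  case (Suc m)
  then show ?case using forms_mult[of f p "\<lambda>s. f s ^ m" "m * p"] by simp
qed

lemma linear_in_forms: "(\<lambda>s. \<Sum>i\<in>UNIV. c i * s $ i) \<in> forms 1"
proof (rule forms_of_homogeneous[where d = 1])
  fix b :: "complex ^ 'a" and i
  let ?p = "\<Sum>j\<in>UNIV. smult (c j) (if j = i then [:0, 1:] else [:b $ j:])"
  have "degree ?p \<le> 1" by (intro degree_sum_le) (auto intro: order_trans[OF degree_smult_le])
  moreover have "(\<Sum>j\<in>UNIV. c j * upd b i z $ j) = poly ?p z" for z
    by (auto simp: poly_sum upd_def intro!: sum.cong)
  ultimately show "\<exists>p. degree p \<le> 1 \<and> (\<forall>z. (\<Sum>j\<in>UNIV. c j * upd b i z $ j) = poly p z)" by blast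
qed (simp add: sum_distrib_left mult_ac)

lemma nth_in_forms: "(\<lambda>s :: complex ^ 'k::finite. s $ i) \<in> forms 1"
  using linear_in_forms[of "\<lambda>j. if j = i then 1 else 0"] by (simp add: if_distrib[of "\<lambda>x. x * _"] cong: if_cong)

section \<open>Families of polynomial curves through a point\<close>

text \<open>Bilinear rather than Hermitian, so that \<open>dot l\<close> runs through the complex
  linear functionals.\<close>

definition dot :: "complex ^ 'j::finite \<Rightarrow> complex ^ 'j \<Rightarrow> complex" where
  "dot l z = (\<Sum>j\<in>UNIV. l $ j * z $ j)"

definition comb :: "complex ^ 'j::finite \<Rightarrow> ('j \<Rightarrow> complex poly) \<Rightarrow> complex poly" where
  "comb l P = (\<Sum>j\<in>UNIV. smult (l $ j) (P j))"

lemma poly_comb: "poly (comb l P) t = dot l (\<chi> j. poly (P j) t)"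
  by (simp add: comb_def dot_def poly_sum)

lemma dot_scale: "dot l (z *s v) = z * dot l v"
  by (simp add: dot_def sum_distrib_left mult_ac)

lemma dot_axis: "dot (axis j 1) v = v $ j"
  by (simp add: dot_def axis_def if_distrib[of "\<lambda>x. x * _"] cong: if_cong)

text \<open>The entry \<open>None\<close> is the homogenizing coordinate: \<open>homog 1 y\<close>
  represents the point with affine coordinates \<open>y\<close>.\<close>

definition homog :: "complex \<Rightarrow> complex ^ 'n::finite \<Rightarrow> complex ^ 'n option" where
  "homog b a = (\<chi> j. case j of None \<Rightarrow> b | Some j \<Rightarrow> a $ j)"

lemma sum_option: "(\<Sum>j\<in>(UNIV :: 'n::finite option set). f j) = f None + (\<Sum>j\<in>UNIV. f (Some j))"
  by (simp add: UNIV_option_conv sum.reindex)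

lemma prod_option: "(\<Prod>j\<in>(UNIV :: 'n::finite option set). f j) = f None * (\<Prod>j\<in>UNIV. f (Some j))"
  by (simp add: UNIV_option_conv prod.reindex)

lemma monomial_homog: "monomial \<alpha> (homog b a) = b ^ \<alpha> None * monomial (\<alpha> \<circ> Some) a"
  by (simp add: monomial_def prod_option homog_def)

lemma exponents_option: "\<alpha> \<in> exponents q \<longleftrightarrow> \<alpha> None + (\<Sum>j\<in>UNIV. \<alpha> (Some j)) = q"
  by (simp add: exponents_def sum_option)

lemma cdiff_imp_big_oh: "cdiff f 0 \<Longrightarrow> big_oh UNIV 0 f"
proof -
  assume "cdiff f 0"
  then have "(f \<longlongrightarrow> f 0) (at 0)" using cdiff_imp_isCont isCont_def by blast
  then have "\<forall>\<^sub>F u in at 0. dist (f u) (f 0) < 1" by (rule tendstoD) simp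
  then have "\<forall>\<^sub>F u in at 0. cmod (f u) \<le> (cmod (f 0) + 1) * norm u ^ 0"
  proof eventually_elim
    case (elim u)
    then show ?case using norm_triangle_sub[of "f u" "f 0"] by (simp add: dist_norm)
  qed
  then show "big_oh UNIV 0 f" by (rule big_ohI)
qed

text \<open>
  \<open>P\<close> is a polynomial vector of homogeneous coordinates, normalized at \<open>t = 0\<close> in the chart \<open>i\<close>; \<open>c\<close>
  is the same curve near \<open>t = 0\<close> in the parameter domain of \<open>F\<close>.  The curve meets the point \<open>F u\<close> at
  \<open>t = 1\<close>, possibly after having left the germ.  The last condition makes it immersed at \<open>t = 0\<close>.
\<close>

definition polynomial_curve ::
  "(complex ^ 'n::finite \<Rightarrow> complex ^ 'j::finite) \<Rightarrow> 'j \<Rightarrow> nat \<Rightarrow> complex ^ 'n \<Rightarrow>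
   ('j \<Rightarrow> complex poly) \<Rightarrow> (complex \<Rightarrow> complex ^ 'n) \<Rightarrow> complex \<Rightarrow> bool" where
  "polynomial_curve F i q u P c \<kappa> \<longleftrightarrow>
     (\<forall>j. degree (P j) \<le> q) \<and> poly (P i) 0 = 1 \<and> \<kappa> \<noteq> 0 \<and>
     (\<forall>j. poly (P j) 1 = \<kappa> * F u $ j) \<and>
     (\<forall>\<^sub>F t in at 0. \<forall>j. poly (P j) t = poly (P i) t * F (c t) $ j) \<and>
     (\<exists>K. \<forall>\<^sub>F t in at 0. norm (c t) \<le> K * norm t) \<and>
     (\<forall>\<^sub>F t in at 0. c t \<noteq> 0) \<and>
     (\<exists>l. \<forall>t. poly (comb l P) t = t)"

text \<open>The interface to the geometry: \<open>F\<close> stands for affine coordinates of the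
  germ in a parameter centred at 0, \<open>G\<close> for the parameters of generic points, and
  \<open>jets\<close> for regularity, read as surjectivity of the map from functionals to jets of
  order \<open>q\<close>.\<close>

locale curve_family =
  fixes F :: "complex ^ 'n::finite \<Rightarrow> complex ^ 'j::finite"
    and G :: "(complex ^ 'n) set" and q :: nat and i :: 'j
  assumes q: "q \<ge> 1"
    and F_cdiff: "\<forall>\<^sub>F u in nhds 0. \<forall>j. cdiff (\<lambda>u. F u $ j) u"
    and dense: "\<forall>\<^sub>F u in at 0. u \<in> closure G"
    and jets: "\<And>\<phi>. (\<And>k. \<phi> k \<in> forms k) \<Longrightarrow>
      \<exists>l. big_oh UNIV (Suc q) (\<lambda>u. dot l (F u) - (\<Sum>k\<le>q. \<phi> k u))"
    and curves: "\<forall>\<^sub>F u in at 0. u \<in> G \<longrightarrow> (\<exists>P c \<kappa>. polynomial_curve F i q u P c \<kappa>)"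
begin

lemma eventually_at_0_of_nhds: "\<forall>\<^sub>F u in nhds 0. Q u \<Longrightarrow> \<forall>\<^sub>F u in at 0 within S. Q u"
  by (simp add: eventually_at_filter eventually_mono)

lemma dot_F_cdiff: "\<forall>\<^sub>F u in nhds 0. cdiff (\<lambda>u. dot l (F u)) u"
  using F_cdiff by eventually_elim (simp add: dot_def cdiff_intros)

lemma dot_F_big_oh: "big_oh UNIV 0 (\<lambda>u. dot l (F u))"
  using dot_F_cdiff[of l] by (intro cdiff_imp_big_oh) (rule eventually_nhds_x_imp_x)

text \<open>Regularity realizes the jet of \<open>\<psi>\<close> even when \<open>\<psi>\<close> is
  controlled on a punctured neighbourhood only; its forms come from the expansion at the
  puncture.\<close>

lemma ex_functional:
  assumes "\<forall>\<^sub>F u in at 0. cdiff \<psi> u" "big_oh UNIV 0 \<psi>"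
  shows "\<exists>l. big_oh UNIV (Suc q) (\<lambda>u. dot l (F u) - \<psi> u)"
proof -
  obtain \<phi> where \<phi>: "\<And>j. \<phi> j \<in> forms j" "\<And>K. big_oh UNIV K (\<lambda>u. \<psi> u - (\<Sum>j<K. \<phi> j u))"
    using taylor_at_puncture[OF assms] by blast
  obtain l where "big_oh UNIV (Suc q) (\<lambda>u. dot l (F u) - (\<Sum>k\<le>q. \<phi> k u))"
    using jets[OF \<phi>(1)] by blast
  moreover have "big_oh UNIV (Suc q) (\<lambda>u. (\<Sum>k\<le>q. \<phi> k u) - \<psi> u)"
    using big_oh_diff_sym[OF \<phi>(2)[of "Suc q"]] by (simp add: lessThan_Suc_atMost)
  ultimately have "big_oh UNIV (Suc q) (\<lambda>u. dot l (F u) - \<psi> u)" by (rule big_oh_diff_trans)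
  then show ?thesis ..
qed

section \<open>Functionals with jets of pure degree and their roots on cones\<close>

definition lin :: "'n \<Rightarrow> 'n \<Rightarrow> complex ^ 'j" where
  "lin k j = (SOME l. big_oh UNIV (Suc q) (\<lambda>u. dot l (F u) - (u $ k) ^ (q - 1) * u $ j))"

text \<open>Serves to read off the velocity of a curve in the parameter domain.\<close>

definition coord :: "'n \<Rightarrow> complex ^ 'j" where
  "coord j = (SOME l. big_oh UNIV (Suc q) (\<lambda>u. dot l (F u) - u $ j))"

definition f :: "'n \<Rightarrow> 'n \<Rightarrow> complex ^ 'n \<Rightarrow> complex" where
  "f k j u = dot (lin k j) (F u)"

lemma power_nth_big_oh: "big_oh UNIV m (\<lambda>u. (u $ k) ^ m)"
  using big_oh_power[OF big_oh_nth[of UNIV k], of m] by simp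

lemma big_oh_f: "big_oh UNIV (Suc q) (\<lambda>u. f k j u - (u $ k) ^ (q - 1) * u $ j)"
  unfolding f_def lin_def
proof (rule someI_ex, rule ex_functional)
  show "big_oh UNIV 0 (\<lambda>u. (u $ k) ^ (q - 1) * u $ j)"
    by (rule big_oh_mono[OF big_oh_mult[OF power_nth_big_oh big_oh_nth]]) simp
qed (intro always_eventually allI cdiff_intros)

lemma big_oh_coord: "big_oh UNIV (Suc q) (\<lambda>u. dot (coord j) (F u) - u $ j)"
  unfolding coord_def
proof (rule someI_ex, rule ex_functional)
  show "big_oh UNIV 0 (\<lambda>u. u $ j)" by (rule big_oh_mono[OF big_oh_nth]) simp
qed (intro always_eventually allI cdiff_intros)

text \<open>
  On \<open>axis_cone k\<close> the vector \<open>g k u\<close> is the \<open>q\<close>-th root \<open>x\<close> of \<open>f\<close>, in the sense that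
  \<open>f k j u = x\<^sub>k\<^sup>q\<^sup>-\<^sup>1 x\<^sub>j\<close>, on the branch asymptotic to \<open>u\<close>.
\<close>

definition A :: "'n \<Rightarrow> complex ^ 'n \<Rightarrow> complex" where "A k u = f k k u / (u $ k) ^ q"
definition B :: "'n \<Rightarrow> 'n \<Rightarrow> complex ^ 'n \<Rightarrow> complex" where "B k j u = f k j u / (u $ k) ^ (q - 1)"
definition H :: "'n \<Rightarrow> complex ^ 'n \<Rightarrow> complex" where "H k u = exp (Ln (A k u) / of_nat q)"
definition g :: "'n \<Rightarrow> 'n \<Rightarrow> complex ^ 'n \<Rightarrow> complex" where "g k j u = H k u * B k j u / A k u"

text \<open>On a cone, division by \<open>(u $ k) ^ p\<close> lowers the order by exactly
  \<open>p\<close>, in the error as well as in the leading part.\<close>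

lemma leading_divide_nth:
  assumes "leading S (m + p) h (\<lambda>u. (u $ k) ^ p * h' u)" "big_oh S m h'" "S \<subseteq> axis_cone k"
  shows "leading S m (\<lambda>u. h u / (u $ k) ^ p) h'"
proof -
  have "big_oh S (Suc m + p) (\<lambda>u. h u - (u $ k) ^ p * h' u)" using assms(1) by (simp add: leading_def)
  then have "big_oh S (Suc m) (\<lambda>u. (h u - (u $ k) ^ p * h' u) / (u $ k) ^ p)"
    using assms(3) by (rule big_oh_cone_divide_nth)
  moreover have "\<forall>\<^sub>F u in at 0 within S. h u / (u $ k) ^ p - h' u = (h u - (u $ k) ^ p * h' u) / (u $ k) ^ p"
    using eventually_in_set
    by eventually_elim (use assms(3) axis_cone_nth_nonzero in \<open>force simp: field_simps\<close>)
  ultimately show ?thesis using assms(2) by (auto simp: leading_def intro: big_oh_cong)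
qed

lemma leading_f: "leading UNIV q (f k j) (\<lambda>u. (u $ k) ^ (q - 1) * u $ j)"
  using big_oh_f big_oh_mult[OF power_nth_big_oh[of "q - 1" k] big_oh_nth, of j] q by (simp add: leading_def)

lemma leading_A: "leading (axis_cone k) 0 (A k) (\<lambda>_. 1)"
  unfolding A_def
proof (rule leading_divide_nth)
  have "(u $ k) ^ q * 1 = (u $ k) ^ (q - 1) * u $ k" for u :: "complex ^ 'n"
    using q by (cases q) simp_all
  then show "leading (axis_cone k) (0 + q) (f k k) (\<lambda>u. (u $ k) ^ q * 1)"
    using leading_subset[OF leading_f] by simp
qed (auto intro: big_oh_const)

lemma leading_B: "leading (axis_cone k) 1 (B k j) (\<lambda>u. u $ j)"
  unfolding B_def
  by (rule leading_divide_nth) (use leading_subset[OF leading_f] q big_oh_nth in auto)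

lemma A_nonzero: "\<forall>\<^sub>F u in at 0 within axis_cone k. A k u \<noteq> 0"
  using leading_eventually_nonzero[OF leading_A] by simp

lemma leading_H: "leading (axis_cone k) 0 (H k) (\<lambda>_. 1)"
proof -
  have "((\<lambda>w. exp (Ln w / of_nat q)) has_field_derivative exp (Ln 1 / of_nat q) * (inverse 1 / of_nat q)) (at 1)"
    using q by (auto intro!: derivative_eq_intros)
  from leading_compose_deriv[OF leading_A this] show ?thesis by (simp add: H_def[abs_def])
qed

lemma leading_g: "leading (axis_cone k) 1 (g k j) (\<lambda>u. u $ j)"
  unfolding g_def
  using leading_divide[OF leading_mult[OF leading_H leading_B] leading_A] by simp

lemma f_cdiff: "\<forall>\<^sub>F u in nhds 0. cdiff (f k j) u"
  unfolding f_def by (rule dot_F_cdiff)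

lemma A_cdiff: "\<forall>\<^sub>F u in at 0 within axis_cone k. cdiff (A k) u"
  using eventually_at_0_of_nhds[OF f_cdiff[of k k]] eventually_in_set unfolding A_def
  by eventually_elim (intro cdiff_intros, auto dest: axis_cone_nth_nonzero)

lemma B_cdiff: "\<forall>\<^sub>F u in at 0 within axis_cone k. cdiff (B k j) u"
  using eventually_at_0_of_nhds[OF f_cdiff[of k j]] eventually_in_set unfolding B_def
  by eventually_elim (intro cdiff_intros, auto dest: axis_cone_nth_nonzero)

lemma H_cdiff: "\<forall>\<^sub>F u in at 0 within axis_cone k. cdiff (H k) u"
proof -
  have "((A k) \<longlongrightarrow> 1) (at 0 within axis_cone k)"
    using big_oh_tendsto_0[of "axis_cone k" 0 "\<lambda>u. A k u - 1"] leading_A[of k]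
    by (simp add: leading_def LIM_zero_iff)
  then have "\<forall>\<^sub>F u in at 0 within axis_cone k. A k u \<in> - \<real>\<^sub>\<le>\<^sub>0"
    by (rule topological_tendstoD) auto
  with A_cdiff show ?thesis
  proof eventually_elim
    case (elim u)
    then have "((\<lambda>w. exp (Ln w / of_nat q)) has_field_derivative
        exp (Ln (A k u) / of_nat q) * (inverse (A k u) / of_nat q)) (at (A k u))"
      using q by (auto intro!: derivative_eq_intros)
    from cdiff_compose[OF elim(1) this] show ?case by (simp add: H_def[abs_def])
  qed
qed

lemma g_cdiff: "\<forall>\<^sub>F u in at 0 within axis_cone k. cdiff (g k j) u"
  using H_cdiff B_cdiff[of k j] A_cdiff A_nonzero unfolding g_def
  by eventually_elim (intro cdiff_intros)

lemma H_power: "A k u \<noteq> 0 \<Longrightarrow> H k u ^ q = A k u"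
  using q by (simp add: H_def flip: exp_of_nat_mult)

text \<open>The last hypothesis makes the vector of all \<open>f k j u\<close> a multiple of
  \<open>a\<close>, so its quotients determine \<open>a\<close> up to scale. It is met in two ways:
  at the endpoint \<open>u\<close> with the constant of the curve, and at \<open>c t\<close> with
  \<open>poly (P i) t\<close> in place of \<open>\<kappa>\<close> and \<open>t *s a\<close> in place
  of \<open>a\<close>.\<close>

lemma B_div_A:
  assumes "\<kappa> \<noteq> 0" "u $ k \<noteq> 0" "A k u \<noteq> 0" "\<And>j. \<kappa> * f k j u = (a $ k) ^ (q - 1) * a $ j"
  shows "a $ k \<noteq> 0" "B k j u / A k u = u $ k * a $ j / a $ k" "\<kappa> * A k u * (u $ k) ^ q = (a $ k) ^ q"
proof -
  have fkk: "\<kappa> * f k k u = (a $ k) ^ q" using assms(4)[of k] q by (cases q) simp_all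
  then show *: "\<kappa> * A k u * (u $ k) ^ q = (a $ k) ^ q" using assms(2) by (simp add: A_def)
  have "f k k u \<noteq> 0" using assms(2,3) by (auto simp: A_def)
  then show ak: "a $ k \<noteq> 0" using fkk assms(1) q by (auto simp: power_0_left)
  have "B k j u / A k u = u $ k * f k j u / f k k u"
  proof -
    have "(u $ k) ^ q = u $ k * (u $ k) ^ (q - 1)" using q by (cases q) simp_all
    then show ?thesis using assms(2) by (simp add: A_def B_def)
  qed
  also have "\<dots> = u $ k * (\<kappa> * f k j u) / (\<kappa> * f k k u)" using assms(1) by simp
  also have "\<dots> = u $ k * a $ j / a $ k"   proof -
    have "(a $ k) ^ q = a $ k * (a $ k) ^ (q - 1)" using q by (cases q) simp_all
    then show ?thesis unfolding fkk assms(4) using ak by simp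
  qed
  finally show "B k j u / A k u = u $ k * a $ j / a $ k" .
qed

lemma g_eq:
  assumes "\<kappa> \<noteq> 0" "u $ k \<noteq> 0" "A k u \<noteq> 0" "\<And>j. \<kappa> * f k j u = (a $ k) ^ (q - 1) * a $ j"
  shows "g k j u = H k u * u $ k / a $ k * a $ j" "\<kappa> * (H k u * u $ k / a $ k) ^ q = 1"
proof -
  note * = B_div_A[OF assms]
  show "g k j u = H k u * u $ k / a $ k * a $ j"
    using *(2)[of j] unfolding g_def times_divide_eq_right[symmetric] by (simp add: mult_ac)
  show "\<kappa> * (H k u * u $ k / a $ k) ^ q = 1"
    using *(1,3) H_power[OF assms(3)] by (simp add: power_divide power_mult_distrib mult.assoc)
qed

section \<open>Polynomial identities along a single curve\<close>

context
  fixes u :: "complex ^ 'n" and P :: "'j \<Rightarrow> complex poly" and c :: "complex \<Rightarrow> complex ^ 'n" and \<kappa> :: complex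
  assumes curve: "polynomial_curve F i q u P c \<kappa>"
begin

lemma degree_comb: "degree (comb l P) \<le> q"
  unfolding comb_def using curve
  by (intro degree_sum_le) (auto simp: polynomial_curve_def intro: order_trans[OF degree_smult_le])

lemma comb_at_1: "poly (comb l P) 1 = \<kappa> * dot l (F u)"
  using curve by (simp add: polynomial_curve_def poly_comb dot_def sum_distrib_left mult_ac)

lemma comb_near_0: "\<forall>\<^sub>F t in at 0. poly (comb l P) t = poly (P i) t * dot l (F (c t))"
proof -
  have "\<forall>\<^sub>F t in at 0. \<forall>j. poly (P j) t = poly (P i) t * F (c t) $ j"
    using curve by (simp add: polynomial_curve_def)
  then show ?thesis
  proof eventually_elim
    case (elim t)
    have "poly (comb l P) t = (\<Sum>j\<in>UNIV. l $ j * (poly (P i) t * F (c t) $ j))"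
      unfolding poly_comb dot_def using elim by (intro sum.cong refl) (metis vec_lambda_beta)
    then show ?case by (simp add: dot_def sum_distrib_left mult_ac)
  qed
qed

lemma c_props:
  obtains K where "\<forall>\<^sub>F t in at 0. norm (c t) \<le> K * norm t" "\<forall>\<^sub>F t in at 0. c t \<noteq> 0"
  using curve by (auto simp: polynomial_curve_def)

lemma eventually_compose_c:
  assumes "\<forall>\<^sub>F v in at 0 within S. Q v" "\<forall>\<^sub>F t in at 0. c t \<in> S"
  shows "\<forall>\<^sub>F t in at 0. Q (c t)"
proof -
  obtain K where K: "\<forall>\<^sub>F t in at 0. norm (c t) \<le> K * norm t" "\<forall>\<^sub>F t in at 0. c t \<noteq> 0"
    by (rule c_props)
  have "((\<lambda>t::complex. K * norm t) \<longlongrightarrow> K * norm (0::complex)) (at 0)"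
    by (intro tendsto_intros)
  then have "(c \<longlongrightarrow> 0) (at 0)"
    using K(1) by (simp add: Lim_null_comparison)
  then have "filterlim c (at 0 within S) (at 0)"
    using K(2) assms(2) by (auto simp: filterlim_at eventually_conj_iff)
  from eventually_compose_filterlim[OF assms(1) this] show ?thesis .
qed

lemma big_oh_compose_c: "big_oh S m \<psi> \<Longrightarrow> \<forall>\<^sub>F t in at 0. c t \<in> S \<Longrightarrow> big_oh UNIV m (\<lambda>t. \<psi> (c t))"
  by (rule c_props) (rule big_oh_compose)

lemma leading_compose_c:
  "leading S m \<psi> \<psi>' \<Longrightarrow> \<forall>\<^sub>F t in at 0. c t \<in> S \<Longrightarrow> leading UNIV m (\<lambda>t. \<psi> (c t)) (\<lambda>t. \<psi>' (c t))"
  by (rule c_props) (rule leading_compose)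

lemma leading_Pi: "leading UNIV 0 (poly (P i)) (\<lambda>_. 1)"
  using leading_poly[of "P i"] curve by (simp add: polynomial_curve_def)

lemma Pi_nonzero: "\<forall>\<^sub>F t in at 0. poly (P i) t \<noteq> 0"
  by (rule leading_eventually_nonzero[OF leading_Pi]) simp

text \<open>Near \<open>t = 0\<close> the factor \<open>poly (P i)\<close> turns affine coordinates
  into the homogeneous ones of the curve, so an approximation on the germ becomes one on the curve
  after multiplication by it.\<close>

lemma comb_expand:
  assumes "big_oh UNIV m (\<lambda>u. dot l (F u) - \<psi> u)"
  shows "big_oh UNIV m (\<lambda>t. poly (comb l P) t - poly (P i) t * \<psi> (c t))"
proof -
  have "big_oh UNIV (0 + m) (\<lambda>t. poly (P i) t * (dot l (F (c t)) - \<psi> (c t)))"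
    by (intro big_oh_mult leading_imp_big_oh[OF leading_Pi] big_oh_compose_c[OF assms]) (simp_all only: UNIV_I eventually_True)
  moreover have "\<forall>\<^sub>F t in at 0. poly (comb l P) t - poly (P i) t * \<psi> (c t) =
      poly (P i) t * (dot l (F (c t)) - \<psi> (c t))"
    using comb_near_0[of l] by eventually_elim (simp add: algebra_simps)
  ultimately show ?thesis by (auto intro: big_oh_cong)
qed

text \<open>The velocity of \<open>c\<close> at 0. First coefficients of the functionals
  \<open>coord j\<close> give it, because these agree with \<open>u $ j\<close> beyond first order
  and \<open>poly (P i) 0 = 1\<close>.\<close>

definition a :: "complex ^ 'n" where
  "a = (\<chi> j. coeff (comb (coord j) P) 1)"

text \<open>About the size of \<open>c\<close> only a linear bound is assumed; its first order
  expansion is inherited from a polynomial.\<close>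

lemma leading_c: "leading UNIV 1 (\<lambda>t. c t $ j) (\<lambda>t. a $ j * t)"
proof -
  have c: "big_oh UNIV 1 (\<lambda>t. c t $ j)"
    by (rule big_oh_compose_c[OF big_oh_nth[of UNIV]]) simp
  have "big_oh UNIV 2 (\<lambda>t. poly (comb (coord j) P) t - poly (P i) t * c t $ j)"
    by (rule big_oh_mono[OF comb_expand[OF big_oh_coord]]) (use q in simp)
  moreover have "big_oh UNIV (Suc 0 + 1) (\<lambda>t. (poly (P i) t - 1) * c t $ j)"
    using leading_Pi by (intro big_oh_mult c) (simp add: leading_def)
  then have "big_oh UNIV 2 (\<lambda>t. poly (P i) t * c t $ j - c t $ j)"
    by (simp add: algebra_simps numeral_2_eq_2)
  ultimately have *: "big_oh UNIV 2 (\<lambda>t. poly (comb (coord j) P) t - c t $ j)"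
    by (rule big_oh_diff_trans)
  then have "big_oh UNIV 1 (\<lambda>t. poly (comb (coord j) P) t - c t $ j + c t $ j)"
    by (intro big_oh_add c) (rule big_oh_mono, auto)
  then have "coeff (comb (coord j) P) 0 = 0"
    by (intro big_oh_poly_imp_coeff_0[of 1]) simp_all
  then have "big_oh UNIV 2 (\<lambda>t. poly (comb (coord j) P) t - a $ j * t)"
    using big_oh_poly_diff_truncation[of "comb (coord j) P"] by (simp add: a_def)
  from big_oh_diff_trans[OF big_oh_diff_sym[OF *] this]
  have "big_oh UNIV (Suc 1) (\<lambda>t. c t $ j - a $ j * t)" by (simp add: numeral_2_eq_2)
  moreover have "big_oh UNIV 1 (\<lambda>t. a $ j * t)"
    by (rule big_ohI[where C = "cmod (a $ j)"]) (simp add: norm_mult)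
  ultimately show ?thesis by (simp add: leading_def)
qed

text \<open>On the curve this functional starts with the stated multiple of \<open>t ^ q\<close>,
  and a polynomial of degree at most \<open>q\<close> has no room for more. Evaluation at
  \<open>t = 1\<close> then yields \<open>kappa_f\<close>.\<close>

lemma comb_lin: "comb (lin k j) P = monom ((a $ k) ^ (q - 1) * a $ j) q"
proof (rule poly_eq_of_big_oh)
  have "big_oh UNIV (Suc q) (\<lambda>t. poly (comb (lin k j) P) t - poly (P i) t * ((c t $ k) ^ (q - 1) * c t $ j))"
    using comb_expand[OF big_oh_f[unfolded f_def]] .
  moreover have "leading UNIV (0 + ((q - 1) * 1 + 1)) (\<lambda>t. poly (P i) t * ((c t $ k) ^ (q - 1) * c t $ j))
      (\<lambda>t. 1 * ((a $ k * t) ^ (q - 1) * (a $ j * t)))"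
    by (intro leading_mult leading_power leading_Pi leading_c)
  then have "big_oh UNIV (Suc q) (\<lambda>t. poly (P i) t * ((c t $ k) ^ (q - 1) * c t $ j) - (a $ k * t) ^ (q - 1) * (a $ j * t))"
    using q by (simp add: leading_def)
  ultimately have "big_oh UNIV (Suc q) (\<lambda>t. poly (comb (lin k j) P) t - (a $ k * t) ^ (q - 1) * (a $ j * t))"
    by (rule big_oh_diff_trans)
  moreover have "(a $ k * t) ^ (q - 1) * (a $ j * t) = poly (monom ((a $ k) ^ (q - 1) * a $ j) q) t" for t
  proof -
    have "t ^ q = t * t ^ (q - 1)" using q by (cases q) auto
    then show ?thesis by (simp add: poly_monom power_mult_distrib mult_ac)
  qed
  ultimately show "big_oh UNIV (Suc q) (\<lambda>t. poly (comb (lin k j) P) t - poly (monom ((a $ k) ^ (q - 1) * a $ j) q) t)"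
    by simp
qed (auto intro: degree_comb degree_monom_le)

lemma kappa_f: "\<kappa> * f k j u = (a $ k) ^ (q - 1) * a $ j"
  using comb_at_1[of "lin k j"] by (simp add: f_def comb_lin poly_monom)

lemma Pi_f: "\<forall>\<^sub>F t in at 0. poly (P i) t * f k j (c t) = ((t *s a) $ k) ^ (q - 1) * (t *s a) $ j"
  using comb_near_0[of "lin k j"]
proof eventually_elim
  case (elim t)
  have "t ^ q = t * t ^ (q - 1)" using q by (cases q) simp_all
  with elim show ?case by (simp add: f_def comb_lin poly_monom power_mult_distrib mult_ac)
qed

text \<open>With zero velocity \<open>c\<close> is of order 2 in \<open>t\<close>, so every
  functional on the curve is a constant times \<open>poly (P i)\<close> up to order 2. For the
  functional equal to \<open>t\<close>, the constant coefficient forces that constant to be 0, and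
  the linear coefficient then gives a contradiction.\<close>

lemma a_nonzero: "a \<noteq> 0"
proof
  assume a0: "a = 0"
  obtain l where l: "\<And>t. poly (comb l P) t = t" using curve by (auto simp: polynomial_curve_def)
  obtain \<phi> where \<phi>: "\<And>j. \<phi> j \<in> forms j" "\<And>K. big_oh UNIV K (\<lambda>u. dot l (F u) - (\<Sum>j<K. \<phi> j u))"
    using taylor_at_puncture[OF eventually_at_0_of_nhds[OF dot_F_cdiff] dot_F_big_oh] by blast
  have \<phi>0: "\<phi> 0 v = \<phi> 0 0" for v
    using forms_scale[OF \<phi>(1)[of 0], of 0 v] by simp
  have "\<exists>C. \<forall>\<^sub>F t in at 0. norm (c t $ j) \<le> C * norm t ^ 2" for j
    using leading_c[of j] a0 by (simp add: leading_def big_oh_def numeral_2_eq_2)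
  then have "\<exists>C. \<forall>j. \<forall>\<^sub>F t in at 0. norm (c t $ j) \<le> C j * norm t ^ 2" by (intro choice allI)
  then obtain C where C: "\<And>j. \<forall>\<^sub>F t in at 0. norm (c t $ j) \<le> C j * norm t ^ 2" by blast
  have "\<forall>\<^sub>F t in at 0. \<forall>j. norm (c t $ j) \<le> C j * norm t ^ 2"
    by (rule finite_eventually_all[OF C])
  then have "\<forall>\<^sub>F t in at 0. norm (c t) \<le> (\<Sum>j\<in>UNIV. C j) * norm t ^ Suc 1"
  proof eventually_elim
    case (elim t)
    have "norm (c t) \<le> (\<Sum>j\<in>UNIV. norm (c t $ j))" by (rule norm_le_sum_nth)
    also have "\<dots> \<le> (\<Sum>j\<in>UNIV. C j * norm t ^ 2)" using elim by (intro sum_mono) auto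
    finally show ?case by (simp add: sum_distrib_right numeral_2_eq_2)
  qed
  moreover obtain K where "\<forall>\<^sub>F t in at 0. norm (c t) \<le> K * norm t" "\<forall>\<^sub>F t in at 0. c t \<noteq> 0"
    by (rule c_props)
  ultimately have "big_oh UNIV (Suc 1 * 1) (\<lambda>t. \<phi> 1 (c t))"
    by (intro big_oh_compose_power[OF big_oh_forms[OF \<phi>(1)[of 1], of UNIV]]) simp_all
  from big_oh_mult[OF leading_imp_big_oh[OF leading_Pi] this]
  have "big_oh UNIV 2 (\<lambda>t. poly (P i) t * \<phi> 1 (c t))" by (simp add: numeral_2_eq_2)
  moreover have "big_oh UNIV 2 (\<lambda>t. t - poly (P i) t * (\<phi> 0 0 + \<phi> 1 (c t)))"
  proof -
    have "(\<Sum>j<2. \<phi> j (c t)) = \<phi> 0 0 + \<phi> 1 (c t)" for t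
      using \<phi>0[of "c t"] by (simp add: numeral_2_eq_2)
    then show ?thesis using comb_expand[OF \<phi>(2)[of 2]] by (simp add: l)
  qed
  ultimately have "big_oh UNIV 2 (\<lambda>t. t - poly (P i) t * (\<phi> 0 0 + \<phi> 1 (c t)) + poly (P i) t * \<phi> 1 (c t))"
    by (intro big_oh_add)
  also have "(\<lambda>t. t - poly (P i) t * (\<phi> 0 0 + \<phi> 1 (c t)) + poly (P i) t * \<phi> 1 (c t)) =
      poly ([:0, 1:] - smult (\<phi> 0 0) (P i))"
    by (rule ext) (simp add: algebra_simps)
  finally have bo: "big_oh UNIV 2 (poly ([:0, 1:] - smult (\<phi> 0 0) (P i)))" .
  have "coeff (P i) 0 = 1" using curve by (simp add: polynomial_curve_def poly_0_coeff_0)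
  then have "\<phi> 0 0 = 0" using big_oh_poly_imp_coeff_0[OF bo, of 0] by simp
  then show False using big_oh_poly_imp_coeff_0[OF bo, of 1] by simp
qed

text \<open>The quotient of \<open>c t\<close> by \<open>t\<close> tends to the nonzero vector
  \<open>a\<close>, and a cone containing \<open>a\<close> is open and invariant under
  scaling.\<close>

lemma ex_axis_cone_curve: "\<exists>l. \<forall>\<^sub>F t in at 0. c t \<in> axis_cone l"
proof -
  obtain l where l: "a \<in> axis_cone l" using ex_axis_cone[OF a_nonzero] by blast
  have "((\<lambda>t. (inverse t *s c t) $ j) \<longlongrightarrow> a $ j) (at 0)" for j
  proof -
    have "big_oh UNIV (1 + 1) (\<lambda>t. t ^ 1 * (inverse t * c t $ j - a $ j))"
    proof (rule big_oh_cong)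
      show "big_oh UNIV (1 + 1) (\<lambda>t. c t $ j - a $ j * t)" using leading_c[of j] by (simp add: leading_def)
      show "\<forall>\<^sub>F t in at 0. t ^ 1 * (inverse t * c t $ j - a $ j) = c t $ j - a $ j * t"
        using eventually_nonzero_at_0 by eventually_elim (simp add: field_simps)
    qed
    from big_oh_divide_self[OF this] have "big_oh UNIV (Suc 0) (\<lambda>t. inverse t * c t $ j - a $ j)" by simp
    from big_oh_tendsto_0[OF this] show ?thesis by (simp add: LIM_zero_iff)
  qed
  then have "((\<lambda>t. inverse t *s c t) \<longlongrightarrow> a) (at 0)" by (rule vec_tendstoI)
  from topological_tendstoD[OF this open_axis_cone l]
  have "\<forall>\<^sub>F t in at 0. inverse t *s c t \<in> axis_cone l" .
  then have "\<forall>\<^sub>F t in at 0. c t \<in> axis_cone l"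
    using eventually_nonzero_at_0 by eventually_elim (simp add: axis_cone_scale)
  then show ?thesis ..
qed

end

text \<open>The two vectors differ by a \<open>q\<close>-th root of unity that tends to \<open>1\<close>.\<close>

lemma g_agree:
  "\<forall>\<^sub>F u in at 0 within axis_cone k \<inter> axis_cone l. u \<in> G \<longrightarrow> g k j u = g l j u"
proof -
  let ?S = "axis_cone k \<inter> axis_cone l"
  \<comment> \<open>Entry \<open>l\<close> of either vector is asymptotic to \<open>u $ l\<close> on
    the overlap, so the ratio of the two entries tends to 1.\<close>
  have quot: "leading ?S 0 (\<lambda>u. g m l u / (u $ l) ^ 1) (\<lambda>_. 1)" if "m = k \<or> m = l" for m
  proof (rule leading_divide_nth)
    have "?S \<subseteq> axis_cone m" using that by auto
    from leading_subset[OF leading_g this] show "leading ?S (0 + 1) (g m l) (\<lambda>u. (u $ l) ^ 1 * 1)" by simp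
  qed (auto intro: big_oh_const)
  have "leading ?S 0 (\<lambda>u. (g k l u / (u $ l) ^ 1) / (g l l u / (u $ l) ^ 1)) (\<lambda>_. 1)"
    by (rule leading_divide) (use quot in auto)
  then have lim: "((\<lambda>u. (g k l u / u $ l) / (g l l u / u $ l)) \<longlongrightarrow> 1) (at 0 within ?S)"
    using big_oh_tendsto_0[of ?S 0 "\<lambda>u. (g k l u / u $ l) / (g l l u / u $ l) - 1"]
    by (simp add: leading_def LIM_zero_iff)
  obtain e where "e > 0" and e: "\<And>z::complex. z ^ q = 1 \<Longrightarrow> cmod (z - 1) < e \<Longrightarrow> z = 1"
    using root_of_unity_isolated[OF q] by blast
  have "\<forall>\<^sub>F u in at 0 within ?S. dist ((g k l u / u $ l) / (g l l u / u $ l)) 1 < e"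
    using lim \<open>e > 0\<close> by (rule tendstoD)
  moreover have "\<forall>\<^sub>F u in at 0 within ?S. A k u \<noteq> 0"
    by (rule filter_leD[OF at_le A_nonzero]) auto
  moreover have "\<forall>\<^sub>F u in at 0 within ?S. A l u \<noteq> 0"
    by (rule filter_leD[OF at_le A_nonzero]) auto
  moreover have "\<forall>\<^sub>F u in at 0 within ?S. u \<in> G \<longrightarrow> (\<exists>P c \<kappa>. polynomial_curve F i q u P c \<kappa>)"
    by (rule filter_leD[OF at_le curves]) auto
  ultimately show ?thesis
    using eventually_in_set
  proof eventually_elim
    case (elim u)
    show ?case
    proof
      assume "u \<in> G"
      then obtain P c \<kappa> where curve: "polynomial_curve F i q u P c \<kappa>" using elim by blast
      have \<kappa>: "\<kappa> \<noteq> 0" using curve by (simp add: polynomial_curve_def)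
      define x where "x = a P"
      have nz: "u $ k \<noteq> 0" "u $ l \<noteq> 0" using elim(5) axis_cone_nth_nonzero by auto
      have kf: "\<kappa> * f m j u = (x $ m) ^ (q - 1) * x $ j" for m j
        using kappa_f[OF curve] by (simp add: x_def)
      note gk = g_eq[OF \<kappa> nz(1) elim(2) kf]
      note gl = g_eq[OF \<kappa> nz(2) elim(3) kf]
      \<comment> \<open>The factor in \<open>g m j u = \<nu> m * x $ j\<close>, for \<open>m\<close>
        one of the two cones. Its \<open>q\<close>-th power is the inverse of
        \<open>\<kappa>\<close> in both cases, so the two factors differ by a root of unity.\<close>
      define \<nu> where "\<nu> m = H m u * u $ m / x $ m" for m
      have xl: "x $ l \<noteq> 0" using B_div_A(1)[OF \<kappa> nz(2) elim(3) kf] .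
      have \<nu>: "\<nu> l ^ q \<noteq> 0" "\<nu> k ^ q = \<nu> l ^ q"
      proof -
        have *: "\<kappa> * \<nu> k ^ q = 1" "\<kappa> * \<nu> l ^ q = 1" using gk(2) gl(2) by (simp_all add: \<nu>_def)
        from *(2) show "\<nu> l ^ q \<noteq> 0" by fastforce
        from * have "\<kappa> * \<nu> k ^ q = \<kappa> * \<nu> l ^ q" by simp
        then show "\<nu> k ^ q = \<nu> l ^ q" using \<kappa> by simp
      qed
      have "\<nu> l \<noteq> 0"
      proof
        assume "\<nu> l = 0"
        then have "\<nu> l ^ q = 0" using q by simp
        with \<nu>(1) show False by simp
      qed
      have "(g k l u / u $ l) / (g l l u / u $ l) = \<nu> k / \<nu> l"
        unfolding gk(1) gl(1) \<nu>_def[symmetric] using nz xl by simp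
      moreover have "(\<nu> k / \<nu> l) ^ q = 1" using \<nu> by (simp add: power_divide)
      moreover have "cmod (\<nu> k / \<nu> l - 1) < e"
        using elim(1) unfolding calculation(1) by (simp add: dist_norm)
      ultimately have "\<nu> k / \<nu> l = 1" using e by blast
      then have "\<nu> k = \<nu> l" using \<open>\<nu> l \<noteq> 0\<close> by simp
      then show "g k j u = g l j u" unfolding gk(1) gl(1) \<nu>_def[symmetric] by simp
    qed
  qed
qed

end

lemma monomial_homog_prod: "monomial \<alpha> (homog b a) = b ^ \<alpha> None * (\<Prod>j\<in>UNIV. (a $ j) ^ \<alpha> (Some j))"
  unfolding monomial_homog by (simp add: monomial_def)

definition exponent0 :: "nat \<Rightarrow> 'n option \<Rightarrow> nat" where "exponent0 q = case_option q (\<lambda>_. 0)"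
definition exponent1 :: "nat \<Rightarrow> 'n \<Rightarrow> 'n option \<Rightarrow> nat" where
  "exponent1 q j = case_option (q - 1) (\<lambda>i. if i = j then 1 else 0)"

lemma exponent0_in_exponents: "exponent0 q \<in> (exponents q :: ('n::finite option \<Rightarrow> nat) set)"
  by (simp add: exponent0_def exponents_option)

lemma exponent1_in_exponents: "q \<ge> 1 \<Longrightarrow> exponent1 q j \<in> (exponents q :: ('n::finite option \<Rightarrow> nat) set)"
  by (simp add: exponent1_def exponents_option)

lemma monomial_exponent0: "monomial (exponent0 q) s = (s $ None) ^ q"
  by (simp add: monomial_def prod_option exponent0_def)

lemma monomial_exponent1: "monomial (exponent1 q j) s = (s $ None) ^ (q - 1) * s $ Some j"
  by (simp add: monomial_def prod_option exponent1_def if_distrib[of "\<lambda>m. _ ^ m"] cong: if_cong)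

section \<open>Functionals with the jets of powers of the root vector\<close>

context curve_family
begin

definition gpow :: "'n \<Rightarrow> complex ^ 'n \<Rightarrow> complex" where
  "gpow j = (SOME \<psi>. (\<forall>\<^sub>F u in at 0. cdiff \<psi> u) \<and>
     (\<forall>k. \<forall>\<^sub>F u in at 0 within axis_cone k. \<psi> u = g k j u ^ (q - 1)))"

lemma gpow:
  "\<forall>\<^sub>F u in at 0. cdiff (gpow j) u"
  "\<forall>\<^sub>F u in at 0 within axis_cone k. gpow j u = g k j u ^ (q - 1)"
proof -
  have "\<exists>\<psi>. (\<forall>\<^sub>F u in at 0. cdiff \<psi> u) \<and>
     (\<forall>k. \<forall>\<^sub>F u in at 0 within axis_cone k. \<psi> u = g k j u ^ (q - 1))"
  proof (rule patch_cones[OF dense, where \<phi> = "\<lambda>k u. g k j u ^ (q - 1)"])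
    show "\<forall>\<^sub>F u in at 0 within axis_cone k. cdiff (\<lambda>u. g k j u ^ (q - 1)) u" for k
      using g_cdiff[of k j] by eventually_elim (rule cdiff_power)
    show "\<forall>\<^sub>F u in at 0 within axis_cone k \<inter> axis_cone l. u \<in> G \<longrightarrow> g k j u ^ (q - 1) = g l j u ^ (q - 1)" for k l
      using g_agree[where k = k and l = l and j = j] by eventually_elim simp
  qed
  from someI_ex[OF this, folded gpow_def]
  show "\<forall>\<^sub>F u in at 0. cdiff (gpow j) u"
    "\<forall>\<^sub>F u in at 0 within axis_cone k. gpow j u = g k j u ^ (q - 1)" by blast+
qed

lemma leading_gpow: "leading UNIV (q - 1) (gpow j) (\<lambda>u. (u $ j) ^ (q - 1))"
  by (rule leading_cones, rule leading_cong[OF _ gpow(2)])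
     (use leading_power[OF leading_g, where m = "q - 1"] in simp)

definition lin' :: "'n \<Rightarrow> complex ^ 'j" where
  "lin' j = (SOME l. big_oh UNIV (Suc q) (\<lambda>u. dot l (F u) - gpow j u))"

definition f' :: "'n \<Rightarrow> complex ^ 'n \<Rightarrow> complex" where
  "f' j u = dot (lin' j) (F u)"

lemma big_oh_f': "big_oh UNIV (Suc q) (\<lambda>u. f' j u - gpow j u)"
  unfolding f'_def lin'_def
proof (rule someI_ex, rule ex_functional)
  show "big_oh UNIV 0 (gpow j)" by (rule big_oh_mono[OF leading_imp_big_oh[OF leading_gpow]]) simp
qed (rule gpow(1))

lemma leading_f': "leading UNIV (q - 1) (f' j) (\<lambda>u. (u $ j) ^ (q - 1))"
proof -
  have "big_oh UNIV (Suc (q - 1)) (\<lambda>u. f' j u - gpow j u)"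
    by (rule big_oh_mono[OF big_oh_f']) simp
  from big_oh_diff_trans[OF this] show ?thesis using leading_gpow[of j] by (simp add: leading_def)
qed

definition D :: "'n \<Rightarrow> complex ^ 'n \<Rightarrow> complex" where "D k u = f' k u / (u $ k) ^ (q - 1)"

lemma leading_D: "leading (axis_cone k) 0 (D k) (\<lambda>_. 1)"
  unfolding D_def
  by (rule leading_divide_nth) (use leading_subset[OF leading_f'] big_oh_const in auto)

lemma D_cdiff: "\<forall>\<^sub>F u in at 0 within axis_cone k. cdiff (D k) u"
  using eventually_at_0_of_nhds[OF dot_F_cdiff[of "lin' k"]] eventually_in_set unfolding D_def f'_def
  by eventually_elim (intro cdiff_intros, auto dest: axis_cone_nth_nonzero)

text \<open>Along the curve \<open>g l j (c t) = N t * a P $ j\<close> with \<open>N\<close>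
  independent of \<open>j\<close>. Hence all these functionals are
  \<open>(a P $ k) ^ (q - 1)\<close> times one function \<open>E\<close> up to order
  \<open>q + 1\<close>, and so times one polynomial \<open>e\<close> of degree at most
  \<open>q\<close>. As \<open>E\<close> starts with \<open>t ^ (q - 1)\<close>, only the coefficient
  of \<open>t ^ q\<close> in \<open>e\<close> is free.\<close>

lemma comb_lin':
  assumes curve: "polynomial_curve F i q u P c \<kappa>"
  shows "\<exists>b. \<forall>k. comb (lin' k) P = smult ((a P $ k) ^ (q - 1)) (monom 1 (q - 1) + monom b q)"
proof -
  let ?a = "a P"
  obtain l where l: "\<forall>\<^sub>F t in at 0. c t \<in> axis_cone l" using ex_axis_cone_curve[OF curve] by blast
  define N where "N t = H l (c t) * (c t $ l * (1 / ?a $ l))" for t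
  have "\<forall>\<^sub>F t in at 0. \<forall>j. poly (P i) t * f l j (c t) = ((t *s ?a) $ l) ^ (q - 1) * (t *s ?a) $ j"
    by (rule finite_eventually_all) (rule Pi_f[OF curve])
  moreover note l eventually_compose_c[OF curve A_nonzero l] Pi_nonzero[OF curve]
    eventually_nonzero_at_0[where 'a = complex and S = UNIV]
  ultimately have ev: "\<forall>\<^sub>F t in at 0. ?a $ l \<noteq> 0 \<and> (\<forall>j. g l j (c t) = N t * ?a $ j)"
  proof eventually_elim
    case (elim t)
    have nz: "c t $ l \<noteq> 0" using elim(2) by (rule axis_cone_nth_nonzero)
    note * = B_div_A(1)[OF elim(4) nz elim(3) spec[OF elim(1)]] g_eq(1)[OF elim(4) nz elim(3) spec[OF elim(1)]]
    have "?a $ l \<noteq> 0" using *(1) by simp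
    moreover have "g l j (c t) = N t * ?a $ j" for j
      using *(2)[of j] elim(5) \<open>?a $ l \<noteq> 0\<close> by (simp add: N_def)
    ultimately show ?case by blast
  qed
  then have al: "?a $ l \<noteq> 0"
    using eventually_happens'[OF at_neq_bot] by blast
  have "leading UNIV (0 + (1 + 0)) N (\<lambda>t. 1 * (?a $ l * t * (1 / ?a $ l)))"
    unfolding N_def
    by (intro leading_mult leading_compose_c[OF curve leading_H l] leading_c[OF curve] leading_const)
  then have N: "leading UNIV 1 N (\<lambda>t. t)" using al by simp
  define E where "E t = poly (P i) t * N t ^ (q - 1)" for t
  have "leading UNIV (0 + (q - 1) * 1) E (\<lambda>t. 1 * t ^ (q - 1))"
    unfolding E_def by (intro leading_mult leading_power N leading_Pi[OF curve])
  then have E: "big_oh UNIV q (\<lambda>t. E t - t ^ (q - 1))" using q by (simp add: leading_def)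
  have X: "big_oh UNIV (Suc q) (\<lambda>t. poly (comb (lin' k) P) t - (?a $ k) ^ (q - 1) * E t)" for k
  proof (rule big_oh_cong)
    show "big_oh UNIV (Suc q) (\<lambda>t. poly (comb (lin' k) P) t - poly (P i) t * gpow k (c t))"
      by (rule comb_expand[OF curve]) (rule big_oh_f'[unfolded f'_def])
    show "\<forall>\<^sub>F t in at 0. poly (comb (lin' k) P) t - (?a $ k) ^ (q - 1) * E t =
        poly (comb (lin' k) P) t - poly (P i) t * gpow k (c t)"
      using eventually_compose_c[OF curve gpow(2)[where j = k and k = l] l] ev
      by eventually_elim (simp add: E_def power_mult_distrib mult_ac)
  qed
  \<comment> \<open>Any index with a nonzero entry of the velocity determines \<open>e\<close>; the
    index of the cone that contains the curve is one.\<close>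
  define e where "e = smult (inverse ((?a $ l) ^ (q - 1))) (comb (lin' l) P)"
  have dege: "degree e \<le> q"
    unfolding e_def by (rule order_trans[OF degree_smult_le degree_comb[OF curve]])
  have eE: "big_oh UNIV (Suc q) (\<lambda>t. poly e t - E t)"
    using big_oh_cmult[OF X[of l], of "inverse ((?a $ l) ^ (q - 1))"] al
    by (simp add: e_def right_diff_distrib mult.assoc[symmetric])
  have comb: "comb (lin' k) P = smult ((?a $ k) ^ (q - 1)) e" for k
  proof (rule poly_eq_of_big_oh)
    have "big_oh UNIV (Suc q) (\<lambda>t. (?a $ k) ^ (q - 1) * E t - (?a $ k) ^ (q - 1) * poly e t)"
      using big_oh_cmult[OF big_oh_diff_sym[OF eE], of "(?a $ k) ^ (q - 1)"] by (simp add: right_diff_distrib)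
    from big_oh_diff_trans[OF X[of k] this]
    show "big_oh UNIV (Suc q) (\<lambda>t. poly (comb (lin' k) P) t - poly (smult ((?a $ k) ^ (q - 1)) e) t)" by simp
  qed (use degree_comb[OF curve] dege in \<open>auto intro: order_trans[OF degree_smult_le]\<close>)
  have "big_oh UNIV q (\<lambda>t. poly e t - t ^ (q - 1))"
    by (rule big_oh_diff_trans[OF big_oh_mono[OF eE] E]) simp
  also have "(\<lambda>t. poly e t - t ^ (q - 1)) = poly (e - monom 1 (q - 1))"
    by (rule ext) (simp add: poly_monom)
  finally have "coeff (e - monom 1 (q - 1)) n = 0" if "n < q" for n
    using that by (rule big_oh_poly_imp_coeff_0)
  then have "coeff e n = coeff (monom 1 (q - 1) + monom (coeff e q) q) n" for n
    using q dege coeff_eq_0[of e n] by (cases n q rule: linorder_cases) auto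
  then have "e = monom 1 (q - 1) + monom (coeff e q) q" by (rule poly_eqI)
  with comb show ?thesis by metis
qed

text \<open>
  \<open>h k \<alpha>\<close> is the value of the monomial \<open>\<alpha>\<close> at the vector with the entries \<open>f' k\<close> and \<open>f k j\<close>, divided
  by \<open>f k k ^ (q - 1)\<close>; the powers of \<open>u $ k\<close> in \<open>D\<close>, \<open>B\<close> and \<open>A\<close> cancel.
\<close>

definition h :: "'n \<Rightarrow> ('n option \<Rightarrow> nat) \<Rightarrow> complex ^ 'n \<Rightarrow> complex" where
  "h k \<alpha> u = D k u ^ \<alpha> None * (\<Prod>j\<in>UNIV. B k j u ^ \<alpha> (Some j)) / A k u ^ (q - 1)"

text \<open>Up to a common factor \<open>m\<close>, the values of \<open>D k\<close> and
  \<open>B k j\<close> are the entries of \<open>homog b a\<close>, so a monomial of degree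
  \<open>q\<close> acquires \<open>m ^ q\<close>. Division by \<open>A k u ^ (q - 1)\<close> leaves
  exactly the factor \<open>1 / \<kappa>\<close>.\<close>

lemma h_eq:
  fixes a :: "complex ^ 'n"
  assumes "\<kappa> \<noteq> 0" "u $ k \<noteq> 0" "A k u \<noteq> 0" "\<And>j. \<kappa> * f k j u = (a $ k) ^ (q - 1) * a $ j"
    and "\<kappa> * f' k u = (a $ k) ^ (q - 1) * b" and "\<alpha> \<in> exponents q"
  shows "\<kappa> * h k \<alpha> u = monomial \<alpha> (homog b a)"
proof -
  note * = B_div_A[OF assms(1-4)]
  define m where "m = (a $ k) ^ (q - 1) / (\<kappa> * (u $ k) ^ (q - 1))"
  have D: "D k u = m * b"
    using assms(1,2,5) by (simp add: D_def m_def field_simps)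
  have B: "B k j u = m * a $ j" for j
    using assms(1,2) assms(4)[of j] by (simp add: B_def m_def field_simps)
  have AB: "A k u * u $ k = B k k u"
  proof -
    have "(u $ k) ^ q = u $ k * (u $ k) ^ (q - 1)" using q by (cases q) simp_all
    then show ?thesis using assms(2) by (simp add: A_def B_def)
  qed
  have "m \<noteq> 0" using *(1) assms(1,2) by (simp add: m_def)
  have A: "A k u = m * (a $ k / u $ k)"
    using AB assms(2) by (simp add: B field_simps)
  have "D k u ^ \<alpha> None * (\<Prod>j\<in>UNIV. B k j u ^ \<alpha> (Some j)) = m ^ (\<alpha> None + (\<Sum>j\<in>UNIV. \<alpha> (Some j))) * monomial \<alpha> (homog b a)"
    unfolding monomial_homog_prod D B power_mult_distrib prod.distrib power_add power_sum by simp
  also have "\<alpha> None + (\<Sum>j\<in>UNIV. \<alpha> (Some j)) = q" using assms(6) by (simp add: exponents_option)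
  also have "m ^ q = m * m ^ (q - 1)" using q by (cases q) simp_all
  finally have "h k \<alpha> u = m * (u $ k / a $ k) ^ (q - 1) * monomial \<alpha> (homog b a)"
    using \<open>m \<noteq> 0\<close> *(1) assms(2) by (simp add: h_def A power_mult_distrib power_divide field_simps)
  moreover have "m * (u $ k / a $ k) ^ (q - 1) = 1 / \<kappa>"
    using *(1) assms(1,2) by (simp add: m_def power_divide)
  ultimately show ?thesis using assms(1) by simp
qed

lemma leading_h: "leading (axis_cone k) (\<Sum>j\<in>UNIV. \<alpha> (Some j)) (h k \<alpha>) (monomial (\<alpha> \<circ> Some))"
proof -
  have "leading (axis_cone k) (\<alpha> None * 0 + (\<Sum>j\<in>UNIV. \<alpha> (Some j) * 1))
      (\<lambda>u. D k u ^ \<alpha> None * (\<Prod>j\<in>UNIV. B k j u ^ \<alpha> (Some j)))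
      (\<lambda>u. 1 ^ \<alpha> None * (\<Prod>j\<in>UNIV. (u $ j) ^ \<alpha> (Some j)))"
    by (intro leading_mult leading_prod leading_power leading_D leading_B) simp_all
  moreover have "leading (axis_cone k) ((q - 1) * 0) (\<lambda>u. A k u ^ (q - 1)) (\<lambda>u. 1 ^ (q - 1))"
    by (intro leading_power leading_A)
  ultimately show ?thesis
    unfolding h_def by (intro leading_divide) (simp_all add: monomial_def[abs_def])
qed

lemma curve_values:
  assumes curve: "polynomial_curve F i q u P c \<kappa>"
  shows "\<exists>b. (\<forall>k. \<kappa> * f' k u = (a P $ k) ^ (q - 1) * (1 + b)) \<and>
    (\<forall>k. \<forall>\<^sub>F t in at 0. poly (P i) t * f' k (c t) = ((t *s a P) $ k) ^ (q - 1) * (1 + b * t))"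
proof -
  obtain b where b: "\<And>k. comb (lin' k) P = smult ((a P $ k) ^ (q - 1)) (monom 1 (q - 1) + monom b q)"
    using comb_lin'[OF curve] by blast
  have tq: "t ^ q = t * t ^ (q - 1)" for t :: complex using q by (cases q) simp_all
  have "\<kappa> * f' k u = (a P $ k) ^ (q - 1) * (1 + b)" for k
    using comb_at_1[OF curve, of "lin' k"] by (simp add: f'_def b poly_monom)
  moreover have "\<forall>\<^sub>F t in at 0. poly (P i) t * f' k (c t) = ((t *s a P) $ k) ^ (q - 1) * (1 + b * t)" for k
    using comb_near_0[OF curve, of "lin' k"]
    by eventually_elim (simp add: f'_def b poly_monom tq power_mult_distrib algebra_simps)
  ultimately show ?thesis by blast
qed

lemma h_cdiff: "\<forall>\<^sub>F u in at 0 within axis_cone k. cdiff (h k \<alpha>) u"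
proof -
  have "\<forall>\<^sub>F u in at 0 within axis_cone k. \<forall>j. cdiff (B k j) u"
    by (rule finite_eventually_all) (rule B_cdiff)
  with D_cdiff A_cdiff A_nonzero show ?thesis
    unfolding h_def by eventually_elim (intro cdiff_intros, auto)
qed

text \<open>At a point of \<open>G\<close> the value is expressed through \<open>\<kappa>\<close>,
  \<open>a P\<close> and \<open>b\<close>, and \<open>b\<close> is the same for all cones by
  \<open>comb_lin'\<close>. No root of unity has to be excluded here.\<close>

lemma h_agree:
  assumes "\<alpha> \<in> exponents q"
  shows "\<forall>\<^sub>F u in at 0 within axis_cone k \<inter> axis_cone l. u \<in> G \<longrightarrow> h k \<alpha> u = h l \<alpha> u"
proof -
  let ?S = "axis_cone k \<inter> axis_cone l"
  have "\<forall>\<^sub>F u in at 0 within ?S. A k u \<noteq> 0"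
    by (rule filter_leD[OF at_le A_nonzero]) auto
  moreover have "\<forall>\<^sub>F u in at 0 within ?S. A l u \<noteq> 0"
    by (rule filter_leD[OF at_le A_nonzero]) auto
  moreover have "\<forall>\<^sub>F u in at 0 within ?S. u \<in> G \<longrightarrow> (\<exists>P c \<kappa>. polynomial_curve F i q u P c \<kappa>)"
    by (rule filter_leD[OF at_le curves]) auto
  ultimately show ?thesis
    using eventually_in_set
  proof eventually_elim
    case (elim u)
    show ?case
    proof
      assume "u \<in> G"
      then obtain P c \<kappa> where curve: "polynomial_curve F i q u P c \<kappa>" using elim by blast
      have \<kappa>: "\<kappa> \<noteq> 0" using curve by (simp add: polynomial_curve_def)
      obtain b where b: "\<And>k. \<kappa> * f' k u = (a P $ k) ^ (q - 1) * (1 + b)"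
        using curve_values[OF curve] by blast
      have "\<kappa> * h m \<alpha> u = monomial \<alpha> (homog (1 + b) (a P))" if "u \<in> axis_cone m" "A m u \<noteq> 0" for m
        by (rule h_eq[OF \<kappa> axis_cone_nth_nonzero[OF that(1)] that(2) kappa_f[OF curve] b assms])
      then have "\<kappa> * h k \<alpha> u = \<kappa> * h l \<alpha> u" using elim by simp
      then show "h k \<alpha> u = h l \<alpha> u" using \<kappa> by simp
    qed
  qed
qed

section \<open>Glued Veronese coordinates and expansion of jets in them\<close>

definition hh :: "('n option \<Rightarrow> nat) \<Rightarrow> complex ^ 'n \<Rightarrow> complex" where
  "hh \<alpha> = (SOME \<psi>. (\<forall>\<^sub>F u in at 0. cdiff \<psi> u) \<and>
     (\<forall>k. \<forall>\<^sub>F u in at 0 within axis_cone k. \<psi> u = h k \<alpha> u))"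

lemma hh:
  assumes "\<alpha> \<in> exponents q"
  shows "\<forall>\<^sub>F u in at 0. cdiff (hh \<alpha>) u" "\<forall>\<^sub>F u in at 0 within axis_cone k. hh \<alpha> u = h k \<alpha> u"
proof -
  have "\<exists>\<psi>. (\<forall>\<^sub>F u in at 0. cdiff \<psi> u) \<and> (\<forall>k. \<forall>\<^sub>F u in at 0 within axis_cone k. \<psi> u = h k \<alpha> u)"
    by (rule patch_cones[OF dense h_cdiff h_agree[OF assms]])
  from someI_ex[OF this, folded hh_def]
  show "\<forall>\<^sub>F u in at 0. cdiff (hh \<alpha>) u" "\<forall>\<^sub>F u in at 0 within axis_cone k. hh \<alpha> u = h k \<alpha> u" by blast+
qed

lemma leading_hh:
  assumes "\<alpha> \<in> exponents q"
  shows "leading UNIV (\<Sum>j\<in>UNIV. \<alpha> (Some j)) (hh \<alpha>) (monomial (\<alpha> \<circ> Some))"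
  by (rule leading_cones, rule leading_cong[OF leading_h hh(2)[OF assms]])

definition approx :: "(complex ^ 'n \<Rightarrow> complex) \<Rightarrow> bool" where
  "approx \<psi> \<longleftrightarrow> (\<exists>x. big_oh UNIV (Suc q) (\<lambda>u. \<psi> u - (\<Sum>\<alpha>\<in>exponents q. x \<alpha> * hh \<alpha> u)))"

lemma approx_minus_hh:
  assumes "approx (\<lambda>u. \<psi> u - e * hh \<alpha> u)" "\<alpha> \<in> exponents q"
  shows "approx \<psi>"
proof -
  obtain x where x: "big_oh UNIV (Suc q) (\<lambda>u. \<psi> u - e * hh \<alpha> u - (\<Sum>\<alpha>\<in>exponents q. x \<alpha> * hh \<alpha> u))"
    using assms(1) by (auto simp: approx_def)
  have sum: "(\<Sum>\<beta>\<in>exponents q. (x \<beta> + (if \<beta> = \<alpha> then e else 0)) * hh \<beta> u) =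
      (\<Sum>\<beta>\<in>exponents q. x \<beta> * hh \<beta> u) + e * hh \<alpha> u" for u
  proof -
    have "(\<Sum>\<beta>\<in>exponents q. (x \<beta> + (if \<beta> = \<alpha> then e else 0)) * hh \<beta> u) =
        (\<Sum>\<beta>\<in>exponents q. x \<beta> * hh \<beta> u) + (\<Sum>\<beta>\<in>exponents q. if \<beta> = \<alpha> then e * hh \<beta> u else 0)"
      unfolding sum.distrib[symmetric] by (intro sum.cong) (auto simp: algebra_simps)
    then show ?thesis using assms(2) by (simp add: finite_exponents)
  qed
  have eq: "\<psi> u - (\<Sum>\<beta>\<in>exponents q. (x \<beta> + (if \<beta> = \<alpha> then e else 0)) * hh \<beta> u) =
      \<psi> u - e * hh \<alpha> u - (\<Sum>\<alpha>\<in>exponents q. x \<alpha> * hh \<alpha> u)" for u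
    unfolding sum by simp
  have "big_oh UNIV (Suc q) (\<lambda>u. \<psi> u - (\<Sum>\<beta>\<in>exponents q. (x \<beta> + (if \<beta> = \<alpha> then e else 0)) * hh \<beta> u))"
    unfolding eq by (rule x)
  then show ?thesis unfolding approx_def
    by (rule exI[where x = "\<lambda>\<beta>. x \<beta> + (if \<beta> = \<alpha> then e else 0)"])
qed

lemma approx_minus_sum_hh:
  assumes "finite I" "\<And>\<gamma>. \<gamma> \<in> I \<Longrightarrow> E \<gamma> \<in> exponents q" "approx (\<lambda>u. \<psi> u - (\<Sum>\<gamma>\<in>I. e \<gamma> * hh (E \<gamma>) u))"
  shows "approx \<psi>"
  using assms
proof (induction I arbitrary: \<psi> rule: finite_induct)
  case empty
  then show ?case by simp
next
  case (insert \<gamma> I)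
  have "approx (\<lambda>u. (\<psi> u - e \<gamma> * hh (E \<gamma>) u) - (\<Sum>\<gamma>\<in>I. e \<gamma> * hh (E \<gamma>) u))"
    using insert.prems(2) insert.hyps by (simp add: diff_diff_eq)
  then have "approx (\<lambda>u. \<psi> u - e \<gamma> * hh (E \<gamma>) u)"
    using insert.prems(1) by (intro insert.IH[of "\<lambda>u. \<psi> u - e \<gamma> * hh (E \<gamma>) u"]) auto
  then show ?case by (rule approx_minus_hh) (use insert.prems in auto)
qed

lemma forms_sum_big_oh_imp_0:
  fixes \<phi> :: "nat \<Rightarrow> complex ^ 'n \<Rightarrow> complex"
  assumes "\<And>j. \<phi> j \<in> forms j" "big_oh UNIV k (\<lambda>u. \<Sum>j<Suc k. \<phi> j u)" "j < k" "u \<noteq> 0"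
  shows "\<phi> j u = 0"
proof -
  have "big_oh UNIV k (\<lambda>t. \<Sum>j<Suc k. \<phi> j (t *s u))"
  proof (rule big_oh_compose[OF assms(2), where K = "norm u"])
    show "\<forall>\<^sub>F t in at 0. t *s u \<noteq> 0" using eventually_nonzero_at_0[where 'a = complex] assms(4) by simp
  qed (simp_all add: norm_vec_scale mult.commute)
  also have "(\<lambda>t. \<Sum>j<Suc k. \<phi> j (t *s u)) = poly (\<Sum>j<Suc k. monom (\<phi> j u) j)"
    unfolding poly_sum poly_monom forms_scale[OF assms(1)] by (simp add: mult.commute)
  finally have "coeff (\<Sum>j<Suc k. monom (\<phi> j u) j) j = 0"
    using assms(3) by (rule big_oh_poly_imp_coeff_0)
  then show ?thesis using assms(3) by (simp add: coeff_sum)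
qed

text \<open>Downward induction on the order of vanishing \<open>k\<close>, removing the leading form of \<open>\<psi>\<close>.\<close>

lemma approx_of_cdiff:
  assumes "\<forall>\<^sub>F u in at 0. cdiff \<psi> u" "big_oh UNIV k \<psi>" "k \<le> Suc q"
  shows "approx \<psi>"
  using assms
proof (induction "Suc q - k" arbitrary: k \<psi>)
  case 0
  then have "big_oh UNIV (Suc q) \<psi>" by simp
  then show ?case unfolding approx_def by (intro exI[of _ "\<lambda>_. 0"]) simp
next
  case (Suc d)
  then have k: "k \<le> q" by simp
  have "big_oh UNIV 0 \<psi>" by (rule big_oh_mono[OF Suc.prems(2)]) simp
  then obtain \<phi> where \<phi>: "\<And>j. \<phi> j \<in> forms j" "\<And>K. big_oh UNIV K (\<lambda>u. \<psi> u - (\<Sum>j<K. \<phi> j u))"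
    using taylor_at_puncture[OF Suc.prems(1)] by blast
  have "big_oh UNIV k (\<lambda>u. \<psi> u - (\<psi> u - (\<Sum>j<Suc k. \<phi> j u)))"
    by (intro big_oh_diff Suc.prems(2) big_oh_mono[OF \<phi>(2)]) simp
  then have bo: "big_oh UNIV k (\<lambda>u. \<Sum>j<Suc k. \<phi> j u)" by simp
  have zero: "\<phi> j u = 0" if "j < k" "u \<noteq> 0" for j u
    by (rule forms_sum_big_oh_imp_0[OF \<phi>(1) bo that])
  obtain e where e: "\<phi> k = (\<lambda>u. \<Sum>\<gamma>\<in>exponents k. e \<gamma> * monomial \<gamma> u)"
    using \<phi>(1)[of k] by (auto simp: forms_iff)
  have "big_oh UNIV (Suc k) (\<lambda>u. \<psi> u - \<phi> k u)"
    by (rule big_oh_cong[OF \<phi>(2)[of "Suc k"]])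
       (use eventually_nonzero_at_0 in \<open>rule eventually_mono, simp add: zero\<close>)
  \<comment> \<open>Padding the entry \<open>None\<close> lifts an exponent of degree
    \<open>k\<close> to degree \<open>q\<close>; the corresponding \<open>hh\<close> has the
    monomial \<open>\<gamma>\<close> as its leading form.\<close>
  moreover define E where "E \<gamma> = case_option (q - k) \<gamma>" for \<gamma> :: "'n \<Rightarrow> nat"
  have E: "E \<gamma> \<in> exponents q" "(\<Sum>j\<in>UNIV. E \<gamma> (Some j)) = k" "E \<gamma> \<circ> Some = \<gamma>" if "\<gamma> \<in> exponents k" for \<gamma>
    using that k by (auto simp: E_def exponents_option) (auto simp: exponents_def)
  have "big_oh UNIV (Suc k) (\<lambda>u. \<Sum>\<gamma>\<in>exponents k. e \<gamma> * (monomial \<gamma> u - hh (E \<gamma>) u))"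
  proof (intro big_oh_sum big_oh_cmult)
    fix \<gamma> :: "'n \<Rightarrow> nat" assume "\<gamma> \<in> exponents k"
    from leading_hh[OF E(1)[OF this]] E(2,3)[OF this]
    show "big_oh UNIV (Suc k) (\<lambda>u. monomial \<gamma> u - hh (E \<gamma>) u)"
      by (intro big_oh_diff_sym[of UNIV "Suc k" "hh (E \<gamma>)"]) (simp add: leading_def)
  qed
  ultimately have "big_oh UNIV (Suc k) (\<lambda>u. (\<psi> u - \<phi> k u) + (\<Sum>\<gamma>\<in>exponents k. e \<gamma> * (monomial \<gamma> u - hh (E \<gamma>) u)))"
    by (intro big_oh_add)
  then have "big_oh UNIV (Suc k) (\<lambda>u. \<psi> u - (\<Sum>\<gamma>\<in>exponents k. e \<gamma> * hh (E \<gamma>) u))"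
    by (simp add: e right_diff_distrib sum_subtractf)
  moreover have "\<forall>\<^sub>F u in at 0. \<forall>\<gamma>\<in>exponents k. cdiff (hh (E \<gamma>)) u"
    by (rule eventually_ball_finite[OF finite_exponents]) (use E(1) hh(1) in blast)
  with Suc.prems(1) have "\<forall>\<^sub>F u in at 0. cdiff (\<lambda>u. \<psi> u - (\<Sum>\<gamma>\<in>exponents k. e \<gamma> * hh (E \<gamma>) u)) u"
    by eventually_elim (intro cdiff_intros, auto)
  ultimately have "approx (\<lambda>u. \<psi> u - (\<Sum>\<gamma>\<in>exponents k. e \<gamma> * hh (E \<gamma>) u))"
    using Suc.hyps(2) k by (intro Suc.hyps(1)[of "Suc k"]) auto
  then show ?case by (rule approx_minus_sum_hh[rotated 2]) (use E(1) finite_exponents in auto)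
qed

text \<open>The same \<open>b\<close> serves at the endpoint and near \<open>t = 0\<close>, which is
  what allows jets to be exchanged for values. At \<open>u\<close> the gluing identities are needed
  pointwise and appear as premises; on the curve they hold for all small nonzero
  \<open>t\<close>.\<close>

lemma curve_hh:
  assumes curve: "polynomial_curve F i q u P c \<kappa>"
  shows "\<exists>b.
    (\<forall>k. \<forall>\<alpha>\<in>exponents q. u \<in> axis_cone k \<longrightarrow> A k u \<noteq> 0 \<longrightarrow> hh \<alpha> u = h k \<alpha> u \<longrightarrow>
      \<kappa> * hh \<alpha> u = monomial \<alpha> (homog (1 + b) (a P))) \<and>
    (\<forall>\<alpha>\<in>exponents q. \<forall>\<^sub>F t in at 0. poly (P i) t * hh \<alpha> (c t) = monomial \<alpha> (homog (1 + b * t) (t *s a P)))"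
proof -
  obtain b where b: "\<And>k. \<kappa> * f' k u = (a P $ k) ^ (q - 1) * (1 + b)"
    "\<And>k. \<forall>\<^sub>F t in at 0. poly (P i) t * f' k (c t) = ((t *s a P) $ k) ^ (q - 1) * (1 + b * t)"
    using curve_values[OF curve] by blast
  have \<kappa>: "\<kappa> \<noteq> 0" using curve by (simp add: polynomial_curve_def)
  have "\<kappa> * hh \<alpha> u = monomial \<alpha> (homog (1 + b) (a P))"
    if "u \<in> axis_cone k" "A k u \<noteq> 0" "\<alpha> \<in> exponents q" "hh \<alpha> u = h k \<alpha> u" for k \<alpha>
    unfolding that(4)
    by (rule h_eq[OF \<kappa> axis_cone_nth_nonzero[OF that(1)] that(2) kappa_f[OF curve] b(1) that(3)])
  moreover have "\<forall>\<^sub>F t in at 0. poly (P i) t * hh \<alpha> (c t) = monomial \<alpha> (homog (1 + b * t) (t *s a P))"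
    if "\<alpha> \<in> exponents q" for \<alpha>
  proof -
    obtain l where l: "\<forall>\<^sub>F t in at 0. c t \<in> axis_cone l" using ex_axis_cone_curve[OF curve] by blast
    have "\<forall>\<^sub>F t in at 0. \<forall>j. poly (P i) t * f l j (c t) = ((t *s a P) $ l) ^ (q - 1) * (t *s a P) $ j"
      by (rule finite_eventually_all) (rule Pi_f[OF curve])
    moreover note l eventually_compose_c[OF curve A_nonzero l] Pi_nonzero[OF curve] b(2)[of l]
      eventually_compose_c[OF curve hh(2)[OF that] l]
    ultimately show ?thesis
    proof eventually_elim
      case (elim t)
      show ?case unfolding elim(6)
        by (rule h_eq[OF elim(4) axis_cone_nth_nonzero[OF elim(2)] elim(3) spec[OF elim(1)] elim(5) that])
    qed
  qed
  ultimately show ?thesis by blast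
qed

text \<open>The polynomial \<open>P j\<close> and the combination \<open>R\<close> of the
  polynomials \<open>mp \<alpha>\<close> have degree at most \<open>q\<close> and agree to order
  \<open>q\<close> at \<open>t = 0\<close>, hence coincide. The claim is their equality at
  \<open>t = 1\<close>.\<close>

lemma curve_span:
  assumes curve: "polynomial_curve F i q u P c \<kappa>"
    and x: "big_oh UNIV (Suc q) (\<lambda>u. F u $ j - (\<Sum>\<alpha>\<in>exponents q. x \<alpha> * hh \<alpha> u))"
    and u: "u \<in> axis_cone k" "A k u \<noteq> 0" "\<And>\<alpha>. \<alpha> \<in> exponents q \<Longrightarrow> hh \<alpha> u = h k \<alpha> u"
  shows "F u $ j = (\<Sum>\<alpha>\<in>exponents q. x \<alpha> * hh \<alpha> u)"
proof -
  obtain b where b: "\<And>\<alpha>. \<alpha> \<in> exponents q \<Longrightarrow> \<kappa> * hh \<alpha> u = monomial \<alpha> (homog (1 + b) (a P))"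
    "\<And>\<alpha>. \<alpha> \<in> exponents q \<Longrightarrow> \<forall>\<^sub>F t in at 0. poly (P i) t * hh \<alpha> (c t) = monomial \<alpha> (homog (1 + b * t) (t *s a P))"
    using curve_hh[OF curve] u by blast
  define mp where "mp \<alpha> = [:1, b:] ^ \<alpha> None * (\<Prod>j\<in>UNIV. [:0, a P $ j:] ^ \<alpha> (Some j))" for \<alpha> :: "'n option \<Rightarrow> nat"
  have mp: "poly (mp \<alpha>) t = monomial \<alpha> (homog (1 + b * t) (t *s a P))" for \<alpha> t
    by (simp add: mp_def monomial_homog_prod poly_prod mult.commute)
  have deg: "degree (mp \<alpha>) \<le> q" if "\<alpha> \<in> exponents q" for \<alpha>
  proof -
    have "degree (\<Prod>j\<in>UNIV. [:0, a P $ j:] ^ \<alpha> (Some j)) \<le> (\<Sum>j\<in>UNIV. degree ([:0, a P $ j:] ^ \<alpha> (Some j)))"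
      using degree_prod_sum_le[of UNIV "\<lambda>j. [:0, a P $ j:] ^ \<alpha> (Some j)"] by (simp add: o_def)
    also have "\<dots> \<le> (\<Sum>j\<in>UNIV. \<alpha> (Some j))"
      by (intro sum_mono order_trans[OF degree_power_le]) simp
    finally have "degree (\<Prod>j\<in>UNIV. [:0, a P $ j:] ^ \<alpha> (Some j)) \<le> (\<Sum>j\<in>UNIV. \<alpha> (Some j))" .
    moreover have "degree ([:1, b:] ^ \<alpha> None) \<le> \<alpha> None"
      by (rule order_trans[OF degree_power_le]) simp
    ultimately have "degree (mp \<alpha>) \<le> \<alpha> None + (\<Sum>j\<in>UNIV. \<alpha> (Some j))"
      unfolding mp_def by (intro order_trans[OF degree_mult_le] add_mono)
    then show ?thesis using that by (simp add: exponents_option)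
  qed
  have Pj: "comb (axis j 1) P = P j"
    by (simp add: comb_def axis_def if_distrib[of "\<lambda>x. smult x _"] cong: if_cong)
  define R where "R = (\<Sum>\<alpha>\<in>exponents q. smult (x \<alpha>) (mp \<alpha>))"
  have "P j = R"
  proof (rule poly_eq_of_big_oh)
    have "big_oh UNIV (Suc q) (\<lambda>u. dot (axis j 1) (F u) - (\<Sum>\<alpha>\<in>exponents q. x \<alpha> * hh \<alpha> u))"
      using x by (simp add: dot_axis)
    from comb_expand[OF curve this]
    have "big_oh UNIV (Suc q) (\<lambda>t. poly (P j) t - poly (P i) t * (\<Sum>\<alpha>\<in>exponents q. x \<alpha> * hh \<alpha> (c t)))"
      by (simp add: Pj)
    moreover have "\<forall>\<^sub>F t in at 0. \<forall>\<alpha>\<in>exponents q. poly (P i) t * hh \<alpha> (c t) = poly (mp \<alpha>) t"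
      unfolding mp by (rule eventually_ball_finite[OF finite_exponents]) (use b(2) in blast)
    then have "\<forall>\<^sub>F t in at 0. poly (P j) t - poly R t =
        poly (P j) t - poly (P i) t * (\<Sum>\<alpha>\<in>exponents q. x \<alpha> * hh \<alpha> (c t))"
    proof eventually_elim
      case (elim t)
      have "poly (P i) t * (\<Sum>\<alpha>\<in>exponents q. x \<alpha> * hh \<alpha> (c t)) =
          (\<Sum>\<alpha>\<in>exponents q. x \<alpha> * (poly (P i) t * hh \<alpha> (c t)))"
        by (simp add: sum_distrib_left mult_ac)
      also have "\<dots> = poly R t" unfolding R_def poly_sum poly_smult using elim by (intro sum.cong) auto
      finally show ?case by simp
    qed
    ultimately show "big_oh UNIV (Suc q) (\<lambda>t. poly (P j) t - poly R t)" by (rule big_oh_cong)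
    show "degree (P j) \<le> q" using curve by (simp add: polynomial_curve_def)
    show "degree R \<le> q"
      unfolding R_def by (intro degree_sum_le finite_exponents order_trans[OF degree_smult_le] deg)
  qed
  then have "poly (P j) 1 = (\<Sum>\<alpha>\<in>exponents q. x \<alpha> * monomial \<alpha> (homog (1 + b) (a P)))"
    by (simp add: R_def poly_sum mp)
  also have "\<dots> = \<kappa> * (\<Sum>\<alpha>\<in>exponents q. x \<alpha> * hh \<alpha> u)"
    by (simp add: b(1)[symmetric] sum_distrib_left mult_ac)
  finally show ?thesis using curve by (simp add: polynomial_curve_def)
qed

lemma eventually_F_eq:
  assumes x: "\<And>j. big_oh UNIV (Suc q) (\<lambda>u. F u $ j - (\<Sum>\<alpha>\<in>exponents q. x j \<alpha> * hh \<alpha> u))"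
  shows "\<forall>\<^sub>F u in at 0. \<forall>j. F u $ j = (\<Sum>\<alpha>\<in>exponents q. x j \<alpha> * hh \<alpha> u)"
proof (rule finite_eventually_all, rule eventually_eq_of_dense[OF dense])
  fix j
  show "\<forall>\<^sub>F u in at 0. cdiff (\<lambda>u. F u $ j) u"
    using eventually_at_0_of_nhds[OF F_cdiff] by eventually_elim blast
  have "\<forall>\<^sub>F u in at 0. \<forall>\<alpha>\<in>exponents q. cdiff (hh \<alpha>) u"
    by (rule eventually_ball_finite[OF finite_exponents]) (use hh(1) in blast)
  then show "\<forall>\<^sub>F u in at 0. cdiff (\<lambda>u. \<Sum>\<alpha>\<in>exponents q. x j \<alpha> * hh \<alpha> u) u"
    by eventually_elim (intro cdiff_intros, auto)
  show "\<forall>\<^sub>F u in at 0. u \<in> G \<longrightarrow> F u $ j = (\<Sum>\<alpha>\<in>exponents q. x j \<alpha> * hh \<alpha> u)"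
  proof (rule eventually_at_0_cones)
    fix k :: 'n
    have "\<forall>\<^sub>F u in at 0 within axis_cone k. \<forall>\<alpha>\<in>exponents q. hh \<alpha> u = h k \<alpha> u"
      by (rule eventually_ball_finite[OF finite_exponents]) (use hh(2) in blast)
    moreover have "\<forall>\<^sub>F u in at 0 within axis_cone k. u \<in> G \<longrightarrow> (\<exists>P c \<kappa>. polynomial_curve F i q u P c \<kappa>)"
      by (rule filter_leD[OF at_le curves]) auto
    ultimately show "\<forall>\<^sub>F u in at 0 within axis_cone k. u \<in> G \<longrightarrow> F u $ j = (\<Sum>\<alpha>\<in>exponents q. x j \<alpha> * hh \<alpha> u)"
      using A_nonzero eventually_in_set
    proof eventually_elim
      case (elim u)
      then show ?case using curve_span[OF _ x] by blast
    qed
  qed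
qed auto

section \<open>The affine parameter of the Veronese map\<close>

lemma leading_hh_exponent0: "leading UNIV 0 (hh (exponent0 q)) (\<lambda>_. 1)"
proof -
  have "monomial (exponent0 q \<circ> Some) = (\<lambda>_ :: complex ^ 'n. 1)" by (rule ext) (simp add: monomial_def exponent0_def)
  moreover have "(\<Sum>j\<in>(UNIV :: 'n set). exponent0 q (Some j)) = 0" by (simp add: exponent0_def)
  ultimately show ?thesis using leading_hh[OF exponent0_in_exponents] by simp
qed

lemma leading_hh_exponent1: "leading UNIV 1 (hh (exponent1 q j)) (\<lambda>u. u $ j)"
proof -
  have "monomial (exponent1 q j \<circ> Some) = (\<lambda>u. u $ j)"
    by (rule ext) (simp add: monomial_def exponent1_def if_distrib[of "\<lambda>m. _ ^ m"] cong: if_cong)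
  then show ?thesis using leading_hh[OF exponent1_in_exponents[OF q], of j] by (simp add: exponent1_def)
qed

text \<open>At points of \<open>G\<close> near the origin the entries are
  \<open>a P $ j / (1 + b)\<close>: these are affine coordinates of the point whose monomials are
  the functions \<open>hh \<alpha>\<close>, up to a common factor.\<close>

definition v :: "complex ^ 'n \<Rightarrow> complex ^ 'n" where "v u = (\<chi> j. hh (exponent1 q j) u / hh (exponent0 q) u)"

lemma hh_exponent0_nonzero: "\<forall>\<^sub>F u in at 0. hh (exponent0 q) u \<noteq> 0"
  by (rule leading_eventually_nonzero[OF leading_hh_exponent0]) simp

lemma v_cdiff: "\<forall>\<^sub>F u in at 0. \<forall>j. cdiff (\<lambda>u. v u $ j) u"
proof (rule finite_eventually_all)
  show "\<forall>\<^sub>F u in at 0. cdiff (\<lambda>u. v u $ j) u" for j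
    using hh(1)[OF exponent0_in_exponents] hh(1)[OF exponent1_in_exponents[OF q, of j]] hh_exponent0_nonzero
    by eventually_elim (simp add: v_def cdiff_divide)
qed

lemma eventually_hh_eq: "\<forall>\<^sub>F u in at 0. \<forall>\<alpha>\<in>exponents q. hh \<alpha> u = hh (exponent0 q) u * monomial \<alpha> (homog 1 (v u))"
proof (rule eventually_ball_finite[OF finite_exponents], rule ballI, rule eventually_eq_of_dense[OF dense])
  fix \<alpha> :: "'n option \<Rightarrow> nat" assume \<alpha>: "\<alpha> \<in> exponents q"
  show "\<forall>\<^sub>F u in at 0. cdiff (hh \<alpha>) u" by (rule hh(1)[OF \<alpha>])
  show "\<forall>\<^sub>F u in at 0. cdiff (\<lambda>u. hh (exponent0 q) u * monomial \<alpha> (homog 1 (v u))) u"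
    using hh(1)[OF exponent0_in_exponents] v_cdiff unfolding monomial_homog_prod
    by eventually_elim (intro cdiff_intros, auto)
  show "\<forall>\<^sub>F u in at 0. u \<in> G \<longrightarrow> hh \<alpha> u = hh (exponent0 q) u * monomial \<alpha> (homog 1 (v u))"
  proof (rule eventually_at_0_cones)
    fix k :: 'n
    have "\<forall>\<^sub>F u in at 0 within axis_cone k. \<forall>\<alpha>\<in>exponents q. hh \<alpha> u = h k \<alpha> u"
      by (rule eventually_ball_finite[OF finite_exponents]) (use hh(2) in blast)
    moreover have "\<forall>\<^sub>F u in at 0 within axis_cone k. u \<in> G \<longrightarrow> (\<exists>P c \<kappa>. polynomial_curve F i q u P c \<kappa>)"
      by (rule filter_leD[OF at_le curves]) auto
    moreover have "\<forall>\<^sub>F u in at 0 within axis_cone k. hh (exponent0 q) u \<noteq> 0"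
      by (rule filter_leD[OF at_le hh_exponent0_nonzero]) auto
    ultimately show "\<forall>\<^sub>F u in at 0 within axis_cone k. u \<in> G \<longrightarrow> hh \<alpha> u = hh (exponent0 q) u * monomial \<alpha> (homog 1 (v u))"
      using A_nonzero eventually_in_set
    proof eventually_elim
      case (elim u)
      show ?case
      proof
        assume "u \<in> G"
        then obtain P c \<kappa> where curve: "polynomial_curve F i q u P c \<kappa>" using elim by blast
        have \<kappa>: "\<kappa> \<noteq> 0" using curve by (simp add: polynomial_curve_def)
        obtain b where b: "\<And>\<beta>. \<beta> \<in> exponents q \<Longrightarrow> \<kappa> * hh \<beta> u = monomial \<beta> (homog (1 + b) (a P))"
          using curve_hh[OF curve] elim by blast
        have 0: "\<kappa> * hh (exponent0 q) u = (1 + b) ^ q" using b[OF exponent0_in_exponents] by (simp add: monomial_exponent0 homog_def)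
        have 1: "\<kappa> * hh (exponent1 q j) u = (1 + b) ^ (q - 1) * a P $ j" for j
          using b[OF exponent1_in_exponents[OF q]] by (simp add: monomial_exponent1 homog_def)
        \<comment> \<open>The value for \<open>exponent0\<close> is eventually nonzero, so the
          vector with first entry \<open>1 + b\<close> does not lie at infinity and can be
          normalized.\<close>
        have nz: "1 + b \<noteq> 0" using 0 \<kappa> elim(3) q by (auto simp: power_0_left)
        have "v u $ j = a P $ j / (1 + b)" for j
        proof -
          have "v u $ j = (\<kappa> * hh (exponent1 q j) u) / (\<kappa> * hh (exponent0 q) u)" using \<kappa> by (simp add: v_def)
          also have "\<dots> = a P $ j / (1 + b)"
          proof -
            have "(1 + b) ^ q = (1 + b) * (1 + b) ^ (q - 1)" using q by (cases q) simp_all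
            then show ?thesis unfolding 0 1 using nz by simp
          qed
          finally show ?thesis .
        qed
        then have "homog (1 + b) (a P) = (1 + b) *s homog 1 (v u)"
        proof (intro vec_eq_iff[THEN iffD2] allI)
          fix j
          assume *: "\<And>j. v u $ j = a P $ j / (1 + b)"
          show "homog (1 + b) (a P) $ j = ((1 + b) *s homog 1 (v u)) $ j"
            by (cases j) (simp_all only: homog_def vec_lambda_beta vector_smult_component option.case
                * nonzero_mult_div_cancel_left[OF nz] times_divide_eq_right mult_1_right)
        qed
        then have "\<kappa> * hh \<alpha> u = (\<kappa> * hh (exponent0 q) u) * monomial \<alpha> (homog 1 (v u))"
          unfolding b[OF \<alpha>] 0 using monomial_scale_exponents[OF \<alpha>] by metis
        then show "hh \<alpha> u = hh (exponent0 q) u * monomial \<alpha> (homog 1 (v u))" using \<kappa> by simp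
      qed
    qed
  qed
qed auto

text \<open>The factor \<open>\<mu>\<close> is \<open>hh (exponent0 q)\<close>. About
  \<open>v\<close> only continuity off the origin and the limit at the origin are recorded, because
  the germs will be identified by a topological argument.\<close>

theorem ex_veronese_parametrization:
  "\<exists>w v \<mu>. (\<forall>\<^sub>F u in at 0. F u = \<mu> u *s (\<Sum>\<alpha>\<in>exponents q. monomial \<alpha> (homog 1 (v u)) *s w \<alpha>)) \<and>
     (\<forall>\<^sub>F u in at 0. isCont v u) \<and> (v \<longlongrightarrow> (0 :: complex ^ 'n)) (at 0) \<and> (\<mu> \<longlongrightarrow> 1) (at 0)"
proof -
  have "approx (\<lambda>u. F u $ j)" for j
  proof (rule approx_of_cdiff)
    show "\<forall>\<^sub>F u in at 0. cdiff (\<lambda>u. F u $ j) u"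
      using eventually_at_0_of_nhds[OF F_cdiff] by eventually_elim blast
    show "big_oh UNIV 0 (\<lambda>u. F u $ j)" using dot_F_big_oh[of "axis j 1"] by (simp add: dot_axis)
  qed simp
  then have "\<forall>j. \<exists>x. big_oh UNIV (Suc q) (\<lambda>u. F u $ j - (\<Sum>\<alpha>\<in>exponents q. x \<alpha> * hh \<alpha> u))"
    by (simp add: approx_def)
  then obtain x where "\<And>j. big_oh UNIV (Suc q) (\<lambda>u. F u $ j - (\<Sum>\<alpha>\<in>exponents q. x j \<alpha> * hh \<alpha> u))"
    using choice[of "\<lambda>j x. big_oh UNIV (Suc q) (\<lambda>u. F u $ j - (\<Sum>\<alpha>\<in>exponents q. x \<alpha> * hh \<alpha> u))"] by blast
  from eventually_F_eq[OF this] eventually_hh_eq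
  have "\<forall>\<^sub>F u in at 0. F u = hh (exponent0 q) u *s (\<Sum>\<alpha>\<in>exponents q. monomial \<alpha> (homog 1 (v u)) *s (\<chi> j. x j \<alpha>))"
  proof eventually_elim
    case (elim u)
    have "F u $ j = hh (exponent0 q) u * (\<Sum>\<alpha>\<in>exponents q. monomial \<alpha> (homog 1 (v u)) * x j \<alpha>)" for j
    proof -
      have "F u $ j = (\<Sum>\<alpha>\<in>exponents q. x j \<alpha> * (hh (exponent0 q) u * monomial \<alpha> (homog 1 (v u))))"
        using elim by (auto intro!: sum.cong)
      then show ?thesis by (simp add: sum_distrib_left mult_ac)
    qed
    then show ?case by (simp add: vec_eq_iff)
  qed
  moreover have "\<forall>\<^sub>F u in at 0. isCont v u"
    using v_cdiff
  proof eventually_elim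
    case (elim u)
    show ?case unfolding isCont_def
    proof (rule vec_tendstoI)
      show "((\<lambda>u. v u $ j) \<longlongrightarrow> v u $ j) (at u)" for j
        using cdiff_imp_isCont[OF spec[OF elim, of j]] by (simp add: isCont_def)
    qed
  qed
  moreover have lim: "(hh (exponent0 q) \<longlongrightarrow> 1) (at 0)"
    using big_oh_tendsto_0[of UNIV 0 "\<lambda>u. hh (exponent0 q) u - 1"] leading_hh_exponent0
    by (simp add: leading_def LIM_zero_iff)
  moreover have "(v \<longlongrightarrow> 0) (at 0)"
  proof (rule vec_tendstoI)
    fix j
    have "(hh (exponent1 q j) \<longlongrightarrow> 0) (at 0)"
      using leading_imp_big_oh[OF leading_hh_exponent1[of j]] by (intro big_oh_tendsto_0[of UNIV 0]) simp
    from tendsto_divide[OF this lim] show "((\<lambda>u. v u $ j) \<longlongrightarrow> 0 $ j) (at 0)" by (simp add: v_def)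
  qed
  ultimately show ?thesis
    by (intro exI[of _ "\<lambda>\<alpha>. \<chi> j. x j \<alpha>"] exI[of _ v] exI[of _ "hh (exponent0 q)"] conjI)
qed

end

section \<open>Linear functionals and homogeneous coordinates\<close>

lemma dot_add: "dot l (v + w) = dot l v + dot l w"
  by (simp add: dot_def distrib_left sum.distrib)

lemma dot_sum: "dot l (\<Sum>i\<in>I. f i) = (\<Sum>i\<in>I. dot l (f i))"
  by (simp add: dot_def sum_distrib_left) (rule sum.swap)

lemma dot_zero: "dot l 0 = 0"
  by (simp add: dot_def)

lemma dot_scale_left: "dot (z *s l) v = z * dot l v"
  by (simp add: dot_def sum_distrib_left mult_ac)

text \<open>A linear map into one coordinate axis stands for a functional; its coefficient vector is
  read off from the standard basis.\<close>

lemma ex_dot_extend: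
  fixes B :: "(complex ^ 'j::finite) set"
  assumes "vec.independent B"
  shows "\<exists>l. \<forall>b\<in>B. dot l b = f b"
proof -
  let ?k = "undefined :: 'j"
  obtain g :: "complex ^ 'j \<Rightarrow> complex ^ 'j" where g: "Vector_Spaces.linear (*s) (*s) g"
    "\<And>b. b \<in> B \<Longrightarrow> g b = f b *s axis ?k 1"
    using vec.linear_independent_extend[OF assms, of "\<lambda>b. f b *s axis ?k 1"] by blast
  have "dot (\<chi> i. g (axis i 1) $ ?k) b = f b" if "b \<in> B" for b
    using linear_componentwise[OF g(1), of b ?k] g(2)[OF that] by (simp add: dot_def mult.commute)
  then show ?thesis by blast
qed

lemma ex_dot_extend_family:
  fixes w :: "'i \<Rightarrow> complex ^ 'j::finite"
  assumes "inj_on w I" "vec.independent (w ` I)"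
  shows "\<exists>l. \<forall>i\<in>I. dot l (w i) = f i"
  using ex_dot_extend[OF assms(2), of "\<lambda>b. f (inv_into I w b)"] assms(1) by auto

text \<open>If \<open>v\<close> were outside the span, adding it to a maximal independent subset of
  \<open>S\<close> would keep independence, and a functional could be 1 at \<open>v\<close> and 0 on
  that subset.\<close>

lemma in_span_of_dot:
  fixes S :: "(complex ^ 'j::finite) set"
  assumes "\<And>l. (\<And>s. s \<in> S \<Longrightarrow> dot l s = 0) \<Longrightarrow> dot l v = 0"
  shows "v \<in> vec.span S"
proof (rule ccontr)
  assume v: "v \<notin> vec.span S"
  obtain B where B: "B \<subseteq> S" "vec.independent B" "S \<subseteq> vec.span B"
    by (rule vec.maximal_independent_subset)
  have "v \<notin> vec.span B" using v B(1) vec.span_mono by blast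
  then have "vec.independent (insert v B)" using B(2) by (simp add: vec.independent_insert vec.span_base)
  then obtain l where l: "\<And>b. b \<in> insert v B \<Longrightarrow> dot l b = (if b = v then 1 else 0)"
    using ex_dot_extend[of "insert v B" "\<lambda>b. if b = v then 1 else 0"] by blast
  have "dot l b = 0" if "b \<in> B" for b
    using l[of b] that \<open>v \<notin> vec.span B\<close> vec.span_base by auto
  moreover have "vec.subspace {s. dot l s = 0}"
    by (rule vec.subspaceI) (auto simp: dot_zero dot_add dot_scale)
  ultimately have "vec.span B \<subseteq> {s. dot l s = 0}"
    by (intro vec.span_minimal) auto
  then have "dot l v = 0" using B(3) by (intro assms) auto
  then show False using l[of v] by simp
qed

lemma ex_homogeneous_coords: "\<exists>v. v \<noteq> 0 \<and> p = proj_point v"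
proof -
  have "line_of p \<in> {L. \<exists>v. v \<noteq> 0 \<and> L = vec.span {v}}" by (rule line_of)
  then obtain v where "v \<noteq> 0" "line_of p = vec.span {v}" by blast
  then show ?thesis unfolding proj_point_def by (metis line_of_inverse)
qed

lemma proj_point_scale: "z \<noteq> 0 \<Longrightarrow> proj_point (z *s v) = proj_point v"
proof -
  assume z: "z \<noteq> 0"
  have "vec.span {z *s v} = vec.span {v}"
  proof (intro equalityI vec.span_minimal)
    show "{z *s v} \<subseteq> vec.span {v}" by (simp add: vec.span_scale vec.span_base)
    have "v = inverse z *s (z *s v)" using z by simp
    also have "\<dots> \<in> vec.span {z *s v}" by (intro vec.span_scale vec.span_base) simp
    finally show "{v} \<subseteq> vec.span {z *s v}" by simp
  qed simp_all
  then show ?thesis by (simp add: proj_point_def)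
qed

lemma proj_point_eqD:
  assumes "proj_point v = proj_point w" "v \<noteq> 0" "w \<noteq> 0"
  obtains z where "z \<noteq> 0" "v = z *s w"
proof -
  have "vec.span {v} = vec.span {w}"
    using assms line_of_proj_point by metis
  then have "v \<in> vec.span {w}" using vec.span_base[of v "{v}"] by simp
  then obtain z where "v = z *s w" by (auto simp: vec.span_singleton)
  moreover then have "z \<noteq> 0" using assms(2) by auto
  ultimately show ?thesis using that by blast
qed

lemma proj_point_in_affine_chart: "v \<noteq> 0 \<Longrightarrow> proj_point v \<in> affine_chart i \<longleftrightarrow> v $ i \<noteq> 0"
  by (auto simp: affine_chart_def line_of_proj_point vec.span_singleton)

lemma affine_coords:
  assumes "p \<in> affine_chart i"
  shows "proj_point (affine_coords i p) = p" "affine_coords i p $ i = 1"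
proof -
  obtain v where v: "v \<noteq> 0" "p = proj_point v" using ex_homogeneous_coords by blast
  then have vi: "v $ i \<noteq> 0" using assms proj_point_in_affine_chart by blast
  then have eq: "affine_coords i p = inverse (v $ i) *s v" using v affine_coords_proj_point by blast
  show "proj_point (affine_coords i p) = p" using eq vi v proj_point_scale[of "inverse (v $ i)" v] by simp
  show "affine_coords i p $ i = 1" using eq vi by simp
qed

text \<open>\<open>has_projective_dim\<close> speaks of some linear space with the given projective
  subspace; injectivity identifies it with the span that defines the osculating space.\<close>

lemma projective_subspace_inject:
  assumes "vec.subspace L" "vec.subspace M" "projective_subspace L = projective_subspace M"
  shows "L = M"
proof -
  have "v \<in> M" if "v \<in> L" "vec.subspace L" "vec.subspace M" "projective_subspace L = projective_subspace M"
    for v and L M :: "(complex ^ 'a option) set"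
  proof (cases "v = 0")
    case True
    then show ?thesis using that(3) by (simp add: vec.subspace_0)
  next
    case False
    have "vec.span {v} \<subseteq> L" using that by (intro vec.span_minimal) auto
    then have "proj_point v \<in> projective_subspace L"
      using False by (simp add: projective_subspace_def line_of_proj_point)
    then have "proj_point v \<in> projective_subspace M"
      using that(4) by simp
    then show ?thesis using False vec.span_base[of v "{v}"]
      by (auto simp: projective_subspace_def line_of_proj_point)
  qed
  then show ?thesis using assms by blast
qed

lemma eventually_proj_point_in_open:
  assumes "(z \<longlongrightarrow> z0) A" "z0 \<noteq> 0" "open U" "proj_point z0 \<in> U"
  shows "\<forall>\<^sub>F t in A. z t \<noteq> 0 \<and> proj_point (z t) \<in> U"
proof -
  have "open {v. v \<noteq> 0 \<and> proj_point v \<in> U}"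
    using assms(3) unfolding open_proj_def .
  from topological_tendstoD[OF assms(1) this] assms(2,4) show ?thesis by simp
qed

lemma open_affine_chart: "open (affine_chart i)"
proof -
  have "{v. v \<noteq> 0 \<and> proj_point v \<in> affine_chart i} = {v. v $ i \<noteq> 0}"
  proof (rule set_eqI)
    fix v :: "complex ^ 'a option"
    show "v \<in> {v. v \<noteq> 0 \<and> proj_point v \<in> affine_chart i} \<longleftrightarrow> v \<in> {v. v $ i \<noteq> 0}"
      using proj_point_in_affine_chart[of v i] by (cases "v = 0") auto
  qed
  then show ?thesis unfolding open_proj_def
    by (simp add: open_Collect_neq continuous_intros)
qed

section \<open>Local parametrizations\<close>

lemma has_derivative_vec:
  fixes E :: "'a::real_normed_vector \<Rightarrow> complex ^ 'j::finite"
  assumes "\<And>j. ((\<lambda>u. E u $ j) has_derivative (\<lambda>h. D h $ j)) (at u)"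
  shows "(E has_derivative D) (at u)"
proof -
  have "((\<lambda>u. \<Sum>j\<in>UNIV. E u $ j *s axis j 1) has_derivative (\<lambda>h. \<Sum>j\<in>UNIV. D h $ j *s axis j 1)) (at u)"
    by (intro has_derivative_sum bounded_linear.has_derivative[OF bounded_linear_vec_scale] assms)
  then show ?thesis by (simp add: basis_expansion)
qed

lemma cdiff_translate:
  assumes "cdiff f (u0 + u)"
  shows "cdiff (\<lambda>u. f (u0 + u)) u"
proof -
  obtain D where D: "(f has_derivative D) (at (u0 + u))" "\<And>c h. D (c *s h) = c * D h"
    using assms by (auto simp: cdiff_def)
  have "((\<lambda>u. u0 + u) has_derivative (\<lambda>h. h)) (at u)"
    by (auto intro!: derivative_eq_intros)
  from has_derivative_compose[OF this D(1)] show ?thesis by (rule cdiffI) (simp add: D)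
qed

text \<open>An injective linear map in finite dimension is bounded below, and half of the bound
  survives the error of differentiation. The result controls parameters by distances in a
  chart.\<close>

lemma derivative_bounded_below:
  fixes E :: "'a::euclidean_space \<Rightarrow> 'b::euclidean_space"
  assumes "E differentiable (at u0)" "inj (frechet_derivative E (at u0))"
  obtains b where "b > 0" "\<forall>\<^sub>F u in nhds u0. b * norm (u - u0) \<le> norm (E u - E u0)"
proof -
  let ?D = "frechet_derivative E (at u0)"
  have D: "(E has_derivative ?D) (at u0)" using assms(1) by (simp add: frechet_derivative_works)
  obtain b where b: "b > 0" "\<And>x. b * norm x \<le> norm (?D x)"
    using linear_inj_bounded_below_pos[OF has_derivative_linear[OF D] assms(2)] by blast
  obtain d where d: "d > 0" "\<And>u. norm (u - u0) < d \<Longrightarrow> norm (E u - E u0 - ?D (u - u0)) \<le> b / 2 * norm (u - u0)"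
    using D[unfolded has_derivative_at_alt] b(1) by (meson half_gt_zero)
  have "b / 2 * norm (u - u0) \<le> norm (E u - E u0)" if "norm (u - u0) < d" for u
    using d(2)[OF that] b(2)[of "u - u0"] norm_triangle_ineq3[of "?D (u - u0)" "?D (u - u0) - (E u - E u0)"]
      norm_triangle_sub[of "?D (u - u0)" "E u - E u0"] by (simp add: norm_minus_commute)
  then have "\<forall>\<^sub>F u in nhds u0. b / 2 * norm (u - u0) \<le> norm (E u - E u0)"
    using d(1) by (auto simp: eventually_nhds_metric dist_norm)
  then show ?thesis using b(1) that[of "b / 2"] by simp
qed

locale parametrized_germ =
  fixes X :: "'N::finite proj set" and \<Omega> :: "(complex ^ 'n::finite) set" and \<sigma> :: "complex ^ 'n \<Rightarrow> 'N proj"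
    and u0 :: "complex ^ 'n" and x :: "'N proj" and i :: "'N option"
  assumes par: "local_parametrization X \<Omega> \<sigma>" and u0: "u0 \<in> \<Omega>" and x_eq: "x = \<sigma> u0"
    and x_chart: "x \<in> affine_chart i"
begin

text \<open>The chart \<open>i\<close> is the one in which the osculating space is computed; it may
  differ from the chart in which \<open>\<sigma>\<close> is given as holomorphic.\<close>

definition F :: "complex ^ 'n \<Rightarrow> complex ^ 'N option" where
  "F u = affine_coords i (\<sigma> (u0 + u))"

lemma open_\<Omega>: "open \<Omega>" and openin_image: "openin (top_of_set X) (\<sigma> ` \<Omega>)"
  using par by (auto simp: local_parametrization_def)

lemma ex_inverse: "\<exists>\<tau>. homeomorphism \<Omega> (\<sigma> ` \<Omega>) \<sigma> \<tau>"
  using par by (auto simp: local_parametrization_def)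

lemma ex_chart:
  obtains k where "\<sigma> ` \<Omega> \<subseteq> affine_chart k" "\<And>j u. u \<in> \<Omega> \<Longrightarrow> cdiff (\<lambda>u. affine_coords k (\<sigma> u) $ j) u"
    "\<And>u. u \<in> \<Omega> \<Longrightarrow> inj (frechet_derivative (\<lambda>u. affine_coords k (\<sigma> u)) (at u))"
proof -
  from par obtain k where "\<sigma> ` \<Omega> \<subseteq> affine_chart k"
    "\<forall>j. holomorphic_several (\<lambda>u. affine_coords k (\<sigma> u) $ j) \<Omega>"
    "\<forall>u\<in>\<Omega>. inj (frechet_derivative (\<lambda>u. affine_coords k (\<sigma> u)) (at u))"
    unfolding local_parametrization_def by blast
  then show ?thesis using that by (simp add: holomorphic_several_iff_cdiff)
qed

lemma \<sigma>_cont: "u \<in> \<Omega> \<Longrightarrow> open U \<Longrightarrow> \<sigma> u \<in> U \<Longrightarrow> \<forall>\<^sub>F v in nhds u. v \<in> \<Omega> \<and> \<sigma> v \<in> U"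
proof -
  assume u: "u \<in> \<Omega>" "open U" "\<sigma> u \<in> U"
  have "continuous_on \<Omega> \<sigma>" using ex_inverse by (auto simp: homeomorphism_def)
  then have "open (\<sigma> -` U \<inter> \<Omega>)" using open_\<Omega> u(2) by (simp add: continuous_on_open_vimage)
  then have "\<forall>\<^sub>F v in nhds u. v \<in> \<sigma> -` U \<inter> \<Omega>" using u by (intro eventually_nhds_in_open) auto
  then show ?thesis by eventually_elim simp
qed

lemma \<sigma>_inj: "inj_on \<sigma> \<Omega>"
  using ex_inverse by (auto simp: homeomorphism_def intro: inj_on_inverseI)

lemma eventually_shift: "\<forall>\<^sub>F v in nhds u0. Q v \<Longrightarrow> \<forall>\<^sub>F u in nhds 0. Q (u0 + u)"
proof -
  assume "\<forall>\<^sub>F v in nhds u0. Q v"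
  moreover have "filterlim (\<lambda>u. u0 + u) (nhds u0) (nhds 0)"
    by (rule tendsto_eq_intros tendsto_ident_at tendsto_const filterlim_ident)+ simp
  ultimately show ?thesis by (rule eventually_compose_filterlim)
qed

lemma eventually_chart: "\<forall>\<^sub>F u in nhds 0. u0 + u \<in> \<Omega> \<and> \<sigma> (u0 + u) \<in> affine_chart i"
  by (intro eventually_shift \<sigma>_cont u0 open_affine_chart) (use x_eq x_chart in simp)

lemma F_props: "\<sigma> (u0 + u) \<in> affine_chart i \<Longrightarrow> proj_point (F u) = \<sigma> (u0 + u)"
  "\<sigma> (u0 + u) \<in> affine_chart i \<Longrightarrow> F u $ i = 1"
  by (simp_all add: F_def affine_coords)

lemma F_cdiff: "\<forall>\<^sub>F u in nhds 0. \<forall>j. cdiff (\<lambda>u. F u $ j) u"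
proof -
  obtain k where k: "\<sigma> ` \<Omega> \<subseteq> affine_chart k" "\<And>j u. u \<in> \<Omega> \<Longrightarrow> cdiff (\<lambda>u. affine_coords k (\<sigma> u) $ j) u"
    by (rule ex_chart) blast
  define E where "E u = affine_coords k (\<sigma> (u0 + u))" for u
  have E: "cdiff (\<lambda>u. E u $ j) u" if "u0 + u \<in> \<Omega>" for u j
    unfolding E_def by (rule cdiff_translate[OF k(2)[OF that]])
  have FE: "E u $ i \<noteq> 0 \<and> F u $ j = E u $ j / E u $ i" if "u0 + u \<in> \<Omega>" "\<sigma> (u0 + u) \<in> affine_chart i" for u j
  proof -
    have pE: "proj_point (E u) = \<sigma> (u0 + u)" "E u $ k = 1"
      unfolding E_def using k(1) that(1) by (auto intro!: affine_coords)
    then have "E u \<noteq> 0" by auto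
    then have "E u $ i \<noteq> 0" using pE(1) that(2) proj_point_in_affine_chart by metis
    then show ?thesis using affine_coords_proj_point[of "E u" i] pE(1) by (simp add: F_def divide_inverse mult.commute)
  qed
  obtain S where S: "open S" "0 \<in> S" "\<And>u. u \<in> S \<Longrightarrow> u0 + u \<in> \<Omega> \<and> \<sigma> (u0 + u) \<in> affine_chart i"
    using eventually_chart by (auto simp: eventually_nhds)
  have "cdiff (\<lambda>u. F u $ j) u" if "u \<in> S" for u j
  proof (rule cdiff_cong)
    show "cdiff (\<lambda>u. E u $ j / E u $ i) u"
      using S(3)[OF that] FE[of u] by (intro cdiff_divide E) auto
    show "\<forall>\<^sub>F v in nhds u. F v $ j = E v $ j / E v $ i"
      using eventually_nhds_in_open[OF S(1) that] by eventually_elim (use S(3) FE in blast)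
  qed
  then show ?thesis using S(1,2) by (auto simp: eventually_nhds)
qed

text \<open>The inverse of the parametrization is known to be continuous only. The linear bound on
  \<open>c\<close> comes from the lower bound for the immersion, combined with the differentiability
  of \<open>z\<close> normalized in the chart of the parametrization.\<close>

lemma lift_curve:
  fixes z :: "complex \<Rightarrow> complex ^ 'N option"
  assumes diff: "\<And>j. (\<lambda>t. z t $ j) field_differentiable at 0"
    and z0: "z 0 \<noteq> 0" "proj_point (z 0) = x" and inX: "\<forall>\<^sub>F t in nhds 0. proj_point (z t) \<in> X"
  obtains c K where "\<forall>\<^sub>F t in nhds 0. z t \<noteq> 0 \<and> u0 + c t \<in> \<Omega> \<and> \<sigma> (u0 + c t) = proj_point (z t)"
    "\<forall>\<^sub>F t in nhds 0. norm (c t) \<le> K * norm t" "(c \<longlongrightarrow> 0) (nhds 0)"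
proof -
  obtain \<tau> where \<tau>: "homeomorphism \<Omega> (\<sigma> ` \<Omega>) \<sigma> \<tau>" using ex_inverse by blast
  obtain T where T: "open T" "\<sigma> ` \<Omega> = X \<inter> T" using openin_image by (auto simp: openin_open)
  have zt: "(z \<longlongrightarrow> z 0) (nhds 0)"
  proof -
    have "((\<lambda>t. z t $ j) \<longlongrightarrow> z 0 $ j) (nhds 0)" for j
      using field_differentiable_imp_continuous_at[OF diff[of j]]
      using tendsto_at_iff_tendsto_nhds[of "\<lambda>t. z t $ j" 0] by (simp add: isCont_def)
    then show ?thesis by (rule vec_tendstoI)
  qed
  have ev: "\<forall>\<^sub>F t in nhds 0. z t \<noteq> 0 \<and> proj_point (z t) \<in> U" if "open U" "x \<in> U" for U
    by (rule eventually_proj_point_in_open[OF zt z0(1) that(1)]) (use that z0 in simp)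
  have "x \<in> T" using T x_eq u0 by auto
  from ev[OF T(1) this] inX have ev\<Omega>: "\<forall>\<^sub>F t in nhds 0. z t \<noteq> 0 \<and> proj_point (z t) \<in> \<sigma> ` \<Omega>"
    by eventually_elim (use T(2) in simp)
  define c where "c t = \<tau> (proj_point (z t)) - u0" for t
  have c: "\<forall>\<^sub>F t in nhds 0. z t \<noteq> 0 \<and> u0 + c t \<in> \<Omega> \<and> \<sigma> (u0 + c t) = proj_point (z t)"
    using ev\<Omega> by eventually_elim (use \<tau> in \<open>auto simp: c_def homeomorphism_def\<close>)
  have lim: "((\<lambda>t. u0 + c t) \<longlongrightarrow> u0) (nhds 0)"
  proof (rule topological_tendstoI)
    fix W assume W: "open W" "u0 \<in> W"
    have "continuous_on (\<sigma> ` \<Omega>) \<tau>" using \<tau> by (simp add: homeomorphism_def)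
    then obtain T' where T': "open T'" "T' \<inter> \<sigma> ` \<Omega> = \<tau> -` W \<inter> \<sigma> ` \<Omega>"
      using W(1) unfolding continuous_on_open_invariant by blast
    have "\<tau> x = u0" using \<tau> u0 x_eq by (simp add: homeomorphism_def)
    then have "x \<in> T'" using T'(2) W(2) u0 x_eq by blast
    from ev[OF T'(1) this] ev\<Omega> show "\<forall>\<^sub>F t in nhds 0. u0 + c t \<in> W"
      by eventually_elim (use T'(2) in \<open>auto simp: c_def\<close>)
  qed
  then have lim0: "(c \<longlongrightarrow> 0) (nhds 0)"
    using tendsto_diff[OF lim tendsto_const[of u0]] by simp
  obtain k where k: "\<sigma> ` \<Omega> \<subseteq> affine_chart k" "\<And>j u. u \<in> \<Omega> \<Longrightarrow> cdiff (\<lambda>u. affine_coords k (\<sigma> u) $ j) u"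
    "\<And>u. u \<in> \<Omega> \<Longrightarrow> inj (frechet_derivative (\<lambda>u. affine_coords k (\<sigma> u)) (at u))"
    by (rule ex_chart) blast
  define E where "E u = affine_coords k (\<sigma> u)" for u
  have "E differentiable (at u0)"
  proof -
    have "\<forall>j. \<exists>D. ((\<lambda>u. E u $ j) has_derivative D) (at u0)"
      using k(2)[OF u0] unfolding cdiff_def E_def by blast
    then obtain D where "\<And>j. ((\<lambda>u. E u $ j) has_derivative D j) (at u0)" by metis
    then have "(E has_derivative (\<lambda>h. \<chi> j. D j h)) (at u0)" by (intro has_derivative_vec) simp
    then show ?thesis by (auto simp: differentiable_def)
  qed
  then obtain b where b: "b > 0" "\<forall>\<^sub>F u in nhds u0. b * norm (u - u0) \<le> norm (E u - E u0)"
    using derivative_bounded_below[of E u0] k(3)[OF u0] by (auto simp: E_def[abs_def])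
  have z0k: "z 0 $ k \<noteq> 0"
    using k(1) u0 x_eq z0 proj_point_in_affine_chart[of "z 0" k] by auto
  define y where "y t = (\<chi> j. z t $ j / z t $ k)" for t
  have Ey: "E (u0 + c t) = y t" if "z t \<noteq> 0" "u0 + c t \<in> \<Omega>" "\<sigma> (u0 + c t) = proj_point (z t)" for t
  proof -
    have "z t $ k \<noteq> 0" using k(1) that proj_point_in_affine_chart[of "z t" k] by auto
    then show ?thesis using affine_coords_proj_point[of "z t" k] that(3)
      by (simp add: E_def y_def vec_eq_iff divide_inverse mult.commute)
  qed
  have Ey0: "E u0 = y 0" using affine_coords_proj_point[of "z 0" k] z0k z0(2) x_eq
    by (simp add: E_def y_def vec_eq_iff divide_inverse mult.commute)
  have "\<exists>C. \<forall>\<^sub>F t in nhds 0. norm (y t $ j - y 0 $ j) \<le> C * norm t" for j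
  proof -
    have "(\<lambda>t. z t $ j / z t $ k) field_differentiable at 0"
      using z0k by (intro field_differentiable_divide diff)
    then obtain y' where "((\<lambda>t. y t $ j) has_derivative (*) y') (at 0)"
      by (auto simp: field_differentiable_def has_field_derivative_def y_def)
    then obtain d where d: "d > 0" "\<And>t. norm t < d \<Longrightarrow> norm (y t $ j - y 0 $ j - y' * t) \<le> 1 * norm t"
      unfolding has_derivative_at_alt by (metis diff_zero zero_less_one)
    have "norm (y t $ j - y 0 $ j) \<le> (norm y' + 1) * norm t" if "norm t < d" for t
      using d(2)[OF that] norm_triangle_sub[of "y t $ j - y 0 $ j" "y' * t"]
      by (simp add: norm_mult algebra_simps)
    then show ?thesis using d(1) by (auto simp: eventually_nhds_metric dist_norm)
  qed
  then have "\<exists>C. \<forall>j. \<forall>\<^sub>F t in nhds 0. norm (y t $ j - y 0 $ j) \<le> C j * norm t" by (intro choice allI)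
  then obtain C where C: "\<And>j. \<forall>\<^sub>F t in nhds 0. norm (y t $ j - y 0 $ j) \<le> C j * norm t" by blast
  have allC: "\<forall>\<^sub>F t in nhds 0. \<forall>j. norm (y t $ j - y 0 $ j) \<le> C j * norm t"
    by (rule finite_eventually_all) (rule C)
  have "\<forall>\<^sub>F t in nhds 0. b * norm (u0 + c t - u0) \<le> norm (E (u0 + c t) - E u0)"
    by (rule eventually_compose_filterlim[OF b(2) lim])
  then have "\<forall>\<^sub>F t in nhds 0. norm (c t) \<le> (\<Sum>j\<in>UNIV. C j) / b * norm t"
    using c allC
  proof eventually_elim
    case (elim t)
    have "b * norm (c t) \<le> norm (y t - y 0)" using elim(1,2) Ey Ey0 by simp
    also have "\<dots> \<le> (\<Sum>j\<in>UNIV. norm (y t $ j - y 0 $ j))" using norm_le_sum_nth[of "y t - y 0"] by simp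
    also have "\<dots> \<le> (\<Sum>j\<in>UNIV. C j * norm t)" using elim(3) by (intro sum_mono) auto
    finally show ?case using b(1) unfolding sum_distrib_right[symmetric] by (simp add: field_simps)
  qed
  with c lim0 show ?thesis using that by blast
qed

end

section \<open>Osculating spaces and jets\<close>

lemma higher_deriv_eq_0_of_bound:
  assumes hol: "h holomorphic_on ball 0 r" and "r > 0"
    and bound: "\<forall>\<^sub>F t in nhds 0. norm (h t) \<le> C * norm t ^ Suc q" and "k \<le> q"
  shows "(deriv ^^ k) h 0 = 0"
proof (rule ccontr)
  assume nz: "(deriv ^^ k) h 0 \<noteq> 0"
  obtain d where d: "d > 0" "\<And>t. norm t < d \<Longrightarrow> norm (h t) \<le> C * norm t ^ Suc q"
    using bound by (auto simp: eventually_nhds_metric)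
  define M where "M = fact k * (\<bar>C\<bar> + 1)"
  have "M > 0" by (simp add: M_def add_nonneg_pos)
  \<comment> \<open>The circle lies where \<open>h\<close> is holomorphic and estimated, and the
    last entry makes the Cauchy bound \<open>M * \<rho>\<close> at most half of the derivative it
    bounds.\<close>
  define \<rho> where "\<rho> = min (min (r / 2) (d / 2)) (min 1 (norm ((deriv ^^ k) h 0) / (2 * M)))"
  have "norm ((deriv ^^ k) h 0) / (2 * M) > 0" using nz \<open>M > 0\<close> by simp
  then have "\<rho> > 0" using \<open>r > 0\<close> d(1) unfolding \<rho>_def min_less_iff_conj by simp
  moreover have "\<rho> \<le> r / 2" "\<rho> \<le> d / 2" "\<rho> \<le> 1" "\<rho> \<le> norm ((deriv ^^ k) h 0) / (2 * M)"
    unfolding \<rho>_def by linarith+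
  ultimately have \<rho>: "\<rho> > 0" "\<rho> < r" "\<rho> < d" "\<rho> \<le> 1" "\<rho> \<le> norm ((deriv ^^ k) h 0) / (2 * M)"
    by linarith+
  have "norm ((deriv ^^ k) h 0) \<le> fact k * ((\<bar>C\<bar> + 1) * \<rho> ^ Suc q) / \<rho> ^ k"
  proof (rule Cauchy_inequality)
    show "h holomorphic_on ball 0 \<rho>" by (rule holomorphic_on_subset[OF hol]) (use \<rho> in auto)
    show "continuous_on (cball 0 \<rho>) h"
      by (rule holomorphic_on_imp_continuous_on[OF holomorphic_on_subset[OF hol]]) (use \<rho> in auto)
    show "norm (h t) \<le> (\<bar>C\<bar> + 1) * \<rho> ^ Suc q" if "norm (0 - t) = \<rho>" for t
    proof -
      have "norm t = \<rho>" using that by simp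
      then have "norm (h t) \<le> C * \<rho> ^ Suc q" using d(2)[of t] \<rho>(3) by simp
      also have "\<dots> \<le> (\<bar>C\<bar> + 1) * \<rho> ^ Suc q" using \<rho>(1) by (intro mult_right_mono) auto
      finally show ?thesis .
    qed
  qed (use \<rho> in auto)
  also have "\<dots> = M * \<rho> ^ (Suc q - k)"
    using \<rho>(1) \<open>k \<le> q\<close> by (simp add: M_def power_diff del: power_Suc)
  also have "\<dots> \<le> M * \<rho> ^ 1"
    using \<rho> \<open>k \<le> q\<close> \<open>M > 0\<close> by (intro mult_left_mono power_decreasing) auto
  also have "\<dots> \<le> M * (norm ((deriv ^^ k) h 0) / (2 * M))"
    unfolding power_one_right using \<rho>(5) \<open>M > 0\<close> by (rule mult_left_mono[OF _ less_imp_le])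
  also have "\<dots> = norm ((deriv ^^ k) h 0) / 2" using \<open>M > 0\<close> by simp
  finally show False using nz by simp
qed

lemma higher_deriv_linear_combination:
  assumes "finite I" "\<And>j. j \<in> I \<Longrightarrow> f j holomorphic_on S" "open S" "z \<in> S"
  shows "(deriv ^^ k) (\<lambda>w. \<Sum>j\<in>I. l j * f j w) z = (\<Sum>j\<in>I. l j * (deriv ^^ k) (f j) z)"
  using assms(1,2)
proof (induction I rule: finite_induct)
  case empty
  then show ?case by simp
next
  case (insert j I)
  have "(\<lambda>w. \<Sum>j\<in>I. l j * f j w) holomorphic_on S"
    using insert.prems by (intro holomorphic_on_sum holomorphic_on_mult holomorphic_on_const) auto
  moreover have "(\<lambda>w. l j * f j w) holomorphic_on S"
    using insert.prems by (intro holomorphic_on_mult holomorphic_on_const) auto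
  ultimately have "(deriv ^^ k) (\<lambda>w. l j * f j w + (\<Sum>j\<in>I. l j * f j w)) z =
      (deriv ^^ k) (\<lambda>w. l j * f j w) z + (deriv ^^ k) (\<lambda>w. \<Sum>j\<in>I. l j * f j w) z"
    using assms(3,4) by (intro higher_deriv_add)
  moreover have "(deriv ^^ k) (\<lambda>w. l j * f j w) z = l j * (deriv ^^ k) (f j) z"
    using insert.prems assms(3,4) by (intro higher_deriv_cmult[of "f j" S]) auto
  ultimately show ?case using insert by simp
qed

text \<open>Homogenization: exponents of degree at most \<open>q\<close> over \<open>'n\<close>
  correspond to exponents of degree exactly \<open>q\<close> over \<open>'n option\<close>, the
  entry \<open>None\<close> taking up the rest.\<close>

lemma sum_forms_eq_option_sum:
  fixes \<phi> :: "nat \<Rightarrow> complex ^ 'n::finite \<Rightarrow> complex"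
  assumes "\<And>k. \<phi> k \<in> forms k"
  shows "\<exists>e. \<forall>u. (\<Sum>k\<le>q. \<phi> k u) = (\<Sum>\<alpha>\<in>exponents q. e \<alpha> * monomial (\<alpha> \<circ> Some) u)"
proof -
  have "\<forall>k. \<exists>e. \<phi> k = (\<lambda>u. \<Sum>\<gamma>\<in>exponents k. e \<gamma> * monomial \<gamma> u)"
    using assms by (auto simp: forms_iff)
  then have "\<exists>e. \<forall>k. \<phi> k = (\<lambda>u. \<Sum>\<gamma>\<in>exponents k. e k \<gamma> * monomial \<gamma> u)" by (rule choice)
  then obtain e where e: "\<And>k. \<phi> k = (\<lambda>u. \<Sum>\<gamma>\<in>exponents k. e k \<gamma> * monomial \<gamma> u)" by blast
  have "(\<Sum>k\<le>q. \<phi> k u) = (\<Sum>\<alpha>\<in>exponents q. e (q - \<alpha> None) (\<alpha> \<circ> Some) * monomial (\<alpha> \<circ> Some) u)" for u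
  proof -
    have "(\<Sum>k\<le>q. \<phi> k u) = (\<Sum>(k, \<gamma>)\<in>(SIGMA k:{..q}. exponents k). e k \<gamma> * monomial \<gamma> u)"
      unfolding e by (subst sum.Sigma) (auto simp: finite_exponents)
    also have "\<dots> = (\<Sum>\<alpha>\<in>exponents q. e (q - \<alpha> None) (\<alpha> \<circ> Some) * monomial (\<alpha> \<circ> Some) u)"
    proof (rule sum.reindex_bij_witness[where i = "\<lambda>\<alpha>. (q - \<alpha> None, \<alpha> \<circ> Some)"
          and j = "\<lambda>(k, \<gamma>). case_option (q - k) \<gamma>"], goal_cases)
      case (1 p)
      then show ?case by (auto simp: fun_eq_iff)
    next
      case (2 p)
      then show ?case by (auto simp: exponents_option) (auto simp: exponents_def)
    next
      case (3 \<alpha>)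
      have "\<alpha> None \<le> q" using 3 by (simp add: exponents_option)
      then show ?case by (auto simp: fun_eq_iff split: option.split)
    next
      case (4 \<alpha>)
      then show ?case by (auto simp: exponents_option) (auto simp: exponents_def)
    next
      case (5 p)
      then show ?case by (auto simp: comp_def)
    qed
    finally show ?thesis .
  qed
  then show ?thesis by (intro exI[of _ "\<lambda>\<alpha>. e (q - \<alpha> None) (\<alpha> \<circ> Some)"] allI)
qed

context parametrized_germ
begin

lemma dot_F_cdiff: "\<forall>\<^sub>F u in nhds 0. cdiff (\<lambda>u. dot l (F u)) u"
  using F_cdiff by eventually_elim (simp add: dot_def cdiff_intros)

lemma dot_F_0:
  assumes "big_oh UNIV (Suc q) (\<lambda>u. dot l (F u))"
  shows "dot l (F 0) = 0"
proof -
  have "((\<lambda>u. dot l (F u)) \<longlongrightarrow> dot l (F 0)) (at 0)"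
    using cdiff_imp_isCont[OF eventually_nhds_x_imp_x[OF dot_F_cdiff]] isCont_def by blast
  with big_oh_tendsto_0[OF assms] show ?thesis
    using tendsto_unique[of "at (0 :: complex ^ 'n)"] by auto
qed

text \<open>A curve germ on \<open>X\<close> lifts to the parameter domain with linear growth. A
  functional that vanishes to order \<open>q + 1\<close> in the parameter therefore does so along
  the curve, and its derivatives up to order \<open>q\<close> there are zero.\<close>

lemma dot_osculating_generators:
  assumes l: "big_oh UNIV (Suc q) (\<lambda>u. dot l (F u))"
    and v: "v \<in> insert (affine_coords i x) {curve_derivative i k \<gamma> | k \<gamma>. 1 \<le> k \<and> k \<le> q \<and> curve_germ_on i X x \<gamma>}"
  shows "dot l v = 0"
proof -
  have F0: "F 0 = affine_coords i x" by (simp add: F_def x_eq)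
  obtain C where C: "C > 0" "\<forall>\<^sub>F u in at 0. cmod (dot l (F u)) \<le> C * norm u ^ Suc q"
    using l by (rule big_ohE)
  have bound: "\<forall>\<^sub>F u in nhds 0. cmod (dot l (F u)) \<le> C * norm u ^ Suc q"
  proof -
    have "\<forall>\<^sub>F u in nhds 0. u \<noteq> 0 \<longrightarrow> cmod (dot l (F u)) \<le> C * norm u ^ Suc q"
      using C(2) by (simp add: eventually_at_filter)
    then show ?thesis by eventually_elim (use dot_F_0[OF l] in force)
  qed
  show ?thesis
  proof (cases "v = affine_coords i x")
    case True
    then show ?thesis using dot_F_0[OF l] F0 by simp
  next
    case False
    then obtain k \<gamma> where k: "k \<le> q" "curve_germ_on i X x \<gamma>" "v = curve_derivative i k \<gamma>" using v by auto
    then obtain r where \<gamma>: "\<gamma> 0 = x" "r > 0" "\<And>t. t \<in> ball 0 r \<Longrightarrow> \<gamma> t \<in> X \<inter> affine_chart i"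
      "\<And>j. (\<lambda>t. affine_coords i (\<gamma> t) $ j) holomorphic_on ball 0 r"
      unfolding curve_germ_on_def by blast
    define z where "z t = affine_coords i (\<gamma> t)" for t
    have z: "proj_point (z t) = \<gamma> t" "z t $ i = 1" if "t \<in> ball 0 r" for t
      unfolding z_def using \<gamma>(3)[OF that] by (auto intro: affine_coords)
    have inball: "\<forall>\<^sub>F t in nhds 0. t \<in> ball (0::complex) r"
      using \<gamma>(2) by (intro eventually_nhds_in_open) auto
    obtain c K where c: "\<forall>\<^sub>F t in nhds 0. z t \<noteq> 0 \<and> u0 + c t \<in> \<Omega> \<and> \<sigma> (u0 + c t) = proj_point (z t)"
      "\<forall>\<^sub>F t in nhds 0. norm (c t) \<le> K * norm t" "(c \<longlongrightarrow> 0) (nhds 0)"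
    proof (rule lift_curve[of z])
      show "(\<lambda>t. z t $ j) field_differentiable at 0" for j
        unfolding z_def using \<gamma>(2) by (intro holomorphic_on_imp_differentiable_at[OF \<gamma>(4)]) auto
      show "z 0 \<noteq> 0" using z(2)[of 0] \<gamma>(2) by auto
      show "proj_point (z 0) = x" using z(1)[of 0] \<gamma>(1,2) by simp
      show "\<forall>\<^sub>F t in nhds 0. proj_point (z t) \<in> X"
        using inball by eventually_elim (use z(1) \<gamma>(3) in simp)
    qed
    have "\<forall>\<^sub>F t in nhds 0. cmod (dot l (F (c t))) \<le> C * norm (c t) ^ Suc q"
      by (rule eventually_compose_filterlim[OF bound c(3)])
    then have "\<forall>\<^sub>F t in nhds 0. cmod (dot l (z t)) \<le> (C * K ^ Suc q) * norm t ^ Suc q"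
      using c(1,2) inball
    proof eventually_elim
      case (elim t)
      have "F (c t) = z t" using elim z by (simp add: F_def) (simp add: z_def)
      moreover have "norm (c t) ^ Suc q \<le> (K * norm t) ^ Suc q" using elim by (intro power_mono) auto
      then have "C * norm (c t) ^ Suc q \<le> C * (K * norm t) ^ Suc q" using C(1) by simp
      ultimately show ?case using elim(1) by (simp only: power_mult_distrib mult.assoc)
    qed
    then have "(deriv ^^ k) (\<lambda>t. dot l (z t)) 0 = 0"
    proof (rule higher_deriv_eq_0_of_bound[rotated 2])
      show "(\<lambda>t. dot l (z t)) holomorphic_on ball 0 r"
        unfolding dot_def z_def by (intro holomorphic_on_sum holomorphic_on_mult holomorphic_on_const \<gamma>(4))
    qed (use \<gamma>(2) k(1) in auto)
    moreover have "(deriv ^^ k) (\<lambda>t. dot l (z t)) 0 = dot l v"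
      unfolding dot_def k(3) curve_derivative_def z_def
      using higher_deriv_linear_combination[of UNIV "\<lambda>j t. affine_coords i (\<gamma> t) $ j" "ball 0 r" 0 k "($) l"]
        \<gamma>(2,4) by simp
    ultimately show ?thesis by simp
  qed
qed

text \<open>A functional that kills all \<open>w \<alpha>\<close> kills the generators of the
  osculating space, so by duality this space lies in the span of the \<open>w \<alpha>\<close>. Its
  linear dimension equals their number, which makes them independent. The lemma is applied to the
  Taylor coefficients of \<open>F\<close> and to the vectors of the Veronese map.\<close>

lemma independent_of_annihilator:
  fixes w :: "'a \<Rightarrow> complex ^ 'N option"
  assumes reg: "has_projective_dim (osculating_space i q X x) (m - 1)" and "m \<ge> 1"
    and I: "finite I" "card I = m"
    and ann: "\<And>l. (\<And>\<alpha>. \<alpha> \<in> I \<Longrightarrow> dot l (w \<alpha>) = 0) \<Longrightarrow> big_oh UNIV (Suc q) (\<lambda>u. dot l (F u))"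
  shows "inj_on w I" "vec.independent (w ` I)"
proof -
  let ?O = "insert (affine_coords i x) {curve_derivative i k \<gamma> | k \<gamma>. 1 \<le> k \<and> k \<le> q \<and> curve_germ_on i X x \<gamma>}"
  let ?L = "vec.span (insert (affine_coords i x) (osculating_direction i q X x))"
  obtain L where L: "vec.subspace L" "vec.dim L = m" "osculating_space i q X x = projective_subspace L"
    using reg \<open>m \<ge> 1\<close> by (auto simp: has_projective_dim_def)
  have "?L = L"
    by (rule projective_subspace_inject) (use L in \<open>auto simp: osculating_space_def\<close>)
  have O: "?O \<subseteq> vec.span (w ` I)"
  proof
    fix v assume v: "v \<in> ?O"
    show "v \<in> vec.span (w ` I)"
      by (rule in_span_of_dot, rule dot_osculating_generators[OF ann v]) auto
  qed
  then have "osculating_direction i q X x \<subseteq> vec.span (w ` I)"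
    unfolding osculating_direction_def by (intro vec.span_minimal) auto
  with O have "?L \<subseteq> vec.span (w ` I)"
    by (intro vec.span_minimal) auto
  then have "m \<le> vec.dim (w ` I)"
    using vec.dim_subset[of ?L "vec.span (w ` I)"] \<open>?L = L\<close> L(2) by simp
  moreover have "vec.dim (w ` I) \<le> card (w ` I)"
    by (rule vec.dim_le_card) (auto simp: I vec.span_superset)
  moreover have "card (w ` I) \<le> m" using card_image_le[OF I(1)] I(2) by simp
  ultimately have "card (w ` I) = m" "vec.dim (w ` I) = card (w ` I)" by simp_all
  then show "inj_on w I" "vec.independent (w ` I)"
    using I eq_card_imp_inj_on[of I w] vec.card_eq_dim[of "w ` I" "w ` I"] vec.span_superset[of "w ` I"] by simp_all
qed

text \<open>The Taylor coefficient vectors \<open>A \<alpha>\<close> of \<open>F\<close> up to order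
  \<open>q\<close> are independent by regularity. A functional can thus be prescribed on them, and
  its values there are the coefficients of its jet.\<close>

lemma jets_of_regularity:
  assumes reg: "has_projective_dim (osculating_space i q X x) (((CARD('n) + q) choose q) - 1)"
    and \<phi>: "\<And>k. \<phi> k \<in> forms k"
  shows "\<exists>l. big_oh UNIV (Suc q) (\<lambda>u. dot l (F u) - (\<Sum>k\<le>q. \<phi> k u))"
proof -
  have "\<exists>e. big_oh UNIV (Suc q) (\<lambda>u. F u $ j - (\<Sum>\<alpha>\<in>exponents q. e \<alpha> * monomial (\<alpha> \<circ> Some) u))" for j
  proof -
    have "\<forall>\<^sub>F u in nhds 0. cdiff (\<lambda>u. F u $ j) u" using F_cdiff by eventually_elim blast
    then have "\<forall>\<^sub>F u in at 0. cdiff (\<lambda>u. F u $ j) u" "big_oh UNIV 0 (\<lambda>u. F u $ j)"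
      using cdiff_imp_big_oh eventually_nhds_x_imp_x by (auto simp: eventually_at_filter eventually_mono)
    from taylor_at_puncture[OF this] obtain \<psi> where \<psi>: "\<And>k. \<psi> k \<in> forms k"
      "\<And>K. big_oh UNIV K (\<lambda>u. F u $ j - (\<Sum>k<K. \<psi> k u))" by blast
    obtain e where "\<forall>u. (\<Sum>k\<le>q. \<psi> k u) = (\<Sum>\<alpha>\<in>exponents q. e \<alpha> * monomial (\<alpha> \<circ> Some) u)"
      using sum_forms_eq_option_sum[OF \<psi>(1)] by blast
    then show ?thesis using \<psi>(2)[of "Suc q"] by (intro exI[of _ e]) (simp add: lessThan_Suc_atMost)
  qed
  then have "\<exists>e. \<forall>j. big_oh UNIV (Suc q) (\<lambda>u. F u $ j - (\<Sum>\<alpha>\<in>exponents q. e j \<alpha> * monomial (\<alpha> \<circ> Some) u))"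
    by (intro choice allI)
  then obtain e where e: "\<And>j. big_oh UNIV (Suc q) (\<lambda>u. F u $ j - (\<Sum>\<alpha>\<in>exponents q. e j \<alpha> * monomial (\<alpha> \<circ> Some) u))"
    by blast
  define A where "A \<alpha> = (\<chi> j. e j \<alpha>)" for \<alpha>
  have dotA: "big_oh UNIV (Suc q) (\<lambda>u. dot l (F u) - (\<Sum>\<alpha>\<in>exponents q. dot l (A \<alpha>) * monomial (\<alpha> \<circ> Some) u))" for l
  proof -
    have "big_oh UNIV (Suc q) (\<lambda>u. \<Sum>j\<in>UNIV. l $ j * (F u $ j - (\<Sum>\<alpha>\<in>exponents q. e j \<alpha> * monomial (\<alpha> \<circ> Some) u)))"
      by (intro big_oh_sum big_oh_cmult e)
    also have "(\<lambda>u. \<Sum>j\<in>UNIV. l $ j * (F u $ j - (\<Sum>\<alpha>\<in>exponents q. e j \<alpha> * monomial (\<alpha> \<circ> Some) u))) =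
        (\<lambda>u. dot l (F u) - (\<Sum>\<alpha>\<in>exponents q. dot l (A \<alpha>) * monomial (\<alpha> \<circ> Some) u))"
    proof
      fix u
      have "(\<Sum>j\<in>UNIV. \<Sum>\<alpha>\<in>exponents q. l $ j * (e j \<alpha> * monomial (\<alpha> \<circ> Some) u)) =
          (\<Sum>\<alpha>\<in>exponents q. \<Sum>j\<in>UNIV. l $ j * (e j \<alpha> * monomial (\<alpha> \<circ> Some) u))" by (rule sum.swap)
      then show "(\<Sum>j\<in>UNIV. l $ j * (F u $ j - (\<Sum>\<alpha>\<in>exponents q. e j \<alpha> * monomial (\<alpha> \<circ> Some) u))) =
          dot l (F u) - (\<Sum>\<alpha>\<in>exponents q. dot l (A \<alpha>) * monomial (\<alpha> \<circ> Some) u)"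
        by (simp add: dot_def A_def right_diff_distrib sum_subtractf sum_distrib_left sum_distrib_right mult.assoc)
    qed
    finally show ?thesis .
  qed
  have card: "card (exponents q :: ('n option \<Rightarrow> nat) set) = (CARD('n) + q) choose q"
    by (simp add: card_exponents add.commute)
  have ge1: "1 \<le> (CARD('n) + q) choose q" by (simp add: Suc_leI)
  have *: "big_oh UNIV (Suc q) (\<lambda>u. dot l (F u))" if "\<And>\<alpha>. \<alpha> \<in> exponents q \<Longrightarrow> dot l (A \<alpha>) = 0" for l
    using dotA[of l] that by simp
  have "inj_on A (exponents q)"
    by (rule independent_of_annihilator(1)[OF reg ge1 finite_exponents card *])
  have "vec.independent (A ` exponents q)"
    by (rule independent_of_annihilator(2)[OF reg ge1 finite_exponents card *])
  obtain d where d: "\<And>u. (\<Sum>k\<le>q. \<phi> k u) = (\<Sum>\<alpha>\<in>exponents q. d \<alpha> * monomial (\<alpha> \<circ> Some) u)"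
    using sum_forms_eq_option_sum[OF \<phi>] by blast
  obtain l where "\<forall>\<alpha>\<in>exponents q. dot l (A \<alpha>) = d \<alpha>"
    using ex_dot_extend_family[of A "exponents q" d] \<open>inj_on A (exponents q)\<close>
      \<open>vec.independent (A ` exponents q)\<close> by blast
  then show ?thesis using dotA[of l] d by (intro exI[of _ l]) simp
qed

section \<open>Rational normal curves through the base point\<close>

text \<open>Because the linear system is complete, every binary form of degree \<open>q\<close> is a
  linear functional on the curve. The projective line is parametrized as
  \<open>s0 + t *s s1\<close>, with \<open>t = 0\<close> over \<open>x\<close> and
  \<open>t = 1\<close> over the given point.\<close>

lemma polynomial_curve_of_rational_normal_curve:
  assumes q: "q \<ge> 1" and rnc: "rational_normal_curve q C" and sub: "germ_subset x C X"
    and xC: "x \<in> C" and yC: "\<sigma> (u0 + u) \<in> C"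
    and u: "u \<noteq> 0" "u0 + u \<in> \<Omega>" "\<sigma> (u0 + u) \<in> affine_chart i"
  shows "\<exists>P c \<kappa>. polynomial_curve F i q u P c \<kappa>"
proof -
  obtain m and \<phi> :: "nat \<Rightarrow> complex ^ 1 option \<Rightarrow> complex" and w :: "nat \<Rightarrow> complex ^ 'N option"
    where basis: "forms_basis q m \<phi>" and w: "inj_on w {..<m}" "vec.independent (w ` {..<m})"
      and C: "C = {proj_point (\<Sum>j<m. \<phi> j s *s w j) | s. s \<noteq> 0}"
    using rnc unfolding rational_normal_curve_def veronese_variety_def by blast
  define \<Phi> where "\<Phi> s = (\<Sum>j<m. \<phi> j s *s w j)" for s
  have \<phi>: "\<phi> j \<in> forms q" if "j < m" for j using basis that by (simp add: forms_basis_def)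
  have functional: "\<exists>l. \<forall>s. dot l (\<Phi> s) = f s" if f: "f \<in> forms q" for f
  proof -
    have "\<exists>!c. c \<in> {..<m} \<rightarrow>\<^sub>E UNIV \<and> f = (\<lambda>s. \<Sum>j<m. c j * \<phi> j s)"
      using basis f unfolding forms_basis_def by simp
    then obtain c where c: "f = (\<lambda>s. \<Sum>j<m. c j * \<phi> j s)" by (elim ex1E conjE)
    obtain l where "\<forall>j\<in>{..<m}. dot l (w j) = c j" using ex_dot_extend_family[OF w] by blast
    then show ?thesis by (intro exI[of _ l]) (simp add: \<Phi>_def dot_sum dot_scale c mult.commute)
  qed
  have linear_form: "(\<lambda>s. dot l s) \<in> forms 1" for l :: "complex ^ 1 option"
    unfolding dot_def by (rule linear_in_forms)
  have \<Phi>_nz: "\<Phi> s \<noteq> 0" if "s \<noteq> 0" for s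
  proof
    assume 0: "\<Phi> s = 0"
    obtain k where k: "s $ k \<noteq> 0" using \<open>s \<noteq> 0\<close> by (auto simp: vec_eq_iff)
    have "(\<lambda>s. (s $ k) ^ q) \<in> forms q" using forms_power[OF nth_in_forms[of k], of q] by simp
    then obtain l where "\<And>s. dot l (\<Phi> s) = (s $ k) ^ q" using functional by blast
    then show False using 0 k dot_zero by (metis power_not_zero)
  qed
  have \<Phi>_scale: "\<Phi> (z *s s) = z ^ q *s \<Phi> s" for z s
    unfolding \<Phi>_def vec.scale_sum_right
    by (intro sum.cong refl) (simp add: forms_scale[OF \<phi>] mult.commute)
  obtain s0 where s0: "s0 \<noteq> 0" "x = proj_point (\<Phi> s0)" using xC by (auto simp: C \<Phi>_def)
  obtain s2 where s2: "s2 \<noteq> 0" "\<sigma> (u0 + u) = proj_point (\<Phi> s2)" using yC by (auto simp: C \<Phi>_def)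
  define s1 where "s1 = s2 - s0"
  have "x \<noteq> \<sigma> (u0 + u)"
    using inj_onD[OF \<sigma>_inj, of u0 "u0 + u"] u0 u x_eq by auto
  have indep: "vec.independent {s0, s1}" "s0 \<noteq> s1"
  proof -
    have not_span: "s1 \<notin> vec.span {s0}"
    proof
      assume "s1 \<in> vec.span {s0}"
      then obtain z where "s1 = z *s s0" by (auto simp: vec.span_singleton)
      then have s2': "s2 = (z + 1) *s s0" by (simp add: s1_def algebra_simps)
      have "z + 1 \<noteq> 0"
      proof
        assume "z + 1 = 0"
        then have "s2 = 0 *s s0" using s2' by metis
        then show False using s2(1) by simp
      qed
      then have "proj_point (\<Phi> s2) = proj_point (\<Phi> s0)" unfolding s2' \<Phi>_scale by (intro proj_point_scale) simp
      then show False using s0(2) s2(2) \<open>x \<noteq> \<sigma> (u0 + u)\<close> by simp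
    qed
    then show "s0 \<noteq> s1" using vec.span_base by auto
    then show "vec.independent {s0, s1}"
      using not_span s0(1) by (simp add: insert_commute[of s0] vec.independent_insert)
  qed
  obtain la where la: "dot la s0 = 1" "dot la s1 = 0"
    using ex_dot_extend[OF indep(1), of "\<lambda>s. if s = s0 then 1 else 0"] indep(2) by auto
  obtain lb where lb: "dot lb s0 = 0" "dot lb s1 = 1"
    using ex_dot_extend[OF indep(1), of "\<lambda>s. if s = s0 then 0 else 1"] indep(2) by auto
  define z where "z t = \<Phi> (s0 + t *s s1)" for t
  have line_nz: "s0 + t *s s1 \<noteq> 0" for t
  proof
    assume "s0 + t *s s1 = 0"
    then have "dot la (s0 + t *s s1) = 0" by (simp add: dot_zero)
    then show False by (simp add: dot_add dot_scale la)
  qed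
  have z_nz: "z t \<noteq> 0" for t unfolding z_def by (rule \<Phi>_nz[OF line_nz])
  \<comment> \<open>On \<open>s0 + t *s s1\<close> the values of \<open>la\<close> and
    \<open>lb\<close> are 1 and \<open>t\<close>, so this form of degree \<open>q\<close> equals
    \<open>t\<close> there. It provides the immersion condition.\<close>
  have "(\<lambda>s. dot la s ^ (q - 1) * dot lb s) \<in> forms ((q - 1) * 1 + 1)"
    by (intro forms_mult forms_power linear_form)
  then obtain l0 where "\<And>s. dot l0 (\<Phi> s) = dot la s ^ (q - 1) * dot lb s"
    using functional q by auto
  then have l0: "dot l0 (z t) = t" for t by (simp add: z_def dot_add dot_scale la lb)
  have "\<exists>p. \<forall>k<m. degree (p k) \<le> q \<and> (\<forall>t. \<phi> k (s0 + t *s s1) = poly (p k) t)"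
  proof -
    have "\<forall>k. \<exists>r. k < m \<longrightarrow> degree r \<le> q \<and> (\<forall>t. \<phi> k (s0 + t *s s1) = poly r t)"
      using poly_of_forms_along_line[OF \<phi>, of _ s0 s1] by blast
    then have "\<exists>p. \<forall>k. k < m \<longrightarrow> degree (p k) \<le> q \<and> (\<forall>t. \<phi> k (s0 + t *s s1) = poly (p k) t)"
      by (rule choice)
    then show ?thesis by blast
  qed
  then obtain p where p: "\<And>k. k < m \<Longrightarrow> degree (p k) \<le> q" "\<And>k t. k < m \<Longrightarrow> \<phi> k (s0 + t *s s1) = poly (p k) t"
    by blast
  define Q where "Q j = (\<Sum>k<m. smult (w k $ j) (p k))" for j
  have Q: "poly (Q j) t = z t $ j" for j t
    by (simp add: Q_def poly_sum z_def \<Phi>_def p(2) mult.commute)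
  have degQ: "degree (Q j) \<le> q" for j
    unfolding Q_def by (intro degree_sum_le order_trans[OF degree_smult_le]) (use p in auto)
  have z0: "proj_point (z 0) = x" using s0(2) by (simp add: z_def)
  have z1: "proj_point (z 1) = \<sigma> (u0 + u)" using s2(2) by (simp add: z_def s1_def)
  define N where "N = z 0 $ i"
  have N: "N \<noteq> 0" using x_chart z0 z_nz proj_point_in_affine_chart[of "z 0" i] by (simp add: N_def)
  define P where "P j = smult (inverse N) (Q j)" for j
  obtain U where U: "open U" "x \<in> U" "C \<inter> U \<subseteq> X" using sub by (auto simp: germ_subset_def)
  have diff: "(\<lambda>t. z t $ j) field_differentiable at 0" for j
    unfolding Q[symmetric] using poly_DERIV field_differentiable_def by blast
  obtain c K where c: "\<forall>\<^sub>F t in nhds 0. z t \<noteq> 0 \<and> u0 + c t \<in> \<Omega> \<and> \<sigma> (u0 + c t) = proj_point (z t)"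
    "\<forall>\<^sub>F t in nhds 0. norm (c t) \<le> K * norm t" "(c \<longlongrightarrow> 0) (nhds 0)"
  proof (rule lift_curve[of z])
    have "(z \<longlongrightarrow> z 0) (nhds 0)"
    proof (rule vec_tendstoI)
      show "((\<lambda>t. z t $ j) \<longlongrightarrow> z 0 $ j) (nhds 0)" for j
        using field_differentiable_imp_continuous_at[OF diff[of j]]
          tendsto_at_iff_tendsto_nhds[of "\<lambda>t. z t $ j" 0] by (simp add: isCont_def)
    qed
    then have "\<forall>\<^sub>F t in nhds 0. z t \<noteq> 0 \<and> proj_point (z t) \<in> U"
      by (rule eventually_proj_point_in_open) (use z_nz U z0 in auto)
    then show "\<forall>\<^sub>F t in nhds 0. proj_point (z t) \<in> X"
    proof eventually_elim
      case (elim t)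
      have "proj_point (z t) \<in> C" unfolding C z_def \<Phi>_def using line_nz by blast
      then show ?case using elim U(3) by blast
    qed
  qed (use diff z_nz z0 in auto)
  have at: "\<forall>\<^sub>F t in nhds 0. R t \<Longrightarrow> \<forall>\<^sub>F t in at 0. R t" for R :: "complex \<Rightarrow> bool"
    by (simp add: eventually_at_filter eventually_mono)
  define \<kappa> where "\<kappa> = z 1 $ i / N"
  have z1i: "z 1 $ i \<noteq> 0" using u(3) z1 z_nz proj_point_in_affine_chart[of "z 1" i] by simp
  have "polynomial_curve F i q u P c \<kappa>"
    unfolding polynomial_curve_def
  proof (intro conjI allI)
    show "degree (P j) \<le> q" for j unfolding P_def by (rule order_trans[OF degree_smult_le degQ])
    show "poly (P i) 0 = 1" using N by (simp add: P_def Q N_def)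
    show "\<kappa> \<noteq> 0" using N z1i by (simp add: \<kappa>_def)
    show "poly (P j) 1 = \<kappa> * F u $ j" for j
    proof -
      have "F u = inverse (z 1 $ i) *s z 1"
        unfolding F_def z1[symmetric] by (rule affine_coords_proj_point[OF z1i])
      then show ?thesis using z1i by (simp add: P_def Q \<kappa>_def divide_inverse)
    qed
    show "\<forall>\<^sub>F t in at 0. \<forall>j. poly (P j) t = poly (P i) t * F (c t) $ j"
    proof -
      have "((\<lambda>t. z t $ i) \<longlongrightarrow> z 0 $ i) (nhds 0)"
        using field_differentiable_imp_continuous_at[OF diff[of i]]
          tendsto_at_iff_tendsto_nhds[of "\<lambda>t. z t $ i" 0] by (simp add: isCont_def)
      then have "\<forall>\<^sub>F t in nhds 0. z t $ i \<noteq> 0"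
        using N unfolding N_def by (rule tendsto_imp_eventually_ne)
      from at[OF c(1)] at[OF this] show ?thesis
      proof eventually_elim
        case (elim t)
        have "F (c t) = inverse (z t $ i) *s z t"
          unfolding F_def using elim affine_coords_proj_point[of "z t" i] by simp
        then show ?case using elim(2) by (simp add: P_def Q)
      qed
    qed
    show "\<exists>K. \<forall>\<^sub>F t in at 0. norm (c t) \<le> K * norm t" using at[OF c(2)] by blast
    show "\<forall>\<^sub>F t in at 0. c t \<noteq> 0"
      using at[OF c(1)] eventually_nonzero_at_0
    proof eventually_elim
      case (elim t)
      show ?case
      proof
        assume "c t = 0"
        then have "proj_point (z t) = proj_point (z 0)" using elim(1) z0 x_eq by simp
        from this z_nz z_nz obtain a where "a \<noteq> 0" "z t = a *s z 0" by (rule proj_point_eqD)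
        \<comment> \<open>The functional \<open>l0\<close> separates \<open>z t\<close> from the
          multiples of \<open>z 0\<close>, since its values are \<open>t\<close> and 0.\<close>
        then have "t = a * dot l0 (z 0)" using l0[of t] by (simp add: dot_scale)
        then show False using elim(2) l0[of 0] by simp
      qed
    qed
    show "\<exists>l. \<forall>t. poly (comb l P) t = t"
    proof (intro exI allI)
      fix t
      have "(\<chi> j. poly (P j) t) = inverse N *s z t" by (simp add: vec_eq_iff P_def Q)
      then show "poly (comb (N *s l0) P) t = t"
        using N l0[of t] by (simp add: poly_comb dot_scale dot_scale_left)
    qed
  qed
  then show ?thesis by blast
qed

end

section \<open>The Veronese variety\<close>

lemma forms_basis_monomials:
  assumes e: "bij_betw e {..<m} (exponents q :: ('k::finite \<Rightarrow> nat) set)"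
  shows "forms_basis q m (\<lambda>j. monomial (e j))"
  unfolding forms_basis_def
proof (intro conjI allI impI ballI)
  fix j assume "j < m"
  then show "monomial (e j) \<in> forms q" using e by (auto simp: bij_betw_def intro: monomial_in_forms)
next
  fix f :: "complex ^ 'k \<Rightarrow> complex" assume "f \<in> forms q"
  then obtain c where c: "f = (\<lambda>s. \<Sum>\<alpha>\<in>exponents q. c \<alpha> * monomial \<alpha> s)" by (auto simp: forms_iff)
  have sum: "(\<Sum>\<alpha>\<in>exponents q. d \<alpha> * monomial \<alpha> s) = (\<Sum>j<m. d (e j) * monomial (e j) s)" for d s
    by (rule sum.reindex_bij_betw[OF e, symmetric])
  define d where "d = restrict (\<lambda>j. c (e j)) {..<m}"
  show "\<exists>!c. c \<in> {..<m} \<rightarrow>\<^sub>E UNIV \<and> f = (\<lambda>s. \<Sum>j<m. c j * monomial (e j) s)"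
  proof (rule ex1I[of _ d])
    show "d \<in> {..<m} \<rightarrow>\<^sub>E UNIV \<and> f = (\<lambda>s. \<Sum>j<m. d j * monomial (e j) s)"
      unfolding c sum by (simp add: d_def)
  next
    fix d' assume d': "d' \<in> {..<m} \<rightarrow>\<^sub>E UNIV \<and> f = (\<lambda>s. \<Sum>j<m. d' j * monomial (e j) s)"
    define inv where "inv = inv_into {..<m} e"
    have inv: "inv (e j) = j" if "j < m" for j
      using that e by (simp add: inv_def bij_betw_def inv_into_f_f)
    have "(\<Sum>\<alpha>\<in>exponents q. (c \<alpha> - d' (inv \<alpha>)) * monomial \<alpha> s) = 0" for s
    proof -
      have "(\<Sum>\<alpha>\<in>exponents q. d' (inv \<alpha>) * monomial \<alpha> s) = f s"
        unfolding sum using d' inv by (auto intro!: sum.cong)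
      then show ?thesis by (simp add: c left_diff_distrib sum_subtractf)
    qed
    then have "c \<alpha> - d' (inv \<alpha>) = 0" if "\<alpha> \<in> exponents q" for \<alpha>
      using that by (rule monomial_coeffs_unique)
    then have "c (e j) = d' j" if "j < m" for j
      using that e inv by (metis bij_betwE eq_iff_diff_eq_0 lessThan_iff)
    then show "d' = d"
      using d' by (auto simp: d_def fun_eq_iff PiE_def extensional_def restrict_def)
  qed
qed

lemma veronese_variety_of_monomials:
  fixes w :: "('n::finite option \<Rightarrow> nat) \<Rightarrow> complex ^ 'N::finite option"
  assumes "inj_on w (exponents q)" "vec.independent (w ` exponents q)"
  shows "veronese_variety TYPE('n) q {proj_point (\<Sum>\<alpha>\<in>exponents q. monomial \<alpha> s *s w \<alpha>) | s. s \<noteq> 0}"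
proof -
  obtain e and m :: nat where e: "bij_betw e {..<m} (exponents q :: ('n option \<Rightarrow> nat) set)"
    using ex_bij_betw_nat_finite[OF finite_exponents] by (metis atLeast0LessThan)
  have im: "w ` exponents q = (w \<circ> e) ` {..<m}"
    unfolding image_comp[symmetric] bij_betw_imp_surj_on[OF e] by (rule refl)
  have "inj_on (w \<circ> e) {..<m}"
    using e assms(1) by (auto simp: bij_betw_def intro: comp_inj_on)
  moreover have "(\<Sum>\<alpha>\<in>exponents q. monomial \<alpha> s *s w \<alpha>) = (\<Sum>j<m. monomial (e j) s *s (w \<circ> e) j)" for s
    using sum.reindex_bij_betw[OF e, of "\<lambda>\<alpha>. monomial \<alpha> s *s w \<alpha>"] by simp
  ultimately show ?thesis
    unfolding veronese_variety_def using forms_basis_monomials[OF e] assms(2) im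
    by (intro exI[of _ m] exI[of _ "\<lambda>j. monomial (e j)"] exI[of _ "w \<circ> e"]) simp
qed

context parametrized_germ
begin

lemma eventually_in_closure_of_generic:
  assumes "nowhere_dense_in X Z"
  shows "\<forall>\<^sub>F u in nhds 0. u \<in> closure {u. u0 + u \<in> \<Omega> \<and> \<sigma> (u0 + u) \<notin> Z}"
proof -
  obtain \<tau> where \<tau>: "homeomorphism \<Omega> (\<sigma> ` \<Omega>) \<sigma> \<tau>" using ex_inverse by blast
  have "u \<in> closure {u. u0 + u \<in> \<Omega> \<and> \<sigma> (u0 + u) \<notin> Z}" if "u0 + u \<in> \<Omega>" for u
    unfolding closure_iff_nhds_not_empty
  proof (intro allI impI)
    fix A S :: "(complex ^ 'n) set" assume S: "S \<subseteq> A" "open S" "u \<in> S"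
    define W where "W = \<Omega> \<inter> (\<lambda>v. v - u0) -` S"
    have "open W" unfolding W_def using S(2) open_\<Omega>
      by (intro open_Int open_vimage continuous_intros)
    then have "openin (top_of_set \<Omega>) W" by (simp add: openin_open_eq[OF open_\<Omega>]) (simp add: W_def)
    then have "openin (top_of_set (\<sigma> ` \<Omega>)) (\<sigma> ` W)" by (rule homeomorphism_imp_open_map[OF \<tau>])
    then have op: "openin (top_of_set X) (\<sigma> ` W)" using openin_image by (rule openin_trans)
    have "\<sigma> (u0 + u) \<in> \<sigma> ` W" using that S(3) by (auto simp: W_def)
    moreover have "\<not> \<sigma> ` W \<subseteq> top_of_set X closure_of Z"
    proof
      assume "\<sigma> ` W \<subseteq> top_of_set X closure_of Z"
      then have "\<sigma> ` W \<subseteq> top_of_set X interior_of (top_of_set X closure_of Z)"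
        using op by (rule interior_of_maximal)
      then show False using assms \<open>\<sigma> (u0 + u) \<in> \<sigma> ` W\<close> by (auto simp: nowhere_dense_in_def)
    qed
    then obtain v where v: "v \<in> W" "\<sigma> v \<notin> top_of_set X closure_of Z" by blast
    have "\<sigma> v \<notin> Z"
    proof
      assume "\<sigma> v \<in> Z"
      moreover have "\<sigma> v \<in> X" using v(1) openin_imp_subset[OF openin_image] by (auto simp: W_def)
      ultimately show False using v(2) closure_of_subset_Int[of "top_of_set X" Z] by auto
    qed
    then have "v - u0 \<in> {u. u0 + u \<in> \<Omega> \<and> \<sigma> (u0 + u) \<notin> Z}" "v - u0 \<in> A"
      using v(1) S(1) by (auto simp: W_def)
    then show "{u. u0 + u \<in> \<Omega> \<and> \<sigma> (u0 + u) \<notin> Z} \<inter> A \<noteq> {}" by blast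
  qed
  then show ?thesis using eventually_chart by (auto elim: eventually_mono)
qed

text \<open>On a ball the affine parameter is a continuous injective map between spaces of the same
  dimension, so its image is open by invariance of domain. Hence the germ fills a neighbourhood of
  \<open>x\<close> in the Veronese variety.\<close>

lemma germ_eq_veronese:
  fixes w :: "('n option \<Rightarrow> nat) \<Rightarrow> complex ^ 'N option" and q :: nat
  defines "\<Psi> \<equiv> \<lambda>s. \<Sum>\<alpha>\<in>exponents q. monomial \<alpha> s *s w \<alpha>"
  assumes q: "q \<ge> 1"
    and w: "inj_on w (exponents q)" "vec.independent (w ` exponents q)"
    and F: "\<forall>\<^sub>F u in at 0. F u = \<mu> u *s \<Psi> (homog 1 (v u))"
    and v: "\<forall>\<^sub>F u in at 0. isCont v u" "(v \<longlongrightarrow> 0) (at 0)" and \<mu>: "(\<mu> \<longlongrightarrow> 1) (at 0)"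
  shows "germ_eq x X {proj_point (\<Psi> s) | s. s \<noteq> 0}"
proof -
  \<comment> \<open>The origin is filled in with the limit of \<open>v\<close>, whose value there is
    arbitrary.\<close>
  define v' where "v' u = (if u = 0 then 0 else v u)" for u
  have coord: "\<exists>l. \<forall>s. dot l (\<Psi> s) = monomial \<alpha> s" if "\<alpha> \<in> exponents q" for \<alpha>
  proof -
    obtain l where l: "\<forall>\<beta>\<in>exponents q. dot l (w \<beta>) = (if \<beta> = \<alpha> then 1 else 0)"
      using ex_dot_extend_family[OF w, of "\<lambda>\<beta>. if \<beta> = \<alpha> then 1 else 0"] by blast
    have "dot l (\<Psi> s) = (\<Sum>\<beta>\<in>exponents q. if \<beta> = \<alpha> then monomial \<beta> s else 0)" for s
      unfolding \<Psi>_def dot_sum dot_scale using l by (intro sum.cong) auto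
    then show ?thesis using that by (intro exI[of _ l]) (simp add: finite_exponents)
  qed
  \<comment> \<open>The quotients of \<open>l1 j\<close> by \<open>l0\<close> recover the affine
    coordinates \<open>s $ Some j / s $ None\<close> from the vector
    \<open>\<Psi> s\<close>.\<close>
  obtain l0 where l0: "\<And>s. dot l0 (\<Psi> s) = (s $ None) ^ q"
    using coord[OF exponent0_in_exponents] by (auto simp: monomial_exponent0)
  have "\<forall>j. \<exists>l. \<forall>s. dot l (\<Psi> s) = (s $ None) ^ (q - 1) * s $ Some j"
    using coord[OF exponent1_in_exponents[OF q]] by (simp add: monomial_exponent1)
  then have "\<exists>l. \<forall>j. \<forall>s. dot (l j) (\<Psi> s) = (s $ None) ^ (q - 1) * s $ Some j" by (rule choice)
  then obtain l1 where l1: "\<And>j s. dot (l1 j) (\<Psi> s) = (s $ None) ^ (q - 1) * s $ Some j" by blast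
  have \<Psi>_scale: "\<Psi> (z *s s) = z ^ q *s \<Psi> s" for z s
    unfolding \<Psi>_def vec.scale_sum_right
    by (intro sum.cong refl) (simp add: monomial_scale_exponents mult.commute)
  have homog_nz: "homog 1 y \<noteq> 0" for y :: "complex ^ 'n"
    by (auto simp: homog_def vec_eq_iff intro!: exI[of _ None])
  have \<Psi>_nz: "\<Psi> s \<noteq> 0" if nz: "s \<noteq> 0" for s
  proof
    assume 0: "\<Psi> s = 0"
    obtain k where k: "s $ k \<noteq> 0" using nz by (auto simp: vec_eq_iff)
    have "(\<lambda>j. if j = k then q else 0) \<in> exponents q" by (simp add: exponents_def)
    from coord[OF this] obtain l where "dot l (\<Psi> s) = monomial (\<lambda>j. if j = k then q else 0) s" by blast
    moreover have "monomial (\<lambda>j. if j = k then q else 0) s = (s $ k) ^ q"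
      by (simp add: monomial_def if_distrib[of "\<lambda>m. _ ^ m"] cong: if_cong)
    ultimately show False using 0 k dot_zero[of l] by simp
  qed
  have \<Psi>1_nz: "\<Psi> (homog 1 y) \<noteq> 0" for y by (rule \<Psi>_nz[OF homog_nz])
  have F0: "F 0 = \<Psi> (homog 1 0)"
  proof (rule vec_eq_iff[THEN iffD2], rule allI)
    fix j
    have "((\<lambda>u. F u $ j) \<longlongrightarrow> F 0 $ j) (at 0)"
      using cdiff_imp_isCont[OF spec[OF eventually_nhds_x_imp_x[OF F_cdiff], of j]] isCont_def by blast
    moreover have "((\<lambda>u. \<mu> u * (\<Sum>\<alpha>\<in>exponents q. monomial \<alpha> (homog 1 (v u)) * w \<alpha> $ j)) \<longlongrightarrow>
        1 * (\<Sum>\<alpha>\<in>exponents q. monomial \<alpha> (homog 1 0) * w \<alpha> $ j)) (at 0)"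
    proof (intro tendsto_mult \<mu> tendsto_sum tendsto_const)
      have v0: "((\<lambda>u. v u $ k) \<longlongrightarrow> 0 $ k) (at 0)" for k
        by (rule tendsto_vec_nth[OF v(2)])
      show "((\<lambda>u. monomial \<alpha> (homog 1 (v u))) \<longlongrightarrow> monomial \<alpha> (homog 1 0)) (at 0)" for \<alpha>
        unfolding monomial_homog_prod by (intro tendsto_mult tendsto_const tendsto_prod tendsto_power v0)
    qed
    moreover have "\<forall>\<^sub>F u in at 0. \<mu> u * (\<Sum>\<alpha>\<in>exponents q. monomial \<alpha> (homog 1 (v u)) * w \<alpha> $ j) = F u $ j"
      using F by eventually_elim (simp add: \<Psi>_def)
    ultimately have "((\<lambda>u. F u $ j) \<longlongrightarrow> F 0 $ j) (at 0)"
      "((\<lambda>u. F u $ j) \<longlongrightarrow> 1 * (\<Sum>\<alpha>\<in>exponents q. monomial \<alpha> (homog 1 0) * w \<alpha> $ j)) (at 0)"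
      by (blast intro: Lim_transform_eventually)+
    moreover have "\<Psi> (homog 1 0) $ j = 1 * (\<Sum>\<alpha>\<in>exponents q. monomial \<alpha> (homog 1 0) * w \<alpha> $ j)"
      by (simp add: \<Psi>_def)
    ultimately show "F 0 $ j = \<Psi> (homog 1 0) $ j"
      using tendsto_unique[of "at (0 :: complex ^ 'n)"] by auto
  qed
  have "\<forall>\<^sub>F u in at 0. \<mu> u \<noteq> 0" using \<mu> by (rule tendsto_imp_eventually_ne) simp
  with F v(1) have "\<forall>\<^sub>F u in at 0. isCont v u \<and> proj_point (F u) = proj_point (\<Psi> (homog 1 (v u)))"
    by eventually_elim (simp add: proj_point_scale)
  then have "\<forall>\<^sub>F u in nhds 0. u \<noteq> 0 \<longrightarrow> isCont v u \<and> proj_point (F u) = proj_point (\<Psi> (homog 1 (v u)))"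
    by (simp add: eventually_at_filter)
  with eventually_chart
  have "\<forall>\<^sub>F u in nhds 0. u0 + u \<in> \<Omega> \<and> \<sigma> (u0 + u) = proj_point (\<Psi> (homog 1 (v' u))) \<and> (u \<noteq> 0 \<longrightarrow> isCont v u)"
  proof eventually_elim
    case (elim u)
    then show ?case using F_props(1)[of u] F0 by (cases "u = 0") (auto simp: v'_def)
  qed
  then obtain d where d: "d > 0" "\<And>u. u \<in> ball 0 d \<Longrightarrow> u0 + u \<in> \<Omega>"
    "\<And>u. u \<in> ball 0 d \<Longrightarrow> \<sigma> (u0 + u) = proj_point (\<Psi> (homog 1 (v' u)))"
    "\<And>u. u \<in> ball 0 d \<Longrightarrow> u \<noteq> 0 \<Longrightarrow> isCont v u"
    by (auto simp: eventually_nhds_metric)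
  have cont: "isCont v' u" if "u \<in> ball 0 d" for u
  proof (cases "u = 0")
    case True
    have "(v' \<longlongrightarrow> 0) (at 0)"
      using v(2) by (rule Lim_transform_eventually) (simp add: eventually_at_filter v'_def)
    then show ?thesis unfolding isCont_def True by (simp add: v'_def)
  next
    case False
    have "\<forall>\<^sub>F y in nhds u. y \<in> - {0}"
      by (rule eventually_nhds_in_open) (use False in \<open>simp_all add: open_Compl\<close>)
    then have "\<forall>\<^sub>F y in nhds u. v' y = v y"
      by eventually_elim (simp add: v'_def)
    then show ?thesis using d(4)[OF that False] isCont_cong by blast
  qed
  \<comment> \<open>On the ball the parametrization factors through \<open>v'\<close>, which
    inherits injectivity from \<open>\<sigma>\<close>.\<close>
  have inj: "inj_on v' (ball 0 d)"
  proof (rule inj_onI)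
    fix y z assume yz: "y \<in> ball 0 d" "z \<in> ball 0 d" "v' y = v' z"
    then have "\<sigma> (u0 + y) = \<sigma> (u0 + z)" using d(3) by simp
    then show "y = z" using inj_onD[OF \<sigma>_inj] d(2) yz by fastforce
  qed
  let ?W = "v' ` ball 0 d"
  have openW: "open ?W"
    by (rule invariance_of_domain) (use cont inj in \<open>auto intro: continuous_at_imp_continuous_on\<close>)
  let ?V = "{proj_point (\<Psi> s) | s. s \<noteq> 0}"
  let ?S = "\<sigma> ` ((\<lambda>u. u0 + u) ` ball 0 d)"
  obtain \<tau> where \<tau>: "homeomorphism \<Omega> (\<sigma> ` \<Omega>) \<sigma> \<tau>" using ex_inverse by blast
  have "open ((\<lambda>u. u0 + u) ` ball 0 d)" by (rule open_translation) simp
  moreover have "(\<lambda>u. u0 + u) ` ball 0 d \<subseteq> \<Omega>" using d(2) by blast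
  ultimately have "openin (top_of_set \<Omega>) ((\<lambda>u. u0 + u) ` ball 0 d)"
    unfolding openin_open_eq[OF open_\<Omega>] by (rule conjI)
  then have "openin (top_of_set (\<sigma> ` \<Omega>)) ?S" by (rule homeomorphism_imp_open_map[OF \<tau>])
  then have "openin (top_of_set X) ?S" using openin_image by (rule openin_trans)
  then obtain U1 where U1: "open U1" "?S = X \<inter> U1" by (auto simp: openin_open)
  \<comment> \<open>A set of ambient points, shown to be open, that meets the Veronese variety
    exactly in the points with affine coordinates in the image of \<open>v'\<close>.\<close>
  define U2 where "U2 = {proj_point z | z. dot l0 z \<noteq> 0 \<and> (\<chi> j. dot (l1 j) z / dot l0 z) \<in> ?W}"
  have U2_iff: "proj_point z \<in> U2 \<longleftrightarrow> dot l0 z \<noteq> 0 \<and> (\<chi> j. dot (l1 j) z / dot l0 z) \<in> ?W" if z: "z \<noteq> 0" for z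
  proof
    assume "proj_point z \<in> U2"
    then obtain y where y: "proj_point z = proj_point y" "dot l0 y \<noteq> 0" "(\<chi> j. dot (l1 j) y / dot l0 y) \<in> ?W"
      by (auto simp: U2_def)
    then have "y \<noteq> 0" using dot_zero by metis
    from y(1) z \<open>y \<noteq> 0\<close> obtain a where "a \<noteq> 0" "z = a *s y" by (rule proj_point_eqD)
    then show "dot l0 z \<noteq> 0 \<and> (\<chi> j. dot (l1 j) z / dot l0 z) \<in> ?W" using y by (simp add: dot_scale)
  qed (auto simp: U2_def)
  have "open U2"
    unfolding open_proj_def
  proof -
    have "{z. z \<noteq> 0 \<and> proj_point z \<in> U2} = {z. dot l0 z \<noteq> 0} \<inter> (\<lambda>z. \<chi> j. dot (l1 j) z / dot l0 z) -` ?W"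
    proof (rule set_eqI)
      fix z show "z \<in> {z. z \<noteq> 0 \<and> proj_point z \<in> U2} \<longleftrightarrow>
          z \<in> {z. dot l0 z \<noteq> 0} \<inter> (\<lambda>z. \<chi> j. dot (l1 j) z / dot l0 z) -` ?W"
        using U2_iff[of z] dot_zero[of l0] by (cases "z = 0") auto
    qed
    moreover have "open ({z. dot l0 z \<noteq> 0} \<inter> (\<lambda>z. \<chi> j. dot (l1 j) z / dot l0 z) -` ?W)"
    proof (rule continuous_open_preimage[OF _ _ openW])
      show "open {z. dot l0 z \<noteq> 0}" unfolding dot_def by (intro open_Collect_neq continuous_intros)
      show "continuous_on {z. dot l0 z \<noteq> 0} (\<lambda>z. \<chi> j. dot (l1 j) z / dot l0 z)"
        by (rule continuous_on_vec_lambda) (auto simp: dot_def intro!: continuous_intros)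
    qed
    ultimately show "open {z. z \<noteq> 0 \<and> proj_point z \<in> U2}" by simp
  qed
  have ratio: "dot l0 (\<Psi> s) = (s $ None) ^ q"
      "dot l0 (\<Psi> s) \<noteq> 0 \<Longrightarrow> (\<chi> j. dot (l1 j) (\<Psi> s) / dot l0 (\<Psi> s)) = (\<chi> j. s $ Some j / s $ None)" for s
  proof -
    show "dot l0 (\<Psi> s) = (s $ None) ^ q" by (rule l0)
    assume "dot l0 (\<Psi> s) \<noteq> 0"
    moreover have "(s $ None) ^ q = s $ None * (s $ None) ^ (q - 1)" using q by (cases q) simp_all
    ultimately show "(\<chi> j. dot (l1 j) (\<Psi> s) / dot l0 (\<Psi> s)) = (\<chi> j. s $ Some j / s $ None)"
      by (simp add: l0 l1 vec_eq_iff)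
  qed
  have VU2: "?V \<inter> U2 = ?S"
  proof (intro equalityI subsetI)
    fix p assume p: "p \<in> ?V \<inter> U2"
    then obtain s where s: "p = proj_point (\<Psi> s)" "s \<noteq> 0" by blast
    have nz: "dot l0 (\<Psi> s) \<noteq> 0" "(\<chi> j. s $ Some j / s $ None) \<in> ?W"
      using p s U2_iff[OF \<Psi>_nz[OF s(2)]] ratio(2)[of s] by auto
    then obtain u where u: "u \<in> ball 0 d" "(\<chi> j. s $ Some j / s $ None) = v' u" by blast
    have "s $ None \<noteq> 0" using nz(1) q by (auto simp: l0 power_0_left)
    then have "s = s $ None *s homog 1 (v' u)"
      unfolding u(2)[symmetric] by (auto simp: vec_eq_iff homog_def split: option.split)
    then have "\<Psi> s = (s $ None) ^ q *s \<Psi> (homog 1 (v' u))" using \<Psi>_scale by metis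
    then have "p = \<sigma> (u0 + u)" unfolding s(1) d(3)[OF u(1)] using \<open>s $ None \<noteq> 0\<close> by (simp add: proj_point_scale)
    then show "p \<in> ?S" using u(1) by blast
  next
    fix p assume "p \<in> ?S"
    then obtain u where u: "u \<in> ball 0 d" "p = \<sigma> (u0 + u)" by blast
    then have p: "p = proj_point (\<Psi> (homog 1 (v' u)))" using d(3) by simp
    have "dot l0 (\<Psi> (homog 1 (v' u))) \<noteq> 0" by (simp add: l0 homog_def)
    moreover have "(\<chi> j. homog 1 (v' u) $ Some j / homog 1 (v' u) $ None) = v' u"
      by (simp add: homog_def vec_eq_iff)
    ultimately have "p \<in> U2" unfolding p U2_iff[OF \<Psi>1_nz] using ratio(2) u(1) by simp
    then show "p \<in> ?V \<inter> U2" using p homog_nz by blast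
  qed
  have x: "x \<in> ?S" using d(1) x_eq by (auto intro!: image_eqI[of _ _ "u0"] image_eqI[of _ _ "0"])
  show ?thesis
    unfolding germ_eq_def
  proof (intro exI[of _ "U1 \<inter> U2"] conjI)
    show "open (U1 \<inter> U2)" using U1(1) \<open>open U2\<close> by (rule open_Int)
    show "x \<in> U1 \<inter> U2" using x U1(2) VU2 by blast
    show "X \<inter> (U1 \<inter> U2) = ?V \<inter> (U1 \<inter> U2)" using U1(2) VU2 by blast
  qed
qed

end

theorem mainTheorem2:
  fixes X :: "'N::finite proj set" and x :: "'N proj" and q :: nat
  assumes "q \<ge> 1"
    and "complex_submanifold TYPE('n::finite) X" and "connected X" and "x \<in> X"
    and "q_regular CARD('n) q X x"
    and "generically TYPE('n) X
           (\<lambda>y. \<exists>C. rational_normal_curve q C \<and> germ_subset x C X \<and> x \<in> C \<and> y \<in> C)"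
  shows "\<exists>V. veronese_variety TYPE('n) q V \<and> germ_eq x X V"
proof -
  obtain \<Omega> :: "(complex ^ 'n) set" and \<sigma> where par: "local_parametrization X \<Omega> \<sigma>" "x \<in> \<sigma> ` \<Omega>"
    using assms(2,4) by (auto simp: complex_submanifold_def)
  then obtain u0 where u0: "u0 \<in> \<Omega>" "x = \<sigma> u0" by blast
  obtain i where i: "x \<in> affine_chart i"
    and dim: "has_projective_dim (osculating_space i q X x) (((CARD('n) + q) choose q) - 1)"
    using assms(5) by (auto simp: q_regular_def)
  interpret parametrized_germ X \<Omega> \<sigma> u0 x i
    by unfold_locales (use par u0 i in auto)
  obtain Z where Z: "nowhere_dense_in X Z"
    "\<And>y. y \<in> X - Z \<Longrightarrow> \<exists>C. rational_normal_curve q C \<and> germ_subset x C X \<and> x \<in> C \<and> y \<in> C"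
    using assms(6) by (auto simp: generically_def)
  define G where "G = {u. u0 + u \<in> \<Omega> \<and> \<sigma> (u0 + u) \<notin> Z}"
  interpret curve_family F G q i
  proof
    show "1 \<le> q" by (rule assms(1))
    show "\<forall>\<^sub>F u in nhds 0. \<forall>j. cdiff (\<lambda>u. F u $ j) u" by (rule F_cdiff)
    show "\<forall>\<^sub>F u in at 0. u \<in> closure G"
      using eventually_in_closure_of_generic[OF Z(1)] by (simp add: G_def eventually_at_filter eventually_mono)
    show "\<exists>l. big_oh UNIV (Suc q) (\<lambda>u. dot l (F u) - (\<Sum>k\<le>q. \<phi> k u))"
      if "\<And>k. \<phi> k \<in> forms k" for \<phi>
      using dim that by (rule jets_of_regularity)
    have "\<forall>\<^sub>F u in at 0. u0 + u \<in> \<Omega> \<and> \<sigma> (u0 + u) \<in> affine_chart i"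
      using eventually_chart by (simp add: eventually_at_filter eventually_mono)
    then show "\<forall>\<^sub>F u in at 0. u \<in> G \<longrightarrow> (\<exists>P c \<kappa>. polynomial_curve F i q u P c \<kappa>)"
      using eventually_nonzero_at_0
    proof eventually_elim
      case (elim u)
      show ?case
      proof
        assume "u \<in> G"
        then have "\<sigma> (u0 + u) \<in> X - Z"
          using openin_imp_subset[OF openin_image] by (auto simp: G_def)
        from Z(2)[OF this] obtain C where "rational_normal_curve q C" "germ_subset x C X" "x \<in> C" "\<sigma> (u0 + u) \<in> C"
          by blast
        then show "\<exists>P c \<kappa>. polynomial_curve F i q u P c \<kappa>"
          using elim assms(1) by (intro polynomial_curve_of_rational_normal_curve) auto
      qed
    qed
  qed
  obtain w v \<mu> where *: "\<forall>\<^sub>F u in at 0. F u = \<mu> u *s (\<Sum>\<alpha>\<in>exponents q. monomial \<alpha> (homog 1 (v u)) *s w \<alpha>)"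
    "\<forall>\<^sub>F u in at 0. isCont v u" "(v \<longlongrightarrow> (0 :: complex ^ 'n)) (at 0)" "(\<mu> \<longlongrightarrow> 1) (at 0)"
    using ex_veronese_parametrization by blast
  \<comment> \<open>Near the base point \<open>F\<close> lies in the span of the vectors
    \<open>w \<alpha>\<close>, so a functional killing them vanishes on \<open>F\<close>. Regularity
    then makes these vectors independent, as a Veronese variety requires.\<close>
  have ann: "big_oh UNIV (Suc q) (\<lambda>u. dot l (F u))" if l: "\<And>\<alpha>. \<alpha> \<in> exponents q \<Longrightarrow> dot l (w \<alpha>) = 0" for l
  proof (rule big_oh_cong[OF big_oh_zero])
    show "\<forall>\<^sub>F u in at 0. dot l (F u) = 0"
      using *(1) by eventually_elim (simp add: dot_scale dot_sum l)
  qed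
  have card: "card (exponents q :: ('n option \<Rightarrow> nat) set) = (CARD('n) + q) choose q"
    by (simp add: card_exponents add.commute)
  have ge1: "1 \<le> (CARD('n) + q) choose q" by (simp add: Suc_leI)
  note w = independent_of_annihilator[OF dim ge1 finite_exponents card ann]
  show ?thesis
    using veronese_variety_of_monomials[OF w] germ_eq_veronese[OF assms(1) w *] by blast
qed

end
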